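(* Let $X$ be a finite connected CW complex of dimension $d\ge1$, and let $W\colon X_d\to\mathbb{R}$, $b\mapsto W_b$, be a function. Let $A\subset C_{d-1}(X;\mathbb{Z})$ be a subgroup such that the orthogonal projection $P_A\colon B_{d-1}(X;\mathbb{R})\to A_{\mathbb{R}}$ is induced by a real isomorphism $p_A\colon B_{d-1}(X;\mathbb{Z})\to A$, i.e. $P_A=(p_A)_{\mathbb{R}}$. Let $\mathcal{L}_A\colon A_{\mathbb{R}}\to A_{\mathbb{R}}$ be the operator $\mathcal{L}_A=P_A\,\partial e^{-W}\partial^*|_{A_{\mathbb{R}}}$. Then $$\det\mathcal{L}_A=\gamma_A\sum_T w_T,$$ where the sum is over all spanning trees $T$ of $X$ and the prefactor is given by $$\gamma_A=\frac{\mu(A)\,t(p_A)^2}{\theta_X^2}.$$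
   Context: Notation. $X_k$ is the set of $k$-cells of $X$, $X^{(k)}$ its $k$-skeleton, $C_k(X;U)$ the cellular chain group (free $U$-module on $X_k$), $\partial\colon C_d\to C_{d-1}$ the cellular boundary, $B_{d-1}(X;U)$ the image of $\partial\colon C_d(X;U)\to C_{d-1}(X;U)$; all homology is cellular, $\beta_k$ is the $k$-th Betti number. The standard inner product $\langle\ ,\ \rangle$ on $C_k(X;\mathbb{R})$ is the one for which $X_k$ is an orthonormal basis, and $\partial^*$ is the adjoint of $\partial$ for the standard inner products. $e^{-W}\colon C_d(X;\mathbb{R})\to C_d(X;\mathbb{R})$ is the linear map $b\mapsto e^{-W_b}b$ for $b\in X_d$. Realification. For an abelian group $A$, $A_{\mathbb{R}}=A\otimes_{\mathbb{Z}}\mathbb{R}$; for $A\subset C_{d-1}(X;\mathbb{Z})$ it is identified with the real span of $A$ in $C_{d-1}(X;\mathbb{R})$. For a homomorphism $\alpha$, $\alpha_{\mathbb{R}}$ is the induced real linear map. The map $P_A$ is the restriction to $B_{d-1}(X;\mathbb{R})$ of the orthogonal projection of $C_{d-1}(X;\mathbb{R})$ onto $A_{\mathbb{R}}$ (standard inner product). A homomorphism $\alpha\colon A\to B$ of finitely generated free abelian groups is a real isomorphism if $\alpha_{\mathbb{R}}$ is an isomorphism (equivalently, $\alpha$ is injective with finite cokernel); then $t(\alpha)$ is the order of its cokernel $B/\alpha(A)$. $\mu(A)$. For a subgroup $A\subset C_{d-1}(X;\mathbb{Z})$ with basis $\{e_i\}$, $\mu(A)=\det(\langle e_i,e_j\rangle)_{i,j}$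 (equivalently the square of the covolume of $A\subset A_{\mathbb{R}}$ for the standard inner product). Spanning trees and weights. A spanning tree for $X$ is a subcomplex $T\subset X$ such that $H_d(T;\mathbb{Z})=0$, $\beta_{d-1}(T)=\beta_{d-1}(X)$, and $X^{(d-1)}\subset T$; $T_d$ is its set of $d$-cells. For $Y=X$ or $Y=T$, $\theta_Y$ is the order of the torsion subgroup of $H_{d-1}(Y;\mathbb{Z})$, and $w_T=\theta_T^2\prod_{b\in T_d}e^{-W_b}$. *)

theory Defs
  imports "HOL-Homology.Homology" "HOL-Analysis.Finite_Function_Topology"
    "Jordan_Normal_Form.Determinant"
begin

definition disk :: "nat \<Rightarrow> (nat \<Rightarrow> real) topology" where
  "disk k = subtopology (Euclidean_space k) {x. (\<Sum>i<k. (x i)\<^sup>2) \<le> 1}"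

definition disk_interior :: "nat \<Rightarrow> (nat \<Rightarrow> real) set" where
  "disk_interior k = {x \<in> topspace (disk k). (\<Sum>i<k. (x i)\<^sup>2) < 1}"

definition disk_boundary :: "nat \<Rightarrow> (nat \<Rightarrow> real) set" where
  "disk_boundary k = {x \<in> topspace (disk k). (\<Sum>i<k. (x i)\<^sup>2) = 1}"

text \<open>Cells are given by labels: \<open>cells X k\<close> is the set of labels of the \<open>k\<close>-cells, and
  \<open>char_map X k c\<close> is the characteristic map of the \<open>k\<close>-cell labelled \<open>c\<close>; its values outside
  \<open>disk k\<close>, or for \<open>c \<notin> cells X k\<close>, carry no meaning.\<close>

record ('a, 'c) cw =
  cw_space :: "'a topology"
  cells :: "nat \<Rightarrow> 'c set"
  char_map :: "nat \<Rightarrow> 'c \<Rightarrow> (nat \<Rightarrow> real) \<Rightarrow> 'a"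

definition open_cell :: "('a, 'c) cw \<Rightarrow> nat \<Rightarrow> 'c \<Rightarrow> 'a set" where
  "open_cell X k c = char_map X k c ` disk_interior k"

definition CW_complex :: "('a, 'c) cw \<Rightarrow> bool" where
  "CW_complex X \<longleftrightarrow>
     Hausdorff_space (cw_space X) \<and>
     (\<forall>k. \<forall>c\<in>cells X k.
        continuous_map (disk k) (cw_space X) (char_map X k c) \<and>
        embedding_map (subtopology (disk k) (disk_interior k)) (cw_space X) (char_map X k c)) \<and>
     (\<forall>k l. \<forall>c\<in>cells X k. \<forall>e\<in>cells X l.
        (k, c) \<noteq> (l, e) \<longrightarrow> open_cell X k c \<inter> open_cell X l e = {}) \<and>
     topspace (cw_space X) = (\<Union>k. \<Union>c\<in>cells X k. open_cell X k c) \<and>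
     (\<forall>k. \<forall>c\<in>cells X k. \<exists>F. finite F \<and> F \<subseteq> (SIGMA j:{..<k}. cells X j) \<and>
        char_map X k c ` disk_boundary k \<subseteq> (\<Union>(j, e)\<in>F. open_cell X j e)) \<and>
     (\<forall>S. S \<subseteq> topspace (cw_space X) \<longrightarrow>
        (closedin (cw_space X) S \<longleftrightarrow>
          (\<forall>k. \<forall>c\<in>cells X k. closedin (disk k) {x \<in> topspace (disk k). char_map X k c x \<in> S})))"

definition finite_CW_complex :: "('a, 'c) cw \<Rightarrow> bool" where
  "finite_CW_complex X \<longleftrightarrow> CW_complex X \<and> finite (SIGMA k:UNIV. cells X k)"

definition has_dimension :: "('a, 'c) cw \<Rightarrow> nat \<Rightarrow> bool" where
  "has_dimension X d \<longleftrightarrow> cells X d \<noteq> {} \<and> (\<forall>k>d. cells X k = {})"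

text \<open>Skeleta are indexed by integers so that the \<open>(-1)\<close>- and \<open>(-2)\<close>-skeleton are empty.\<close>

definition skeleton :: "('a, 'c) cw \<Rightarrow> int \<Rightarrow> 'a set" where
  "skeleton X k = (\<Union>j\<in>{j. int j \<le> k}. \<Union>c\<in>cells X j. open_cell X j c)"

text \<open>A subcomplex is a union of cells containing the closure of each of its cells, with the
  subspace topology; the closure of a cell is the image of its characteristic map. Requiring the
  whole function \<open>char_map\<close> to agree makes a subcomplex determined by its set of cells.\<close>

definition subcomplex :: "('a, 'c) cw \<Rightarrow> ('a, 'c) cw \<Rightarrow> bool" where
  "subcomplex T X \<longleftrightarrow>
     (\<forall>k. cells T k \<subseteq> cells X k) \<and>
     char_map T = char_map X \<and>
     cw_space T = subtopology (cw_space X) (\<Union>k. \<Union>c\<in>cells T k. open_cell X k c) \<and>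
     (\<forall>k. \<forall>c\<in>cells T k. char_map X k c ` topspace (disk k) \<subseteq> topspace (cw_space T))"

type_synonym 'c zchain = "'c \<Rightarrow>\<^sub>0 int"
type_synonym 'c rchain = "'c \<Rightarrow>\<^sub>0 real"

text \<open>A generator of the infinite cyclic group \<open>H\<^sub>k(D\<^sup>k, S\<^sup>k\<^sup>-\<^sup>1)\<close>, i.e. an orientation of
  the standard disk, chosen once for each \<open>k\<close>. Together with the characteristic maps it orients
  all cells.\<close>

definition disk_class :: "nat \<Rightarrow> (nat \<Rightarrow> real) chain set" where
  "disk_class k =
     (let G = relative_homology_group (int k) (disk k) (disk_boundary k)
      in SOME g. g \<in> carrier G \<and> subgroup_generated G {g} = G)"

definition skeletal_homology :: "('a, 'c) cw \<Rightarrow> nat \<Rightarrow> 'a chain set monoid" where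
  "skeletal_homology X k =
     relative_homology_group (int k) (subtopology (cw_space X) (skeleton X (int k)))
       (skeleton X (int k - 1))"

text \<open>The classes of the \<open>k\<close>-cells form a basis of \<open>H\<^sub>k(X\<^sup>k, X\<^sup>k\<^sup>-\<^sup>1)\<close>.\<close>

definition cell_class :: "('a, 'c) cw \<Rightarrow> nat \<Rightarrow> 'c \<Rightarrow> 'a chain set" where
  "cell_class X k c =
     hom_induced (int k) (disk k) (disk_boundary k)
       (subtopology (cw_space X) (skeleton X (int k))) (skeleton X (int k - 1))
       (char_map X k c) (disk_class k)"

text \<open>For a \<open>(k+1)\<close>-cell \<open>a\<close>, the integral \<open>k\<close>-chain of incidence numbers of \<open>a\<close>: the coordinates
  of the image of the class of \<open>a\<close> under the boundary map
  \<open>H\<^sub>k\<^sub>+\<^sub>1(X\<^sup>k\<^sup>+\<^sup>1, X\<^sup>k) \<rightarrow> H\<^sub>k(X\<^sup>k, X\<^sup>k\<^sup>-\<^sup>1)\<close> of the triple of skeleta. The homology groups of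
  the library are written multiplicatively.\<close>

definition incidence :: "('a, 'c) cw \<Rightarrow> nat \<Rightarrow> 'c \<Rightarrow> 'c zchain" where
  "incidence X k a =
     (THE f. Poly_Mapping.keys f \<subseteq> cells X k \<and>
        hom_relboundary (int (Suc k)) (subtopology (cw_space X) (skeleton X (int (Suc k))))
          (skeleton X (int k)) (skeleton X (int k - 1)) (cell_class X (Suc k) a)
        = finprod (skeletal_homology X k)
            (\<lambda>b. cell_class X k b [^]\<^bsub>skeletal_homology X k\<^esub> Poly_Mapping.lookup f b)
            (Poly_Mapping.keys f))"

text \<open>\<open>C\<^sub>k(X;U)\<close> as the free \<open>U\<close>-module on the \<open>k\<close>-cells.\<close>

definition chains :: "('a, 'c) cw \<Rightarrow> nat \<Rightarrow> ('c \<Rightarrow>\<^sub>0 'u::comm_ring_1) set" where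
  "chains X k = {x. Poly_Mapping.keys x \<subseteq> cells X k}"

fun boundary_map :: "('a, 'c) cw \<Rightarrow> nat \<Rightarrow> ('c \<Rightarrow>\<^sub>0 'u::comm_ring_1) \<Rightarrow> ('c \<Rightarrow>\<^sub>0 'u)" where
  "boundary_map X 0 x = 0"
| "boundary_map X (Suc k) x =
     (\<Sum>a\<in>Poly_Mapping.keys x.
        Poly_Mapping.map (\<lambda>n. Poly_Mapping.lookup x a * of_int n) (incidence X k a))"

definition cycles :: "('a, 'c) cw \<Rightarrow> nat \<Rightarrow> ('c \<Rightarrow>\<^sub>0 'u::comm_ring_1) set" where
  "cycles X k = {x \<in> chains X k. boundary_map X k x = 0}"

definition boundaries :: "('a, 'c) cw \<Rightarrow> nat \<Rightarrow> ('c \<Rightarrow>\<^sub>0 'u::comm_ring_1) set" where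
  "boundaries X k = boundary_map X (Suc k) ` chains X (Suc k)"

definition chain_subgroup :: "'c zchain set \<Rightarrow> 'c zchain monoid" where
  "chain_subgroup A = (free_Abelian_group UNIV)\<lparr>carrier := A\<rparr>"

definition cellular_homology :: "('a, 'c) cw \<Rightarrow> nat \<Rightarrow> 'c zchain set monoid" where
  "cellular_homology X k = chain_subgroup (cycles X k) Mod boundaries X k"

text \<open>The largest number of elements independent over the integers; only meaningful for
  abelian groups of finite rank.\<close>

definition abelian_rank :: "('g, 'm) monoid_scheme \<Rightarrow> nat" where
  "abelian_rank G =
     Max {card S |S. finite S \<and> S \<subseteq> carrier G \<and>
       (\<forall>n::'g \<Rightarrow> int. finprod G (\<lambda>x. x [^]\<^bsub>G\<^esub> n x) S = \<one>\<^bsub>G\<^esub> \<longrightarrow> (\<forall>x\<in>S. n x = 0))}"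

definition betti :: "('a, 'c) cw \<Rightarrow> nat \<Rightarrow> nat" where
  "betti X k = abelian_rank (cellular_homology X k)"

definition torsion_order :: "('g, 'm) monoid_scheme \<Rightarrow> nat" where
  "torsion_order G = card {x \<in> carrier G. \<exists>n::nat. n > 0 \<and> x [^]\<^bsub>G\<^esub> n = \<one>\<^bsub>G\<^esub>}"

definition chain_inner :: "'c rchain \<Rightarrow> 'c rchain \<Rightarrow> real" where
  "chain_inner x y =
     (\<Sum>c\<in>Poly_Mapping.keys x. Poly_Mapping.lookup x c * Poly_Mapping.lookup y c)"

definition real_chain :: "'c zchain \<Rightarrow> 'c rchain" where
  "real_chain = Poly_Mapping.map real_of_int"

definition realification :: "'c zchain set \<Rightarrow> 'c rchain set" where
  "realification A = span (real_chain ` A)"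

text \<open>The real linear map induced by a homomorphism \<open>\<alpha>\<close> defined on \<open>A\<close>; it is determined on
  \<open>realification A\<close> only.\<close>

definition real_hom :: "'c zchain set \<Rightarrow> ('c zchain \<Rightarrow> 'c zchain) \<Rightarrow> 'c rchain \<Rightarrow> 'c rchain" where
  "real_hom A \<alpha> = (SOME F. linear F \<and> (\<forall>a\<in>A. F (real_chain a) = real_chain (\<alpha> a)))"

definition real_isomorphism :: "'c zchain set \<Rightarrow> 'c zchain set \<Rightarrow> ('c zchain \<Rightarrow> 'c zchain) \<Rightarrow> bool" where
  "real_isomorphism A B \<alpha> \<longleftrightarrow>
     \<alpha> \<in> hom (chain_subgroup A) (chain_subgroup B) \<and>
     bij_betw (real_hom A \<alpha>) (realification A) (realification B)"

definition cokernel_order :: "'c zchain set \<Rightarrow> 'c zchain set \<Rightarrow> ('c zchain \<Rightarrow> 'c zchain) \<Rightarrow> nat" where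
  "cokernel_order A B \<alpha> = Coset.order (chain_subgroup B Mod (\<alpha> ` A))"

definition orthogonal_projection ::
    "'c rchain set \<Rightarrow> 'c rchain \<Rightarrow> 'c rchain" where
  "orthogonal_projection V x = (THE y. y \<in> V \<and> (\<forall>v\<in>V. chain_inner (x - y) v = 0))"

text \<open>The adjoint, defined on \<open>C\<^sub>k\<^sub>-\<^sub>1(X;\<real>)\<close>, of the boundary map defined on \<open>C\<^sub>k(X;\<real>)\<close>.\<close>

definition coboundary_map :: "('a, 'c) cw \<Rightarrow> nat \<Rightarrow> 'c rchain \<Rightarrow> 'c rchain" where
  "coboundary_map X k y =
     (THE x. x \<in> chains X k \<and>
        (\<forall>v\<in>chains X k. chain_inner (boundary_map X k v) y = chain_inner v x))"

definition exp_weight :: "('c \<Rightarrow> real) \<Rightarrow> 'c rchain \<Rightarrow> 'c rchain" where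
  "exp_weight W = Poly_Mapping.mapp (\<lambda>b r. exp (- W b) * r)"

definition operator_det ::
    "'c rchain set \<Rightarrow> ('c rchain \<Rightarrow> 'c rchain) \<Rightarrow> real" where
  "operator_det V L =
     (let bs = (SOME bs. distinct bs \<and> independent (set bs) \<and> span (set bs) = V)
      in Determinant.det (Matrix.mat (length bs) (length bs)
           (\<lambda>(i, j). representation (set bs) (L (bs ! j)) (bs ! i))))"

definition lattice_basis :: "'c zchain set \<Rightarrow> 'c zchain list \<Rightarrow> bool" where
  "lattice_basis A es \<longleftrightarrow>
     distinct es \<and> \<not> Modules.module.dependent frag_cmul (set es) \<and>
     Modules.module.span frag_cmul (set es) = A"

definition gram_det :: "'c zchain set \<Rightarrow> real" where
  "gram_det A =
     (let es = (SOME es. lattice_basis A es)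
      in Determinant.det (Matrix.mat (length es) (length es)
           (\<lambda>(i, j). chain_inner (real_chain (es ! i)) (real_chain (es ! j)))))"

definition reduced_laplacian ::
    "('a, 'c) cw \<Rightarrow> nat \<Rightarrow> ('c \<Rightarrow> real) \<Rightarrow> 'c zchain set \<Rightarrow> 'c rchain \<Rightarrow> 'c rchain" where
  "reduced_laplacian X d W A x =
     orthogonal_projection (realification A)
       (boundary_map X d (exp_weight W (coboundary_map X d x)))"

definition homology_torsion :: "('a, 'c) cw \<Rightarrow> nat \<Rightarrow> nat" where
  "homology_torsion Y d = torsion_order (cellular_homology Y (d - 1))"

definition spanning_trees :: "('a, 'c) cw \<Rightarrow> nat \<Rightarrow> ('a, 'c) cw set" where
  "spanning_trees X d =
     {T. subcomplex T X \<and>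
         trivial_group (cellular_homology T d) \<and>
         betti T (d - 1) = betti X (d - 1) \<and>
         (\<forall>k<d. cells X k \<subseteq> cells T k)}"

definition tree_weight :: "('c \<Rightarrow> real) \<Rightarrow> nat \<Rightarrow> ('a, 'c) cw \<Rightarrow> real" where
  "tree_weight W d T = (real (homology_torsion T d))\<^sup>2 * (\<Prod>b\<in>cells T d. exp (- W b))"

end

theory Submission
  imports Defs
begin

text \<open>
  The operator whose determinant is computed is governed by the bilinear form
  \<open>(x, y) \<mapsto> \<Sum>\<^sub>a exp (- W a) \<langle>x, \<partial>a\<rangle> \<langle>\<partial>a, y\<rangle>\<close> on the real span of \<open>A\<close>, the sum being over the \<open>d\<close>-cells \<open>a\<close>.
  In a basis with \<open>r\<close> elements this form has a matrix \<open>Q D Q\<^sup>T\<close> with \<open>D\<close> diagonal, and the Cauchy-Binet formula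
  (\<open>det_weighted_gram\<close>) turns its determinant into a sum over the sets \<open>S\<close> of \<open>r\<close> cells. As \<open>p\<close> induces the
  orthogonal projection, \<open>\<langle>x, \<partial>a\<rangle> = \<langle>x, p (\<partial>a)\<rangle>\<close> for \<open>x\<close> in the span of \<open>A\<close>, and the summand of \<open>S\<close>, divided by the Gram
  determinant of the basis, is the weight of \<open>S\<close> times the Gram determinant of the elements \<open>p (\<partial>a)\<close>, \<open>a \<in> S\<close>
  (\<open>operator_det_laplacian\<close>).

  Such a Gram determinant vanishes if the elements are dependent. Otherwise it is \<open>\<mu>(A)\<close> times the square of the index in
  \<open>A\<close> of the subgroup that they generate (\<open>gram_lattice_index\<close>). If \<open>B\<close> denotes the group of integral boundaries and \<open>U\<close>
  the subgroup generated by the \<open>\<partial>a\<close>, \<open>a \<in> S\<close>, then this index is \<open>[A : p U] = [A : p B] [B : U] = t(p) [B : U]\<close>.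

  It remains to read \<open>S\<close> and \<open>[B : U]\<close> topologically. Let \<open>T\<close> be the union of the \<open>(d-1)\<close>-skeleton and the cells in
  \<open>S\<close>. That \<open>H\<^sub>d(T)\<close> vanishes means that the \<open>\<partial>a\<close> are independent, and then equality of the Betti numbers means that \<open>S\<close>
  has as many elements as the rank of \<open>B\<close>, which is \<open>r\<close> (\<open>with_top_cells_spanning_tree_iff\<close>). The torsion subgroups of
  \<open>H\<^sub>d\<^sub>-\<^sub>1(X)\<close> and \<open>H\<^sub>d\<^sub>-\<^sub>1(T)\<close> are the quotients by \<open>B\<close> and by \<open>U\<close> of one and the same group of chains, so
  \<open>\<theta>\<^sub>T = \<theta>\<^sub>X [B : U]\<close> (\<open>torsion_index\<close>). Altogether a tree contributes \<open>\<mu>(A) t(p)\<^sup>2 \<theta>\<^sub>T\<^sup>2 / \<theta>\<^sub>X\<^sup>2\<close> times its exponential factor.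

  Topology enters at two points. The cycles must contain the boundaries (\<open>boundary_of_boundary\<close>), and the incidence numbers
  of \<open>T\<close> must be those of \<open>X\<close> (\<open>incidence_subcomplex\<close>). The second is naturality of the connecting homomorphism. The first
  needs the incidence numbers to be well defined, that is, the classes of the \<open>k\<close>-cells to be a basis of the homology of
  the \<open>k\<close>-skeleton relative to the \<open>(k-1)\<close>-skeleton. This follows from the case of one attached cell
  (\<open>iso_attached_cell\<close>): attaching the cells successively gives generation (\<open>part_homology_generated\<close>), and collapsing
  all cells but one gives independence (\<open>part_classes_independent\<close>).

  The algebra rests on one normal form: a subgroup of a free abelian group of finite rank has generators that are
  triangular with respect to a given basis (\<open>triangular_generators\<close>). It yields the existence of bases, and the equality
  between an index and the absolute value of a determinant (\<open>lattice_index_det\<close>).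
\<close>

section \<open>The standard disk\<close>

definition radius :: "nat \<Rightarrow> (nat \<Rightarrow> real) \<Rightarrow> real" where
  "radius k v = sqrt (\<Sum>i<k. (v i)\<^sup>2)"

lemma radius_nonneg: "0 \<le> radius k v"
  by (simp add: radius_def sum_nonneg)

lemma radius_scale: "radius k (\<lambda>i. v i * c) = radius k v * \<bar>c\<bar>"
  by (simp add: radius_def power_mult_distrib flip: sum_distrib_right) (simp add: real_sqrt_mult)

text \<open>
  Functions carry the product topology, so continuity on the disk can be tested on coordinates.
\<close>

lemma disk_eq: "disk k = top_of_set {x. (\<forall>i\<ge>k. x i = 0) \<and> radius k x \<le> 1}"
  unfolding disk_def Euclidean_space_def radius_def
  by (simp add: subtopology_subtopology euclidean_product_topology Collect_conj_eq)

lemma topspace_disk: "topspace (disk k) = {x. (\<forall>i\<ge>k. x i = 0) \<and> radius k x \<le> 1}"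
  by (simp add: disk_eq)

lemma disk_interior_eq: "disk_interior k = {x \<in> topspace (disk k). radius k x < 1}"
  by (simp add: disk_interior_def radius_def)

lemma disk_boundary_eq: "disk_boundary k = {x \<in> topspace (disk k). radius k x = 1}"
  by (simp add: disk_boundary_def radius_def)

lemma continuous_on_radius: "continuous_on S (radius k)"
  unfolding radius_def
  by (intro continuous_intros continuous_on_subset[OF continuous_on_product_coordinates]) auto

lemma disk_interior_Un_boundary: "topspace (disk k) = disk_interior k \<union> disk_boundary k"
  by (auto simp: disk_interior_eq disk_boundary_eq topspace_disk)

lemma disk_interior_boundary_disjoint: "disk_interior k \<inter> disk_boundary k = {}"
  by (auto simp: disk_interior_eq disk_boundary_eq topspace_disk)

lemma Hausdorff_disk: "Hausdorff_space (disk k)"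
  by (simp add: disk_eq Hausdorff_space_subtopology)

text \<open>
  The disk is a closed subset of a product of compact intervals and points.
\<close>

lemma compact_disk: "compact_space (disk k)"
proof -
  let ?B = "\<Pi>\<^sub>E i\<in>UNIV. if i < k then {-1..1} else {0::real}"
  let ?D = "{x. (\<forall>i\<ge>k. x i = 0) \<and> radius k x \<le> 1}"
  have "compactin (powertop_real UNIV) ?B"
    by (subst compactin_PiE) auto
  then have B: "compact ?B"
    by (simp add: euclidean_product_topology)
  have sub: "?D \<subseteq> ?B"
  proof (clarsimp simp: PiE_iff)
    fix x i assume "radius k x \<le> 1" "i < k"
    have "(x i)\<^sup>2 \<le> (\<Sum>i<k. (x i)\<^sup>2)"
      using \<open>i < k\<close> by (intro member_le_sum) auto
    then have "\<bar>x i\<bar> \<le> radius k x"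
      unfolding radius_def by (metis real_sqrt_abs real_sqrt_le_iff)
    then show "- 1 \<le> x i \<and> x i \<le> 1" using \<open>radius k x \<le> 1\<close> by auto
  qed
  have "?D = (\<Inter>i\<in>{k..}. {x. x i = 0}) \<inter> {x. radius k x \<le> 1}" by auto
  moreover have "closed {x::nat\<Rightarrow>real. x i = 0}" for i
    by (intro closed_Collect_eq continuous_on_product_coordinates) auto
  moreover have "closed {x. radius k x \<le> 1}"
    by (intro closed_Collect_le continuous_on_radius) auto
  ultimately have "closed ?D" by (simp only:) (intro closed_Int closed_INT ballI)
  then have "compact ?D"
    using compact_Int_closed[OF B, of ?D] sub by (simp only: inf.absorb2)
  then show ?thesis
    by (simp add: disk_eq compact_space_subtopology)
qed

text \<open>
  Radial stretching, as a homotopy in \<open>t\<close> that starts at the identity. At \<open>t = 1\<close> it doubles the ball of radius \<open>1/2\<close>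
  onto the disk and throws everything outside that ball radially onto the sphere. The maximum avoids a division by
  zero at the centre, so the formula is continuous on the whole disk.
\<close>

definition stretch :: "nat \<Rightarrow> real \<Rightarrow> (nat \<Rightarrow> real) \<Rightarrow> nat \<Rightarrow> real" where
  "stretch k t v = (\<lambda>i. v i * ((1 - t) + t / max (1/2) (radius k v)))"

lemma radius_stretch:
  assumes "0 \<le> t" "t \<le> 1" "radius k v \<le> 1"
  shows "radius k (stretch k t v) \<le> 1" "radius k v \<le> radius k (stretch k t v)"
    "radius k v = 1 \<Longrightarrow> stretch k t v = v"
    "1/2 < radius k v \<Longrightarrow> radius k (stretch k 1 v) = 1"
proof -
  let ?r = "radius k v" and ?c = "(1 - t) + t / max (1/2) (radius k v)"
  have r: "0 \<le> ?r" by (rule radius_nonneg)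
  have m: "1 \<le> 1 / max (1/2) ?r" using assms by (simp add: field_simps)
  have "t * 1 \<le> t * (1 / max (1/2) ?r)" using m assms by (intro mult_left_mono) auto
  then have c: "1 \<le> ?c" by simp
  have eq: "radius k (stretch k t v) = ?r * ?c"
    unfolding stretch_def using c by (simp add: radius_scale)
  show "?r \<le> radius k (stretch k t v)" unfolding eq using mult_left_mono[OF c r] by simp
  have "?r * (1 / max (1/2) ?r) \<le> 1" by (simp add: field_simps max_def)
  then have "t * (?r * (1 / max (1/2) ?r)) \<le> t * 1" using assms by (intro mult_left_mono) auto
  moreover have "(1 - t) * ?r \<le> (1 - t) * 1" using assms by (intro mult_left_mono) auto
  ultimately show "radius k (stretch k t v) \<le> 1" unfolding eq by (simp add: algebra_simps)
  show "stretch k t v = v" if "?r = 1" using that by (simp add: stretch_def)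
  show "radius k (stretch k 1 v) = 1" if "1/2 < ?r"
  proof -
    have "max (1/2) ?r = ?r" using that by simp
    then show ?thesis unfolding stretch_def using that radius_scale[of k v "1 / radius k v"] by simp
  qed
qed

lemma stretch_0 [simp]: "stretch k 0 v = v"
  by (simp add: stretch_def)

lemma stretch_in_disk:
  assumes "0 \<le> t" "t \<le> 1" "v \<in> topspace (disk k)"
  shows "stretch k t v \<in> topspace (disk k)"
  using assms radius_stretch(1)[of t k v] unfolding topspace_disk by (simp add: stretch_def)

lemma continuous_map_stretch:
  "continuous_map (prod_topology (top_of_set {0..1}) (disk k)) (disk k) (\<lambda>(t, v). stretch k t v)"
proof -
  let ?D = "{x. (\<forall>i\<ge>k. x i = 0) \<and> radius k x \<le> 1}"
  have c: "continuous_on ({0..1} \<times> ?D) (\<lambda>z. radius k (snd z))"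
    by (rule continuous_on_compose2[OF continuous_on_radius[of UNIV]]) (auto intro: continuous_intros)
  have "continuous_on ({0..1} \<times> ?D) (\<lambda>z. snd z i * ((1 - fst z) + fst z / max (1/2) (radius k (snd z))))" for i
  proof -
    have "continuous_on UNIV (\<lambda>x::nat\<Rightarrow>real. x i)" by (rule continuous_on_product_coordinates)
    then have "continuous_on ({0..1} \<times> ?D) (\<lambda>z::real \<times> (nat \<Rightarrow> real). snd z i)"
      by (rule continuous_on_compose2) (auto intro: continuous_intros)
    then show ?thesis by (intro continuous_intros c) auto
  qed
  then have "continuous_on ({0..1} \<times> ?D) (\<lambda>(t, v). stretch k t v)"
    unfolding stretch_def case_prod_unfold
    by (intro continuous_on_coordinatewise_then_product)
  moreover have "(\<lambda>(t, v). stretch k t v) \<in> {0..1} \<times> ?D \<rightarrow> ?D"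
    using stretch_in_disk[of _ _ k] by (fastforce simp: topspace_disk)
  ultimately show ?thesis
    by (simp add: disk_eq prod_topology_subtopology_eu continuous_map_in_subtopology)
qed

section \<open>Attaching one cell\<close>

text \<open>
  The space \<open>Z\<close> arises from its closed subspace \<open>Y\<close> by attaching one \<open>k\<close>-cell with characteristic map \<open>\<phi>\<close>.
\<close>

locale cell_attachment =
  fixes Z :: "'a topology" and Y :: "'a set" and k :: nat and \<phi> :: "(nat \<Rightarrow> real) \<Rightarrow> 'a"
  assumes Hausdorff: "Hausdorff_space Z"
    and closed: "closedin Z Y"
    and cont: "continuous_map (disk k) Z \<phi>"
    and embed: "embedding_map (subtopology (disk k) (disk_interior k)) Z \<phi>"
    and bound: "\<phi> ` disk_boundary k \<subseteq> Y"
    and topspace: "topspace Z = Y \<union> \<phi> ` disk_interior k"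
    and disj: "Y \<inter> \<phi> ` disk_interior k = {}"
begin

text \<open>
  A neighbourhood of \<open>Y\<close> that can be pushed into \<open>Y\<close>. It is an intermediate subspace that makes excision applicable.
\<close>

definition collar :: "'a set" where
  "collar = Y \<union> \<phi> ` {v \<in> topspace (disk k). 1/2 < radius k v}"

text \<open>
  Stretching of the attached cell, transported along \<open>\<phi>\<close> and extended by the identity on \<open>Y\<close>.
\<close>

definition push :: "real \<Rightarrow> 'a \<Rightarrow> 'a" where
  "push t z = (if z \<in> Y then z else \<phi> (stretch k t (inv_into (disk_interior k) \<phi> z)))"

lemma topspace_interior: "topspace (subtopology (disk k) (disk_interior k)) = disk_interior k"
  by (auto simp: disk_interior_eq)

lemma inj: "inj_on \<phi> (disk_interior k)"
  using embed unfolding embedding_map_def homeomorphic_map_def topspace_interior by blast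

lemma image_disk: "\<phi> ` topspace (disk k) \<subseteq> topspace Z"
  using cont by (simp add: continuous_map_image_subset_topspace)

lemma push_cell:
  assumes "v \<in> topspace (disk k)" "0 \<le> t" "t \<le> 1"
  shows "push t (\<phi> v) = \<phi> (stretch k t v)"
proof (cases "v \<in> disk_interior k")
  case True
  then show ?thesis using disj inj by (auto simp: push_def)
next
  case False
  then have "v \<in> disk_boundary k" using assms disk_interior_Un_boundary by blast
  then show ?thesis
    using bound assms radius_stretch(3)[of t k v] by (auto simp: push_def disk_boundary_eq)
qed

lemma push_base: "z \<in> Y \<Longrightarrow> push t z = z"
  by (simp add: push_def)

lemma topspace_cases:
  assumes "z \<in> topspace Z"
  obtains "z \<in> Y" | v where "v \<in> topspace (disk k)" "v \<in> disk_interior k" "z = \<phi> v"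
  using assms unfolding topspace by (auto simp: disk_interior_eq)

lemma push_0: "z \<in> topspace Z \<Longrightarrow> push 0 z = z"
  by (erule topspace_cases) (auto simp: push_base push_cell)

lemma push_collar:
  assumes "0 \<le> t" "t \<le> 1" shows "push t \<in> collar \<rightarrow> collar"
proof
  fix z assume "z \<in> collar"
  then consider "z \<in> Y" | v where "v \<in> topspace (disk k)" "1/2 < radius k v" "z = \<phi> v"
    by (auto simp: collar_def)
  then show "push t z \<in> collar"
  proof cases
    case 2
    then have "radius k v \<le> radius k (stretch k t v)"
      using assms by (intro radius_stretch) (auto simp: topspace_disk)
    then have "1/2 < radius k (stretch k t v)" using 2 by linarith
    then show ?thesis using 2 assms stretch_in_disk[of t v k] by (auto simp: push_cell collar_def)
  qed (simp add: push_base collar_def)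
qed

lemma push_collar_1: "push 1 \<in> collar \<rightarrow> Y"
proof
  fix z assume "z \<in> collar"
  then consider "z \<in> Y" | v where "v \<in> topspace (disk k)" "1/2 < radius k v" "z = \<phi> v"
    by (auto simp: collar_def)
  then show "push 1 z \<in> Y"
  proof cases
    case 2
    then have "radius k (stretch k 1 v) = 1"
      by (intro radius_stretch(4)[of 0]) (auto simp: topspace_disk)
    then have "stretch k 1 v \<in> disk_boundary k"
      using 2 stretch_in_disk[of 1 v k] by (auto simp: disk_boundary_eq)
    then show ?thesis using 2 bound by (auto simp: push_cell)
  qed (simp add: push_base)
qed

text \<open>
  Continuity is tested on the closed pieces \<open>Y\<close> and \<open>\<phi> (disk)\<close>. On the second piece, \<open>\<phi>\<close> times the identity of the
  interval is a map from a compact space onto a Hausdorff space and hence a quotient map, so that continuity can be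
  tested on the disk itself.
\<close>

lemma continuous_map_push:
  "continuous_map (prod_topology (top_of_set {0..1}) Z) Z (\<lambda>(t, z). push t z)"
proof -
  let ?I = "top_of_set {0..1::real}" and ?D = "\<phi> ` topspace (disk k)"
  let ?T = "\<lambda>b. {0..1::real} \<times> (if b then Y else ?D)"
  have cD: "closedin Z ?D"
    by (intro compactin_imp_closedin[OF Hausdorff] image_compactin[OF _ cont])
       (use compact_disk in \<open>simp add: compact_space_def\<close>)
  show ?thesis
  proof (rule pasting_lemma_closed[of "UNIV::bool set" _ ?T _ "\<lambda>_ (t, z). push t z"])
    fix b :: bool
    show "closedin (prod_topology ?I Z) (?T b)"
      using closed cD by (auto simp: closedin_prod_Times_iff)
    have "continuous_map (prod_topology ?I (subtopology Z Y)) Z (\<lambda>(t, z). push t z)"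
    proof (rule continuous_map_eq[where f = snd])
      show "continuous_map (prod_topology ?I (subtopology Z Y)) Z snd"
        using continuous_map_in_subtopology continuous_map_snd by blast
    qed (auto simp: push_base)
    moreover have "continuous_map (prod_topology ?I (subtopology Z ?D)) Z (\<lambda>(t, z). push t z)"
    proof (rule continuous_compose_quotient_map)
      have c: "continuous_map (disk k) (subtopology Z ?D) \<phi>"
        using cont by (simp add: continuous_map_in_subtopology)
      show "quotient_map (prod_topology ?I (disk k)) (prod_topology ?I (subtopology Z ?D)) (\<lambda>(t, v). (t, \<phi> v))"
      proof (rule continuous_imp_quotient_map)
        show "continuous_map (prod_topology ?I (disk k)) (prod_topology ?I (subtopology Z ?D)) (\<lambda>(t, v). (t, \<phi> v))"
          unfolding case_prod_unfold
          using continuous_map_compose[OF continuous_map_snd c]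
          by (intro continuous_map_pairedI continuous_map_fst) (auto simp: o_def)
        show "compact_space (prod_topology ?I (disk k))"
          by (simp add: compact_space_prod_topology compact_disk compact_space_subtopology)
        show "Hausdorff_space (prod_topology ?I (subtopology Z ?D))"
          using Hausdorff by (simp add: Hausdorff_space_prod_topology Hausdorff_space_subtopology)
        show "(\<lambda>(t, v). (t, \<phi> v)) ` topspace (prod_topology ?I (disk k)) = topspace (prod_topology ?I (subtopology Z ?D))"
          using image_disk by (auto simp: image_iff)
      qed
      show "continuous_map (prod_topology ?I (disk k)) Z ((\<lambda>(t, z). push t z) \<circ> (\<lambda>(t, v). (t, \<phi> v)))"
      proof (rule continuous_map_eq)
        show "continuous_map (prod_topology ?I (disk k)) Z (\<phi> \<circ> (\<lambda>(t, v). stretch k t v))"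
          by (rule continuous_map_compose[OF continuous_map_stretch cont])
      qed (auto simp: push_cell)
    qed
    ultimately show "continuous_map (subtopology (prod_topology ?I Z) (?T b)) Z (\<lambda>(t, z). push t z)"
      by (simp add: subtopology_Times subtopology_subtopology)
  next
    fix x assume "x \<in> topspace (prod_topology ?I Z)"
    then obtain t z where x: "x = (t, z)" "t \<in> {0..1}" and z: "z \<in> topspace Z" by auto
    from z have "z \<in> Y \<or> z \<in> ?D" by (rule topspace_cases) auto
    then have "x \<in> ?T True \<or> x \<in> ?T False" using x by simp
    then show "\<exists>b. b \<in> UNIV \<and> x \<in> ?T b \<and> (case x of (t, z) \<Rightarrow> push t z) = (case x of (t, z) \<Rightarrow> push t z)"
      by blast
  qed simp_all
qed

lemma homotopic_push:
  assumes "\<And>t. 0 \<le> t \<Longrightarrow> t \<le> 1 \<Longrightarrow> push t \<in> U \<rightarrow> U"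
  shows "homotopic_with (\<lambda>h. h \<in> U \<rightarrow> U) Z Z (push 1) id"
proof -
  have "homotopic_with (\<lambda>h. h \<in> U \<rightarrow> U) Z Z (push 0) (push 1)"
    unfolding homotopic_with_def using continuous_map_push assms by (intro exI[of _ "\<lambda>(t, z). push t z"]) simp
  then have "homotopic_with (\<lambda>h. h \<in> U \<rightarrow> U) Z Z (push 1) (push 0)"
    by (rule homotopic_with_symD)
  moreover have "homotopic_with (\<lambda>h. h \<in> U \<rightarrow> U) Z Z (push 0) id"
    using homotopic_with_imp_continuous_maps[OF calculation] assms[of 0] push_0
    by (intro homotopic_with_equal) auto
  ultimately show ?thesis by (rule homotopic_with_trans)
qed

lemma continuous_map_push_1: "continuous_map Z Z (push 1)"
  using homotopic_with_imp_continuous_maps[OF homotopic_push[of "{}"]] by simp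

text \<open>
  The pushing map is a homotopy inverse of the inclusion \<open>(Z, Y) \<rightarrow> (Z, collar)\<close>, the homotopies
  preserving \<open>Y\<close> and the collar respectively.
\<close>

lemma iso_into_collar:
  "hom_induced p Z Y Z collar id \<in> iso (relative_homology_group p Z Y) (relative_homology_group p Z collar)"
proof (rule homotopy_equivalence_relative_homology_group_isomorphism[where g = "push 1"])
  show "homotopic_with (\<lambda>h. h \<in> Y \<rightarrow> Y) Z Z (push 1 \<circ> id) id"
    using homotopic_push[of Y] by (simp add: push_base)
  show "homotopic_with (\<lambda>h. h \<in> collar \<rightarrow> collar) Z Z (id \<circ> push 1) id"
    using homotopic_push[of collar] push_collar by simp
qed (use push_collar_1 in \<open>auto simp: continuous_map_push_1 collar_def\<close>)

lemma openin_collar: "openin Z collar"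
proof -
  let ?K = "{v \<in> topspace (disk k). radius k v \<le> 1/2}"
  have "closedin (disk k) ?K"
  proof -
    have "continuous_map (disk k) euclideanreal (radius k)"
      using continuous_on_radius by (simp add: disk_eq)
    then show ?thesis
      using closedin_continuous_map_preimage[of "disk k" euclideanreal "radius k" "{..1/2}"] by simp
  qed
  then have "compactin (disk k) ?K"
    by (intro closedin_compact_space compact_disk)
  then have "closedin Z (\<phi> ` ?K)"
    by (intro compactin_imp_closedin[OF Hausdorff] image_compactin[OF _ cont])
  moreover have "topspace Z - collar = \<phi> ` ?K"
  proof -
    \<comment> \<open>The complement of the collar is the image of the closed ball of radius \<open>1/2\<close>, which is compact.\<close>
    have K: "?K \<subseteq> disk_interior k" by (auto simp: disk_interior_eq)
    have "z \<in> \<phi> ` ?K" if "z \<in> topspace Z" "z \<notin> collar" for z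
      using that(1)
    proof (rule topspace_cases)
      fix v assume "v \<in> topspace (disk k)" "v \<in> disk_interior k" "z = \<phi> v"
      with that(2) show "z \<in> \<phi> ` ?K" by (force simp: collar_def not_less)
    qed (use that(2) in \<open>auto simp: collar_def\<close>)
    moreover have "\<phi> v \<notin> collar" if v: "v \<in> ?K" for v
    proof
      assume "\<phi> v \<in> collar"
      moreover have "\<phi> v \<notin> Y" using v K disj by blast
      ultimately obtain w where w: "w \<in> topspace (disk k)" "1/2 < radius k w" "\<phi> v = \<phi> w"
        by (auto simp: collar_def)
      have "w \<in> disk_interior k"
        using w bound \<open>\<phi> v \<notin> Y\<close> disk_interior_Un_boundary[of k] by auto
      then have "v = w" using inj K v w by (meson inj_onD subsetD)
      then show False using v w by auto
    qed
    ultimately show ?thesis using image_disk by blast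
  qed
  moreover have "collar \<subseteq> topspace Z"
    using image_disk topspace by (auto simp: collar_def)
  ultimately show ?thesis
    by (simp add: openin_closedin_eq)
qed

lemma excision_collar:
  "hom_induced p (subtopology Z (topspace Z - Y)) (collar - Y) Z collar id
     \<in> iso (relative_homology_group p (subtopology Z (topspace Z - Y)) (collar - Y))
           (relative_homology_group p Z collar)"
proof -
  have "collar \<subseteq> topspace Z" using openin_collar by (rule openin_subset)
  moreover have "Z closure_of Y \<subseteq> Z interior_of collar"
    using closed openin_collar by (auto simp: closure_of_closedin interior_of_openin collar_def)
  ultimately show ?thesis
    using homology_excision_axiom[of Z Y collar "topspace Z" p] by simp
qed

end

text \<open>
  The disk is itself its bounding sphere with one cell attached. The statements about attached cells therefore also
  describe the pair of the disk and the sphere.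
\<close>

lemma cell_attachment_disk: "cell_attachment (disk k) (disk_boundary k) k id"
proof
  have "continuous_map (disk k) euclideanreal (radius k)"
    using continuous_on_radius by (simp add: disk_eq)
  then show "closedin (disk k) (disk_boundary k)"
    using closedin_continuous_map_preimage[of "disk k" euclideanreal "radius k" "{1}"]
    by (simp add: disk_boundary_eq)
  show "embedding_map (subtopology (disk k) (disk_interior k)) (disk k) id"
  proof -
    have "topspace (disk k) \<inter> disk_interior k = disk_interior k" by (auto simp: disk_interior_eq)
    then show ?thesis by (simp add: embedding_map_def)
  qed
qed (use disk_interior_Un_boundary disk_interior_boundary_disjoint Hausdorff_disk in auto)

context cell_attachment begin

text \<open>
  Both pairs are compared with their collars, and the collars are compared after excision of \<open>Y\<close> and of the sphere.
  What is then left of \<open>\<phi>\<close> is a homeomorphism.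
\<close>

theorem iso_attached_cell:
  "hom_induced p (disk k) (disk_boundary k) Z Y \<phi>
     \<in> iso (relative_homology_group p (disk k) (disk_boundary k)) (relative_homology_group p Z Y)"
proof -
  interpret D: cell_attachment "disk k" "disk_boundary k" k id by (rule cell_attachment_disk)
  let ?D0 = "subtopology (disk k) (topspace (disk k) - disk_boundary k)"
  let ?Z0 = "subtopology Z (topspace Z - Y)"
  let ?H = relative_homology_group
  let ?a = "hom_induced p (disk k) (disk_boundary k) (disk k) D.collar id"
  let ?b = "hom_induced p ?D0 (D.collar - disk_boundary k) (disk k) D.collar id"
  let ?c = "hom_induced p ?D0 (D.collar - disk_boundary k) ?Z0 (collar - Y) \<phi>"
  let ?e = "hom_induced p ?Z0 (collar - Y) Z collar id"
  let ?f = "hom_induced p Z Y Z collar id"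
  let ?g = "hom_induced p (disk k) D.collar Z collar \<phi>"
  let ?h = "hom_induced p (disk k) (disk_boundary k) Z Y \<phi>"
  have int: "topspace (disk k) - disk_boundary k = disk_interior k"
    using disk_interior_Un_boundary disk_interior_boundary_disjoint by blast
  have img: "\<phi> ` disk_interior k = topspace Z - Y" using topspace disj by blast
  have colD: "D.collar - disk_boundary k = {v \<in> disk_interior k. 1/2 < radius k v}"
    using disk_interior_Un_boundary[of k] disk_interior_boundary_disjoint[of k]
    unfolding D.collar_def image_id id_apply by blast
  have homeo: "homeomorphic_map ?D0 ?Z0 \<phi>"
    using embed by (simp only: embedding_map_def topspace_interior int img)
  have c_img: "\<phi> ` (D.collar - disk_boundary k) = collar - Y"
  proof -
    have "collar - Y = \<phi> ` {v \<in> topspace (disk k). 1/2 < radius k v} - Y"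
      by (auto simp: collar_def)
    also have "\<dots> = \<phi> ` {v \<in> disk_interior k. 1/2 < radius k v}"
      using bound disj disk_interior_Un_boundary[of k] by blast
    finally show ?thesis using colD by simp
  qed
  have iso_c: "?c \<in> iso (?H p ?D0 (D.collar - disk_boundary k)) (?H p ?Z0 (collar - Y))"
    by (intro homeomorphic_map_relative_homology_iso homeo c_img) (auto simp: colD int disk_interior_eq)
  have col: "\<phi> \<in> D.collar \<rightarrow> collar" using bound by (auto simp: collar_def D.collar_def)
  have c0: "continuous_map ?D0 ?Z0 \<phi>"
    using homeo by (rule homeomorphic_imp_continuous_map)
  \<comment> \<open>Naturality of the excision isomorphisms and of the inclusions into the collars.\<close>
  have comm1: "?g \<circ> ?b = ?e \<circ> ?c"
  proof -
    have "?g \<circ> ?b = hom_induced p ?D0 (D.collar - disk_boundary k) Z collar (\<phi> \<circ> id)"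
      by (rule hom_induced_compose[symmetric]) (use cont col in \<open>auto simp: continuous_map_from_subtopology\<close>)
    moreover have "?e \<circ> ?c = hom_induced p ?D0 (D.collar - disk_boundary k) Z collar (id \<circ> \<phi>)"
      by (rule hom_induced_compose[symmetric]) (use c0 c_img in \<open>auto simp: continuous_map_from_subtopology\<close>)
    ultimately show ?thesis by simp
  qed
  have comm2: "?f \<circ> ?h = ?g \<circ> ?a"
  proof -
    have "?g \<circ> ?a = hom_induced p (disk k) (disk_boundary k) Z collar (\<phi> \<circ> id)"
      by (rule hom_induced_compose[symmetric]) (use cont col in \<open>auto simp: D.collar_def\<close>)
    moreover have "?f \<circ> ?h = hom_induced p (disk k) (disk_boundary k) Z collar (id \<circ> \<phi>)"
      by (rule hom_induced_compose[symmetric]) (use cont bound in \<open>auto simp: collar_def\<close>)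
    ultimately show ?thesis by simp
  qed
  have a: "bij_betw ?a (carrier (?H p (disk k) (disk_boundary k))) (carrier (?H p (disk k) D.collar))"
    using D.iso_into_collar by (auto simp: iso_def)
  have b: "bij_betw ?b (carrier (?H p ?D0 (D.collar - disk_boundary k))) (carrier (?H p (disk k) D.collar))"
    using D.excision_collar by (auto simp: iso_def)
  have c: "bij_betw ?c (carrier (?H p ?D0 (D.collar - disk_boundary k))) (carrier (?H p ?Z0 (collar - Y)))"
    using iso_c by (auto simp: iso_def)
  have e: "bij_betw ?e (carrier (?H p ?Z0 (collar - Y))) (carrier (?H p Z collar))"
    using excision_collar by (auto simp: iso_def)
  have f: "bij_betw ?f (carrier (?H p Z Y)) (carrier (?H p Z collar))"
    using iso_into_collar by (auto simp: iso_def)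
  have g: "bij_betw ?g (carrier (?H p (disk k) D.collar)) (carrier (?H p Z collar))"
    using bij_betw_comp_iff[OF b, of ?g "carrier (?H p Z collar)"] bij_betw_trans[OF c e] comm1 by simp
  have hom: "?h \<in> hom (?H p (disk k) (disk_boundary k)) (?H p Z Y)"
    by (rule hom_induced_hom)
  have "bij_betw ?h (carrier (?H p (disk k) (disk_boundary k))) (carrier (?H p Z Y))"
    using bij_betw_comp_iff2[OF f, of ?h "carrier (?H p (disk k) (disk_boundary k))"]
      bij_betw_trans[OF a g] comm2 hom by (auto simp: hom_def)
  then show ?thesis using hom by (auto simp: iso_def)
qed

end

section \<open>Homology of the disk and of successive attachments\<close>

lemma hom_finprod:
  assumes "comm_group G" "comm_group H" "h \<in> hom G H" "f \<in> A \<rightarrow> carrier G"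
  shows "h (finprod G f A) = finprod H (\<lambda>x. h (f x)) A"
proof -
  interpret G: comm_group G by fact
  interpret H: comm_group H by fact
  interpret h: group_hom G H h
    using assms(3) by (simp add: group_hom_def group_hom_axioms_def G.is_group H.is_group)
  from assms(4) show ?thesis
    by (induction A rule: infinite_finite_induct) (auto simp: Pi_iff)
qed

text \<open>
  One step of an induction along the exact sequence of a triple. An element \<open>z\<close> of the middle group agrees, modulo the
  image of \<open>G\<close>, with a multiple of the one new generator.
\<close>

lemma generated_by_exactness:
  assumes comm: "comm_group G" "comm_group M" "comm_group R"
    and hom: "i \<in> hom G M" "j \<in> hom M R" and ex: "kernel M R j = i ` carrier G"
    and F: "finite F" "c \<notin> F"
    and a: "\<And>x. x \<in> F \<Longrightarrow> a x \<in> carrier G" and b: "\<And>x. x \<in> insert c F \<Longrightarrow> b x \<in> carrier M"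
    and ab: "\<And>x. x \<in> F \<Longrightarrow> i (a x) = b x"
    and gen: "\<And>y. y \<in> carrier G \<Longrightarrow> \<exists>n. y = finprod G (\<lambda>x. a x [^]\<^bsub>G\<^esub> (n x :: int)) F"
    and gen': "\<And>r. r \<in> carrier R \<Longrightarrow> \<exists>m::int. r = j (b c) [^]\<^bsub>R\<^esub> m"
    and z: "z \<in> carrier M"
  shows "\<exists>n. z = finprod M (\<lambda>x. b x [^]\<^bsub>M\<^esub> (n x :: int)) (insert c F)"
proof -
  interpret G: comm_group G by fact
  interpret M: comm_group M by fact
  interpret R: comm_group R by fact
  interpret i: group_hom G M i
    using hom by (simp add: group_hom_def group_hom_axioms_def G.is_group M.is_group)
  interpret j: group_hom M R j
    using hom by (simp add: group_hom_def group_hom_axioms_def R.is_group M.is_group)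
  obtain m :: int where "j z = j (b c) [^]\<^bsub>R\<^esub> m" using gen'[of "j z"] z by auto
  then have jz: "j z = j (b c [^]\<^bsub>M\<^esub> m)" using b by (simp add: j.hom_int_pow)
  let ?w = "b c [^]\<^bsub>M\<^esub> m"
  have w: "?w \<in> carrier M" using b by simp
  have "z \<otimes>\<^bsub>M\<^esub> inv\<^bsub>M\<^esub> ?w \<in> kernel M R j"
    using z w jz by (simp add: kernel_def)
  then obtain y where y: "y \<in> carrier G" "z \<otimes>\<^bsub>M\<^esub> inv\<^bsub>M\<^esub> ?w = i y"
    unfolding ex by blast
  then have z_eq: "z = i y \<otimes>\<^bsub>M\<^esub> ?w"
    using z w by (metis M.inv_solve_right i.hom_closed)
  obtain n :: "_ \<Rightarrow> int" where n: "y = finprod G (\<lambda>x. a x [^]\<^bsub>G\<^esub> n x) F"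
    using gen[OF y(1)] by blast
  have "i y = finprod M (\<lambda>x. i (a x [^]\<^bsub>G\<^esub> n x)) F"
    unfolding n by (rule hom_finprod) (use comm hom a in auto)
  also have "\<dots> = finprod M (\<lambda>x. b x [^]\<^bsub>M\<^esub> (n(c := m)) x) F"
    using a b ab F by (intro M.finprod_cong') (auto simp: i.hom_int_pow)
  finally have "i y = finprod M (\<lambda>x. b x [^]\<^bsub>M\<^esub> (n(c := m)) x) F" .
  moreover have "finprod M (\<lambda>x. b x [^]\<^bsub>M\<^esub> (n(c := m)) x) (insert c F)
      = ?w \<otimes>\<^bsub>M\<^esub> finprod M (\<lambda>x. b x [^]\<^bsub>M\<^esub> (n(c := m)) x) F"
    using F b by (subst M.finprod_insert) auto
  ultimately show ?thesis
    using z_eq w y by (metis M.m_comm i.hom_closed)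
qed

lemma exact_seq_kernel:
  "exact_seq ([A, B, C], [f, g]) \<Longrightarrow> kernel B A f = g ` carrier C"
  by simp

lemma contractible_space_disk: "contractible_space (disk k)"
proof -
  let ?D = "{x. (\<forall>i\<ge>k. x i = 0) \<and> radius k x \<le> 1}"
  have "continuous_on ({0..1} \<times> ?D) (\<lambda>z::real \<times> (nat \<Rightarrow> real). snd z i * (1 - fst z))" for i
  proof -
    have "continuous_on UNIV (\<lambda>x::nat\<Rightarrow>real. x i)" by (rule continuous_on_product_coordinates)
    then have "continuous_on ({0..1} \<times> ?D) (\<lambda>z::real \<times> (nat \<Rightarrow> real). snd z i)"
      by (rule continuous_on_compose2) (auto intro: continuous_intros)
    then show ?thesis by (intro continuous_intros)
  qed
  then have "continuous_on ({0..1} \<times> ?D) (\<lambda>(t, v) i. v i * (1 - t))"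
    unfolding case_prod_unfold by (intro continuous_on_coordinatewise_then_product)
  moreover have "(\<lambda>(t, v) i. v i * (1 - t)) \<in> {0..1} \<times> ?D \<rightarrow> ?D"
    by (auto simp: radius_scale radius_nonneg intro!: mult_le_one)
  ultimately have "continuous_map (prod_topology (top_of_set {0..1}) (disk k)) (disk k) (\<lambda>(t, v) i. v i * (1 - t))"
    by (simp add: disk_eq prod_topology_subtopology_eu continuous_map_in_subtopology)
  then show ?thesis
    unfolding contractible_space_def homotopic_with_def
    by (intro exI[of _ "\<lambda>i. 0"] exI[of _ "\<lambda>(t, v) i. v i * (1 - t)"]) auto
qed

text \<open>
  The connecting homomorphism identifies this group with the reduced homology of the sphere. The \<open>0\<close>-disk has an empty
  boundary and is treated as a one-point space.
\<close>

lemma disk_homology_integer: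
  "relative_homology_group (int k) (disk k) (disk_boundary k) \<cong> integer_group"
proof (cases k)
  case 0
  have "topspace (disk 0) = {\<lambda>i. 0}" by (auto simp: topspace_disk radius_def)
  moreover have "disk_boundary 0 = {}" by (auto simp: disk_boundary_eq radius_def)
  ultimately show ?thesis using 0 homology_coefficients by fastforce
next
  case (Suc n)
  have sphere: "subtopology (disk k) (disk_boundary k) = nsphere n"
  proof -
    let ?S = "{x::nat \<Rightarrow> real. (\<Sum>i\<le>n. (x i)\<^sup>2) = 1}"
    have "{x. (\<Sum>i<k. (x i)\<^sup>2) \<le> 1} \<inter> disk_boundary k = topspace (Euclidean_space (Suc n)) \<inter> ?S"
      by (auto simp: disk_boundary_def disk_def Suc lessThan_Suc_atMost)
    then show ?thesis
      unfolding disk_def nsphere_def subtopology_subtopology Suc by (simp only: subtopology_restrict)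
  qed
  have "nsphere n \<noteq> trivial_topology" by simp
  then have "topspace (disk k) \<inter> disk_boundary k \<noteq> {}"
    unfolding sphere[symmetric] by (metis null_topspace_iff_trivial topspace_subtopology)
  then have "relative_homology_group (int k) (disk k) (disk_boundary k) \<cong> reduced_homology_group (int n) (nsphere n)"
    using isomorphic_group_relative_homology_of_contractible[OF contractible_space_disk, of k "disk_boundary k" "int k"]
    by (simp only: sphere) (simp add: Suc)
  then show ?thesis
    using reduced_homology_group_nsphere(1) iso_trans by blast
qed

text \<open>
  The choice in the definition of the class of the disk is meaningful: the class generates an infinite cyclic group.
\<close>

lemma disk_class:
  defines "G \<equiv> \<lambda>k. relative_homology_group (int k) (disk k) (disk_boundary k)"
  shows "disk_class k \<in> carrier (G k)"
    and "z \<in> carrier (G k) \<Longrightarrow> \<exists>n::int. z = disk_class k [^]\<^bsub>G k\<^esub> n"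
    and "disk_class k [^]\<^bsub>G k\<^esub> (n::int) = \<one>\<^bsub>G k\<^esub> \<Longrightarrow> n = 0"
proof -
  have grp: "Group.group (G k)" unfolding G_def by simp
  have iso: "G k \<cong> integer_group" unfolding G_def by (rule disk_homology_integer)
  have "cyclic_group (G k)"
    using isomorphic_group_cyclicity[OF iso grp] cyclic_integer_group group_integer_group by blast
  then have "\<exists>g. g \<in> carrier (G k) \<and> subgroup_generated (G k) {g} = G k"
    unfolding cyclic_group_def by blast
  then have g: "disk_class k \<in> carrier (G k) \<and> subgroup_generated (G k) {disk_class k} = G k"
    unfolding disk_class_def Let_def G_def by (rule someI_ex)
  then show "disk_class k \<in> carrier (G k)" by blast
  have car: "carrier (G k) = range (\<lambda>n::int. disk_class k [^]\<^bsub>G k\<^esub> n)"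
    using group.carrier_subgroup_generated_by_singleton[OF grp, of "disk_class k"] g by simp
  then show "z \<in> carrier (G k) \<Longrightarrow> \<exists>n::int. z = disk_class k [^]\<^bsub>G k\<^esub> n" by blast
  have "infinite (carrier (G k))"
    using iso by (auto simp: is_iso_def iso_def dest: bij_betw_finite)
  then have "\<forall>i j::int. disk_class k [^]\<^bsub>G k\<^esub> i = disk_class k [^]\<^bsub>G k\<^esub> j \<longrightarrow> i = j"
    using group.infinite_cyclic_subgroup_int[OF grp, of "disk_class k"] g by simp
  then show "disk_class k [^]\<^bsub>G k\<^esub> (n::int) = \<one>\<^bsub>G k\<^esub> \<Longrightarrow> n = 0"
    by (metis int_pow_0)
qed

section \<open>Finite CW complexes with some of the top cells\<close>

locale finite_cw =
  fixes X :: "('a, 'c) cw"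
  assumes finite_cw: "finite_CW_complex X"
begin

lemma finite_cells: "finite (cells X k)"
proof -
  have "finite (Pair k -` (SIGMA k:UNIV. cells X k))"
    using finite_cw unfolding finite_CW_complex_def by (intro finite_vimageI) (auto simp: inj_on_def)
  moreover have "Pair k -` (SIGMA k:UNIV. cells X k) = cells X k" by auto
  ultimately show ?thesis by simp
qed

lemma CW: "CW_complex X" using finite_cw by (simp add: finite_CW_complex_def)

lemma Hausdorff: "Hausdorff_space (cw_space X)" using CW by (simp add: CW_complex_def)

lemma char_map_continuous: "c \<in> cells X k \<Longrightarrow> continuous_map (disk k) (cw_space X) (char_map X k c)"
  and char_map_embedding: "c \<in> cells X k \<Longrightarrow>
    embedding_map (subtopology (disk k) (disk_interior k)) (cw_space X) (char_map X k c)"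
  using CW by (simp_all add: CW_complex_def)

lemma open_cells_disjoint:
  "\<lbrakk>c \<in> cells X k; e \<in> cells X l; (k, c) \<noteq> (l, e)\<rbrakk> \<Longrightarrow> open_cell X k c \<inter> open_cell X l e = {}"
  using CW by (simp add: CW_complex_def)

lemma char_map_boundary: "c \<in> cells X k \<Longrightarrow> char_map X k c ` disk_boundary k \<subseteq> skeleton X (int k - 1)"
proof -
  assume "c \<in> cells X k"
  then obtain F where "F \<subseteq> (SIGMA j:{..<k}. cells X j)"
    "char_map X k c ` disk_boundary k \<subseteq> (\<Union>(j, e)\<in>F. open_cell X j e)"
    using CW unfolding CW_complex_def by meson
  moreover have "(\<Union>(j, e)\<in>F. open_cell X j e) \<subseteq> skeleton X (int k - 1)"
    using calculation(1) unfolding skeleton_def by auto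
  ultimately show ?thesis by blast
qed

lemma char_map_disk:
  "char_map X k c ` topspace (disk k) = open_cell X k c \<union> char_map X k c ` disk_boundary k"
  unfolding open_cell_def disk_interior_Un_boundary by blast

lemma closedin_closed_cell: "c \<in> cells X k \<Longrightarrow> closedin (cw_space X) (char_map X k c ` topspace (disk k))"
  by (intro compactin_imp_closedin[OF Hausdorff] image_compactin[OF _ char_map_continuous])
     (use compact_disk in \<open>simp_all add: compact_space_def\<close>)

text \<open>
  Between the \<open>(k-1)\<close>-skeleton and the \<open>k\<close>-skeleton lie the spaces that contain only the \<open>k\<close>-cells in \<open>F\<close>. Adding the
  elements of \<open>F\<close> one after the other leads from the first skeleton to the second.
\<close>

definition partial_skeleton :: "nat \<Rightarrow> 'c set \<Rightarrow> 'a set" where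
  "partial_skeleton k F = skeleton X (int k - 1) \<union> (\<Union>c\<in>F. open_cell X k c)"

lemma part_empty: "partial_skeleton k {} = skeleton X (int k - 1)"
  by (simp add: partial_skeleton_def)

lemma part_cells: "partial_skeleton k (cells X k) = skeleton X (int k)"
proof -
  have "{j. int j \<le> int k} = insert k {j. int j \<le> int k - 1}" by auto
  then show ?thesis unfolding partial_skeleton_def skeleton_def by auto
qed

lemma part_insert: "partial_skeleton k (insert c F) = partial_skeleton k F \<union> open_cell X k c"
  unfolding partial_skeleton_def by auto

lemma skeleton_part: "skeleton X (int k - 1) \<subseteq> partial_skeleton k F"
  by (simp add: partial_skeleton_def)

lemma closedin_part:
  assumes "F \<subseteq> cells X k"
  shows "closedin (cw_space X) (partial_skeleton k F)"
proof -
  let ?I = "(SIGMA j:{..<k}. cells X j) \<union> Pair k ` F"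
  have fin: "finite ?I"
    using finite_cells assms by (auto intro: finite_subset)
  have sub: "(\<Union>(j, e)\<in>?I. char_map X j e ` topspace (disk j)) = partial_skeleton k F"
  proof
    have "char_map X j e ` topspace (disk j) \<subseteq> partial_skeleton k F" if "(j, e) \<in> ?I" for j e
    proof -
      have e: "e \<in> cells X j" "j \<le> k" using that assms by auto
      have "char_map X j e ` disk_boundary j \<subseteq> skeleton X (int j - 1)"
        by (rule char_map_boundary[OF e(1)])
      moreover have "skeleton X (int j - 1) \<subseteq> skeleton X (int k - 1)"
        using e(2) unfolding skeleton_def by (intro UN_mono) auto
      moreover have "open_cell X j e \<subseteq> partial_skeleton k F"
      proof (cases "j < k")
        case True
        then have "j \<in> {i. int i \<le> int k - 1}" by auto
        then show ?thesis using e unfolding partial_skeleton_def skeleton_def by blast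
      next
        case False
        then show ?thesis using that unfolding partial_skeleton_def by auto
      qed
      ultimately show ?thesis unfolding char_map_disk using skeleton_part[of k F] by blast
    qed
    then show "(\<Union>(j, e)\<in>?I. char_map X j e ` topspace (disk j)) \<subseteq> partial_skeleton k F" by blast
    show "partial_skeleton k F \<subseteq> (\<Union>(j, e)\<in>?I. char_map X j e ` topspace (disk j))"
    proof
      fix x assume "x \<in> partial_skeleton k F"
      then obtain j e where "(j, e) \<in> ?I" "x \<in> open_cell X j e"
        unfolding partial_skeleton_def skeleton_def by auto
      then show "x \<in> (\<Union>(j, e)\<in>?I. char_map X j e ` topspace (disk j))"
        unfolding char_map_disk by blast
    qed
  qed
  have "closedin (cw_space X) (\<Union>((\<lambda>(j, e). char_map X j e ` topspace (disk j)) ` ?I))"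
    using fin closedin_closed_cell assms by (intro closedin_Union) auto
  then show ?thesis using sub by simp
qed

lemma part_topspace: "F \<subseteq> cells X k \<Longrightarrow> partial_skeleton k F \<subseteq> topspace (cw_space X)"
  using closedin_part closedin_subset by blast

lemma open_cell_part_disjoint:
  assumes "F \<subseteq> cells X k" "c \<in> cells X k" "c \<notin> F"
  shows "partial_skeleton k F \<inter> open_cell X k c = {}"
proof -
  have "open_cell X j e \<inter> open_cell X k c = {}" if "e \<in> cells X j" "j < k \<or> j = k \<and> e \<in> F" for j e
    using that assms by (intro open_cells_disjoint) auto
  then show ?thesis using assms(1) unfolding partial_skeleton_def skeleton_def by auto
qed

lemma cell_attachment_part:
  assumes "F \<subseteq> cells X k" "c \<in> cells X k" "c \<notin> F"
  shows "cell_attachment (subtopology (cw_space X) (partial_skeleton k (insert c F))) (partial_skeleton k F) k (char_map X k c)"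
proof
  have F': "insert c F \<subseteq> cells X k" using assms by auto
  have img: "char_map X k c ` topspace (disk k) \<subseteq> partial_skeleton k (insert c F)"
    using char_map_boundary[OF assms(2)] skeleton_part[of k F] by (auto simp: char_map_disk part_insert)
  show "Hausdorff_space (subtopology (cw_space X) (partial_skeleton k (insert c F)))"
    by (intro Hausdorff_space_subtopology Hausdorff)
  show "closedin (subtopology (cw_space X) (partial_skeleton k (insert c F))) (partial_skeleton k F)"
    using closedin_part[OF assms(1)] by (intro closedin_subset_topspace) (auto simp: part_insert)
  show "continuous_map (disk k) (subtopology (cw_space X) (partial_skeleton k (insert c F))) (char_map X k c)"
    using char_map_continuous[OF assms(2)] img by (simp add: continuous_map_in_subtopology image_subset_iff_funcset)
  show "embedding_map (subtopology (disk k) (disk_interior k))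
     (subtopology (cw_space X) (partial_skeleton k (insert c F))) (char_map X k c)"
    using char_map_embedding[OF assms(2)] img by (auto simp: embedding_map_in_subtopology)
  show "char_map X k c ` disk_boundary k \<subseteq> partial_skeleton k F"
    using char_map_boundary[OF assms(2)] skeleton_part[of k F] by auto
  show "topspace (subtopology (cw_space X) (partial_skeleton k (insert c F))) = partial_skeleton k F \<union> char_map X k c ` disk_interior k"
    using part_topspace[OF F'] by (auto simp: part_insert open_cell_def)
  show "partial_skeleton k F \<inter> char_map X k c ` disk_interior k = {}"
    using open_cell_part_disjoint[OF assms] by (simp add: open_cell_def)
qed

abbreviation part_homology :: "nat \<Rightarrow> 'c set \<Rightarrow> 'a chain set monoid" where
  "part_homology k F \<equiv> relative_homology_group (int k) (subtopology (cw_space X) (partial_skeleton k F)) (skeleton X (int k - 1))"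

definition part_class :: "nat \<Rightarrow> 'c set \<Rightarrow> 'c \<Rightarrow> 'a chain set" where
  "part_class k F c = hom_induced (int k) (disk k) (disk_boundary k)
     (subtopology (cw_space X) (partial_skeleton k F)) (skeleton X (int k - 1)) (char_map X k c) (disk_class k)"

lemma char_map_part:
  assumes "F \<subseteq> cells X k" "c \<in> F"
  shows "continuous_map (disk k) (subtopology (cw_space X) (partial_skeleton k F)) (char_map X k c)"
    "char_map X k c \<in> disk_boundary k \<rightarrow> skeleton X (int k - 1)"
proof -
  have c: "c \<in> cells X k" using assms by auto
  have "char_map X k c ` topspace (disk k) \<subseteq> partial_skeleton k F"
    using char_map_boundary[OF c] skeleton_part[of k F] assms by (auto simp: char_map_disk partial_skeleton_def)
  then show "continuous_map (disk k) (subtopology (cw_space X) (partial_skeleton k F)) (char_map X k c)"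
    using char_map_continuous[OF c] by (simp add: continuous_map_in_subtopology image_subset_iff_funcset)
  show "char_map X k c \<in> disk_boundary k \<rightarrow> skeleton X (int k - 1)"
    using char_map_boundary[OF c] by auto
qed

lemma part_class_closed: "part_class k F c \<in> carrier (part_homology k F)"
  unfolding part_class_def using hom_in_carrier[OF hom_induced_hom disk_class(1)] .

lemma part_class_mono:
  assumes "F \<subseteq> F'" "F' \<subseteq> cells X k" "c \<in> F"
  shows "hom_induced (int k) (subtopology (cw_space X) (partial_skeleton k F)) (skeleton X (int k - 1))
     (subtopology (cw_space X) (partial_skeleton k F')) (skeleton X (int k - 1)) id (part_class k F c) = part_class k F' c"
proof -
  have "partial_skeleton k F \<subseteq> partial_skeleton k F'" using assms(1) by (auto simp: partial_skeleton_def)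
  then have "continuous_map (subtopology (cw_space X) (partial_skeleton k F)) (subtopology (cw_space X) (partial_skeleton k F')) id"
    by (auto simp: continuous_map_in_subtopology topspace_subtopology)
  then show ?thesis unfolding part_class_def
    using assms char_map_part[of F k c] by (subst hom_induced_compose') auto
qed

text \<open>
  Induction on \<open>F\<close>. By \<open>iso_attached_cell\<close> the homology of the new space relative to the old one is generated by the
  class of the new cell, and the exact sequence of the triple of the new space, the old space and the
  \<open>(k-1)\<close>-skeleton supplies the rest.
\<close>

theorem part_homology_generated:
  assumes "F \<subseteq> cells X k" "z \<in> carrier (part_homology k F)"
  shows "\<exists>n. z = finprod (part_homology k F) (\<lambda>c. part_class k F c [^]\<^bsub>part_homology k F\<^esub> (n c :: int)) F"
proof -
  have "finite F" using assms finite_cells finite_subset by blast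
  then show ?thesis using assms
  proof (induction F arbitrary: z)
    case empty
    have "topspace (subtopology (cw_space X) (partial_skeleton k {})) = skeleton X (int k - 1)"
      using part_topspace[of "{}" k] by (auto simp: part_empty)
    then have "trivial_group (part_homology k {})"
      using trivial_relative_homology_group_topspace by metis
    then have "z = \<one>\<^bsub>part_homology k {}\<^esub>" using empty(2) by (simp only: trivial_group_def) blast
    then show ?case by (simp only: comm_monoid.finprod_empty[OF comm_group.axioms(1)[OF abelian_relative_homology_group]]) simp
  next
    case (insert c F)
    let ?F' = "insert c F"
    let ?T = "skeleton X (int k - 1)" and ?S = "partial_skeleton k F"
    let ?X' = "subtopology (cw_space X) (partial_skeleton k ?F')"
    let ?M = "part_homology k ?F'" and ?N = "part_homology k F"
    let ?R = "relative_homology_group (int k) ?X' ?S"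
    let ?D = "relative_homology_group (int k) (disk k) (disk_boundary k)"
    have F: "F \<subseteq> cells X k" and c: "c \<in> cells X k" using insert by auto
    have sub: "subtopology ?X' ?S = subtopology (cw_space X) ?S"
      by (simp add: subtopology_subtopology part_insert Int_absorb1)
    let ?j = "hom_induced (int k) ?X' ?T ?X' ?S id"
    let ?i = "hom_induced (int k) (subtopology (cw_space X) ?S) ?T ?X' ?T id"
    have gen: "\<exists>m::int. r = ?j (part_class k ?F' c) [^]\<^bsub>?R\<^esub> m" if r: "r \<in> carrier ?R" for r
    proof -
      interpret CA: cell_attachment ?X' ?S k "char_map X k c"
        by (rule cell_attachment_part[OF F c insert.hyps(2)])
      let ?\<phi> = "hom_induced (int k) (disk k) (disk_boundary k) ?X' ?S (char_map X k c)"
      have "r \<in> ?\<phi> ` carrier ?D"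
        using CA.iso_attached_cell[of "int k"] r by (auto simp: iso_def bij_betw_def)
      then obtain m :: int where "r = ?\<phi> (disk_class k [^]\<^bsub>?D\<^esub> m)"
        using disk_class(2) by blast
      also have "\<dots> = ?\<phi> (disk_class k) [^]\<^bsub>?R\<^esub> m"
        by (intro hom_int_pow hom_induced_hom disk_class(1)) auto
      also have "?\<phi> (disk_class k) = ?j (part_class k ?F' c)"
        unfolding part_class_def
        using char_map_part[OF insert.prems(1), of c] skeleton_part[of k F] by (subst hom_induced_compose') auto
      finally show ?thesis by blast
    qed
    show ?case
    proof (rule generated_by_exactness[where i = ?i and j = ?j and a = "part_class k F" and G = ?N and R = ?R])
      show "kernel ?M ?R ?j = ?i ` carrier ?N"
        using exact_seq_kernel[OF homology_exactness_triple_3[OF skeleton_part[of k F], of "int k" ?X']]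
        unfolding sub .
      show "?i (part_class k F b) = part_class k ?F' b" if "b \<in> F" for b
        using part_class_mono[OF _ insert.prems(1) that] by auto
    qed (use insert F gen part_class_closed in \<open>simp_all add: hom_induced_hom\<close>)
  qed
qed

text \<open>
  Passing to the homology relative to the complement of one open cell kills the classes of all other cells, since
  their characteristic maps have their image in this complement. By \<open>iso_attached_cell\<close> the class of the
  remaining cell keeps its infinite order.
\<close>

lemma part_classes_independent:
  fixes n :: "'c \<Rightarrow> int" and k :: nat
  defines "K \<equiv> cells X k"
  assumes one: "finprod (part_homology k K) (\<lambda>c. part_class k K c [^]\<^bsub>part_homology k K\<^esub> n c) K = \<one>\<^bsub>part_homology k K\<^esub>"
    and c: "c \<in> cells X k"
  shows "n c = 0"
proof -
  let ?X = "subtopology (cw_space X) (partial_skeleton k K)" and ?T = "skeleton X (int k - 1)" and ?P = "partial_skeleton k (K - {c})"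
  let ?M = "part_homology k K" and ?R = "relative_homology_group (int k) ?X ?P"
  let ?D = "relative_homology_group (int k) (disk k) (disk_boundary k)"
  let ?j = "hom_induced (int k) ?X ?T ?X ?P id"
  let ?\<phi> = "\<lambda>b. hom_induced (int k) (disk k) (disk_boundary k) ?X ?P (char_map X k b)"
  have K: "insert c (K - {c}) = K" "K - {c} \<subseteq> cells X k" "K \<subseteq> cells X k" "finite K"
    using c finite_cells unfolding K_def by auto
  interpret CA: cell_attachment ?X ?P k "char_map X k c"
    using cell_attachment_part[OF K(2) c] unfolding K by simp
  have comm: "comm_group ?M" "comm_group ?R" by simp_all
  have j: "?j \<in> hom ?M ?R" by (rule hom_induced_hom)
  interpret R: comm_group ?R by (rule comm)
  interpret j: group_hom ?M ?R ?j
    using j by (simp add: group_hom_def group_hom_axioms_def)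
  have sub: "subtopology ?X ?P = subtopology (cw_space X) ?P"
    unfolding subtopology_subtopology by (rule arg_cong[where f = "subtopology _"]) (auto simp: partial_skeleton_def)
  have cls: "?j (part_class k K b) = ?\<phi> b (disk_class k)" if "b \<in> K" for b
    unfolding part_class_def
    using char_map_part[OF K(3) that] skeleton_part[of k "K - {c}"] by (subst hom_induced_compose') auto
  have trivial: "?\<phi> b (disk_class k) = \<one>\<^bsub>?R\<^esub>" if "b \<in> K" "b \<noteq> c" for b
  proof -
    let ?Q = "relative_homology_group (int k) (subtopology (cw_space X) ?P) ?P"
    let ?h = "hom_induced (int k) (disk k) (disk_boundary k) (subtopology (cw_space X) ?P) ?P (char_map X k b)"
    let ?i = "hom_induced (int k) (subtopology ?X ?P) ?P ?X ?P id"
    have cont: "continuous_map (disk k) (subtopology (cw_space X) ?P) (char_map X k b)"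
      "char_map X k b \<in> disk_boundary k \<rightarrow> ?T"
      using char_map_part[OF K(2), of b] that by auto
    have "topspace (subtopology (cw_space X) ?P) = ?P"
      using part_topspace[OF K(2)] by auto
    then have "trivial_group ?Q"
      using trivial_relative_homology_group_topspace by metis
    moreover have "?h (disk_class k) \<in> carrier ?Q"
      by (rule hom_in_carrier[OF hom_induced_hom disk_class(1)])
    ultimately have "?h (disk_class k) = \<one>\<^bsub>?Q\<^esub>"
      unfolding trivial_group_def by blast
    moreover have "?i (\<one>\<^bsub>?Q\<^esub>) = \<one>\<^bsub>?R\<^esub>"
      using hom_one[OF hom_induced_hom group_relative_homology_group group_relative_homology_group,
          of "int k" "subtopology ?X ?P" ?P ?X ?P id] unfolding sub .
    moreover have "?i (?h (disk_class k)) = ?\<phi> b (disk_class k)"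
      using cont skeleton_part[of k "K - {c}"] unfolding sub[symmetric]
      by (subst hom_induced_compose') (auto simp: continuous_map_from_subtopology)
    ultimately show ?thesis by simp
  qed
  have cK: "c \<in> K" using c by (simp add: K_def)
  have pow: "?\<phi> c (disk_class k) [^]\<^bsub>?R\<^esub> n c \<in> carrier ?R"
    by (intro R.int_pow_closed hom_in_carrier[OF hom_induced_hom disk_class(1)])
  have "\<one>\<^bsub>?R\<^esub> = ?j (finprod ?M (\<lambda>b. part_class k K b [^]\<^bsub>?M\<^esub> n b) K)"
    unfolding one by (rule j.hom_one[symmetric])
  also have "\<dots> = finprod ?R (\<lambda>b. ?j (part_class k K b [^]\<^bsub>?M\<^esub> n b)) K"
    by (rule hom_finprod[OF comm j]) (auto intro: group.int_pow_closed part_class_closed)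
  also have "\<dots> = finprod ?R (\<lambda>b. if c = b then ?\<phi> c (disk_class k) [^]\<^bsub>?R\<^esub> n c else \<one>\<^bsub>?R\<^esub>) K"
  proof (rule R.finprod_cong')
    show "?j (part_class k K b [^]\<^bsub>?M\<^esub> n b) = (if c = b then ?\<phi> c (disk_class k) [^]\<^bsub>?R\<^esub> n c else \<one>\<^bsub>?R\<^esub>)"
      if "b \<in> K" for b
      using cls[OF that] trivial[OF that] part_class_closed by (auto simp: j.hom_int_pow simp del: one_relative_homology_group)
  qed (use pow R.one_closed in \<open>simp_all add: Pi_iff del: one_relative_homology_group\<close>)
  also have "\<dots> = ?\<phi> c (disk_class k) [^]\<^bsub>?R\<^esub> n c"
    using pow K(4) cK R.one_closed
    by (intro R.finprod_singleton) (simp_all add: Pi_iff del: one_relative_homology_group)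
  also have "\<dots> = ?\<phi> c (disk_class k [^]\<^bsub>?D\<^esub> n c)"
    by (intro hom_int_pow[symmetric] hom_induced_hom disk_class(1)) auto
  finally have "?\<phi> c (disk_class k [^]\<^bsub>?D\<^esub> n c) = ?\<phi> c (\<one>\<^bsub>?D\<^esub>)"
    using hom_one[OF hom_induced_hom group_relative_homology_group group_relative_homology_group] by metis
  moreover have "disk_class k [^]\<^bsub>?D\<^esub> n c \<in> carrier ?D" "\<one>\<^bsub>?D\<^esub> \<in> carrier ?D"
    by (intro group.int_pow_closed group_relative_homology_group disk_class(1) monoid.one_closed group.is_monoid)+
  ultimately have "disk_class k [^]\<^bsub>?D\<^esub> n c = \<one>\<^bsub>?D\<^esub>"
    using CA.iso_attached_cell[of "int k"] unfolding iso_def bij_betw_def inj_on_def by blast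
  then show ?thesis by (rule disk_class(3))
qed

section \<open>Incidence numbers\<close>

lemma skeletal_homology_part: "skeletal_homology X k = part_homology k (cells X k)"
  by (simp only: skeletal_homology_def part_cells)

lemma cell_class_part: "cell_class X k c = part_class k (cells X k) c"
  by (simp only: cell_class_def part_class_def part_cells)

text \<open>
  The isomorphism from the integral cellular chains to the homology of the skeleta. It is written with the product over
  the support of a chain that also occurs in the definition of the incidence numbers.
\<close>

definition cell_combination :: "nat \<Rightarrow> 'c zchain \<Rightarrow> 'a chain set" where
  "cell_combination k f = finprod (skeletal_homology X k)
     (\<lambda>b. cell_class X k b [^]\<^bsub>skeletal_homology X k\<^esub> Poly_Mapping.lookup f b) (Poly_Mapping.keys f)"

lemma comm_group_skeletal: "comm_group (skeletal_homology X k)"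
  by (simp add: skeletal_homology_def)

lemma group_skeletal: "Group.group (skeletal_homology X k)"
  by (simp add: skeletal_homology_def)

lemma cell_class_closed: "cell_class X k c \<in> carrier (skeletal_homology X k)"
  unfolding skeletal_homology_part cell_class_part by (rule part_class_closed)

lemma cell_combination_cells:
  assumes "Poly_Mapping.keys f \<subseteq> cells X k"
  shows "cell_combination k f = finprod (skeletal_homology X k)
     (\<lambda>b. cell_class X k b [^]\<^bsub>skeletal_homology X k\<^esub> Poly_Mapping.lookup f b) (cells X k)"
proof -
  interpret G: comm_group "skeletal_homology X k" by (rule comm_group_skeletal)
  show ?thesis unfolding cell_combination_def
    using assms finite_cells cell_class_closed
    by (intro G.finprod_mono_neutral_cong_left) (auto simp: in_keys_iff)
qed

lemma cell_combination_hom: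
  "cell_combination k \<in> hom (free_Abelian_group (cells X k)) (skeletal_homology X k)"
proof -
  interpret G: comm_group "skeletal_homology X k" by (rule comm_group_skeletal)
  show ?thesis
  proof (rule homI)
    fix f g assume f: "f \<in> carrier (free_Abelian_group (cells X k))" and g: "g \<in> carrier (free_Abelian_group (cells X k))"
    then have "Poly_Mapping.keys (f + g) \<subseteq> cells X k"
      using keys_add[of f g] by auto
    then show "cell_combination k (f \<otimes>\<^bsub>free_Abelian_group (cells X k)\<^esub> g)
        = cell_combination k f \<otimes>\<^bsub>skeletal_homology X k\<^esub> cell_combination k g"
      using f g cell_class_closed
      by (auto simp: cell_combination_cells lookup_add G.int_pow_mult simp flip: G.finprod_multf intro!: G.finprod_cong')
  qed (use cell_class_closed in \<open>auto simp: cell_combination_def\<close>)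
qed

lemma cell_combination_inj:
  assumes "Poly_Mapping.keys f \<subseteq> cells X k" "Poly_Mapping.keys g \<subseteq> cells X k"
    and "cell_combination k f = cell_combination k g"
  shows "f = g"
proof -
  let ?F = "free_Abelian_group (cells X k)"
  interpret h: group_hom ?F "skeletal_homology X k" "cell_combination k"
    using cell_combination_hom by (simp add: group_hom_def group_hom_axioms_def group_skeletal)
  have ker: "x = 0" if x: "Poly_Mapping.keys x \<subseteq> cells X k" "cell_combination k x = \<one>\<^bsub>skeletal_homology X k\<^esub>" for x
  proof (rule poly_mapping_eqI)
    fix c
    show "Poly_Mapping.lookup x c = Poly_Mapping.lookup 0 c"
    proof (cases "c \<in> cells X k")
      case True
      then show ?thesis
        using part_classes_independent[of k "Poly_Mapping.lookup x" c] x
        by (simp add: cell_combination_cells skeletal_homology_part cell_class_part)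
    next
      case False
      then show ?thesis using x(1) by (auto simp: in_keys_iff)
    qed
  qed
  have "inj_on (cell_combination k) (carrier ?F)"
    using h.inj_on_one_iff ker by (simp add: h.inj_on_one_iff)
  then show ?thesis using assms by (auto simp: inj_on_def)
qed

lemma cell_combination_surj:
  assumes "z \<in> carrier (skeletal_homology X k)"
  shows "\<exists>f. Poly_Mapping.keys f \<subseteq> cells X k \<and> z = cell_combination k f"
proof -
  interpret G: comm_group "skeletal_homology X k" by (rule comm_group_skeletal)
  obtain n :: "'c \<Rightarrow> int" where n: "z = finprod (skeletal_homology X k) (\<lambda>c. cell_class X k c [^]\<^bsub>skeletal_homology X k\<^esub> n c) (cells X k)"
    using part_homology_generated[of "cells X k" k z] assms by (auto simp: skeletal_homology_part cell_class_part)
  define f where "f = Abs_poly_mapping (\<lambda>c. if c \<in> cells X k then n c else 0)"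
  have f: "Poly_Mapping.lookup f c = (if c \<in> cells X k then n c else 0)" for c
  proof -
    have "{c. (if c \<in> cells X k then n c else 0) \<noteq> 0} \<subseteq> cells X k"
      by (rule subsetI, rule ccontr) simp
    then have "finite {c. (if c \<in> cells X k then n c else 0) \<noteq> 0}"
      using finite_cells finite_subset by blast
    then show ?thesis unfolding f_def by (simp add: lookup_Abs_poly_mapping)
  qed
  have "Poly_Mapping.keys f \<subseteq> cells X k"
    by (rule subsetI, rule ccontr) (simp add: in_keys_iff f)
  moreover from this have "z = cell_combination k f"
    unfolding n cell_combination_cells[OF calculation]
    by (intro G.finprod_cong') (auto simp: f intro!: G.int_pow_closed cell_class_closed)
  ultimately show ?thesis by blast
qed

definition skeletal_boundary :: "nat \<Rightarrow> 'a chain set \<Rightarrow> 'a chain set" where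
  "skeletal_boundary k = hom_relboundary (int (Suc k)) (subtopology (cw_space X) (skeleton X (int (Suc k))))
     (skeleton X (int k)) (skeleton X (int k - 1))"

lemma skeleton_mono: "i \<le> j \<Longrightarrow> skeleton X i \<subseteq> skeleton X j"
  unfolding skeleton_def by (intro UN_mono) auto

lemma subtopology_skeleton:
  "i \<le> j \<Longrightarrow> subtopology (subtopology (cw_space X) (skeleton X j)) (skeleton X i) = subtopology (cw_space X) (skeleton X i)"
  using skeleton_mono[of i j] by (simp add: subtopology_subtopology Int_absorb1)

lemma skeletal_boundary_hom: "skeletal_boundary k \<in> hom (skeletal_homology X (Suc k)) (skeletal_homology X k)"
  using group_homomorphism_hom_relboundary[of "int (Suc k)" "subtopology (cw_space X) (skeleton X (int (Suc k)))"
      "skeleton X (int k)" "skeleton X (int k - 1)"]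
  by (simp add: skeletal_boundary_def skeletal_homology_def subtopology_skeleton)

text \<open>
  The description that defines the incidence chain is satisfied by exactly one chain, because the combinations of cell
  classes represent every homology class in a unique way.
\<close>

lemma incidence:
  shows "Poly_Mapping.keys (incidence X k a) \<subseteq> cells X k"
    and "cell_combination k (incidence X k a) = skeletal_boundary k (cell_class X (Suc k) a)"
proof -
  let ?P = "\<lambda>f. Poly_Mapping.keys f \<subseteq> cells X k \<and> skeletal_boundary k (cell_class X (Suc k) a) = cell_combination k f"
  have "skeletal_boundary k (cell_class X (Suc k) a) \<in> carrier (skeletal_homology X k)"
    by (rule hom_in_carrier[OF skeletal_boundary_hom cell_class_closed])
  then have "\<exists>!f. ?P f"
    using cell_combination_surj cell_combination_inj by metis
  then have "?P (THE f. ?P f)" by (rule theI')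
  moreover have "incidence X k a = (THE f. ?P f)"
    unfolding incidence_def skeletal_boundary_def cell_combination_def by simp
  ultimately show "Poly_Mapping.keys (incidence X k a) \<subseteq> cells X k"
    "cell_combination k (incidence X k a) = skeletal_boundary k (cell_class X (Suc k) a)"
    by simp_all
qed

text \<open>
  The composite passes through two consecutive maps of the long exact sequence of the pair formed by the
  \<open>(k+1)\<close>-skeleton and the \<open>k\<close>-skeleton.
\<close>

lemma skeletal_boundary_square:
  assumes "z \<in> carrier (skeletal_homology X (Suc (Suc k)))"
  shows "skeletal_boundary k (skeletal_boundary (Suc k) z) = \<one>\<^bsub>skeletal_homology X k\<^esub>"
proof -
  let ?Y = "subtopology (cw_space X) (skeleton X (int (Suc k)))"
  let ?S = "skeleton X (int k)" and ?T = "skeleton X (int k - 1)"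
  let ?Z = "subtopology (cw_space X) (skeleton X (int (Suc (Suc k))))"
  let ?w = "hom_boundary (int (Suc (Suc k))) ?Z (skeleton X (int (Suc k))) z"
  let ?i = "hom_induced (int (Suc k)) ?Y {} ?Y ?S id"
  have w: "?w \<in> carrier (homology_group (int (Suc k)) ?Y)"
    using hom_in_carrier[OF hom_boundary_hom assms[unfolded skeletal_homology_def], simplified]
      hom_boundary_hom[of "int (Suc (Suc k))" ?Z "skeleton X (int (Suc k))"] assms
    by (simp add: subtopology_skeleton skeletal_homology_def hom_def Pi_iff)
  have eq: "skeletal_boundary (Suc k) z = ?i ?w"
    by (simp add: skeletal_boundary_def hom_relboundary_def subtopology_skeleton)
  have "?i ?w \<in> kernel (relative_homology_group (int (Suc k)) ?Y ?S)
      (homology_group (int (Suc k) - 1) (subtopology ?Y ?S)) (hom_boundary (int (Suc k)) ?Y ?S)"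
    using exact_seq_kernel[OF homology_exactness_axiom_1[of "int (Suc k)" ?Y ?S]] w by blast
  then have "hom_boundary (int (Suc k)) ?Y ?S (?i ?w) = \<one>\<^bsub>homology_group (int (Suc k) - 1) (subtopology ?Y ?S)\<^esub>"
    by (simp add: kernel_def)
  then have "skeletal_boundary k (?i ?w)
      = hom_induced (int (Suc k) - 1) (subtopology ?Y ?S) {} (subtopology ?Y ?S) ?T id
         (\<one>\<^bsub>homology_group (int (Suc k) - 1) (subtopology ?Y ?S)\<^esub>)"
    by (simp only: skeletal_boundary_def hom_relboundary_def o_apply)
  also have "\<dots> = \<one>\<^bsub>relative_homology_group (int (Suc k) - 1) (subtopology ?Y ?S) ?T\<^esub>"
    by (rule hom_one[OF hom_induced_hom group_relative_homology_group group_relative_homology_group])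
  also have "relative_homology_group (int (Suc k) - 1) (subtopology ?Y ?S) ?T = skeletal_homology X k"
    by (simp add: skeletal_homology_def subtopology_skeleton)
  finally show ?thesis unfolding eq .
qed

end

lemma finprod_free_Abelian_group:
  assumes "\<And>x. x \<in> A \<Longrightarrow> Poly_Mapping.keys (f x) \<subseteq> S"
  shows "finprod (free_Abelian_group S) f A = sum f A"
proof -
  interpret comm_group "free_Abelian_group S" by (rule abelian_free_Abelian_group)
  show ?thesis using assms
    by (induction A rule: infinite_finite_induct) (auto simp: Pi_iff)
qed

lemma boundary_map_int:
  "boundary_map X (Suc k) (x :: 'c zchain) = (\<Sum>a\<in>Poly_Mapping.keys x. frag_cmul (Poly_Mapping.lookup x a) (incidence X k a))"
proof -
  have "Poly_Mapping.map (\<lambda>n. m * of_int n) y = frag_cmul m y" for m and y :: "'c zchain"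
    by (rule poly_mapping_eqI) (simp add: map.rep_eq when_def)
  then show ?thesis by simp
qed

context finite_cw begin

lemma cell_combination_boundary:
  assumes "Poly_Mapping.keys x \<subseteq> cells X (Suc k)"
  shows "Poly_Mapping.keys (boundary_map X (Suc k) x) \<subseteq> cells X k"
    and "cell_combination k (boundary_map X (Suc k) x) = skeletal_boundary k (cell_combination (Suc k) x)"
proof -
  let ?F = "free_Abelian_group (cells X k)" and ?H = "skeletal_homology X k"
  let ?L = "Poly_Mapping.lookup x"
  have keys: "Poly_Mapping.keys (frag_cmul (?L a) (incidence X k a)) \<subseteq> cells X k" for a
    using incidence(1)[of k a] keys_cmul by (rule subset_trans[rotated])
  then show "Poly_Mapping.keys (boundary_map X (Suc k) x) \<subseteq> cells X k"
    unfolding boundary_map_int using sum_closed_free_Abelian_group[of "Poly_Mapping.keys x" "\<lambda>a. frag_cmul (?L a) (incidence X k a)"] by simp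
  have "cell_combination k (boundary_map X (Suc k) x)
      = cell_combination k (finprod ?F (\<lambda>a. frag_cmul (?L a) (incidence X k a)) (Poly_Mapping.keys x))"
    unfolding boundary_map_int using keys by (subst finprod_free_Abelian_group) auto
  also have "\<dots> = finprod ?H (\<lambda>a. cell_combination k (frag_cmul (?L a) (incidence X k a))) (Poly_Mapping.keys x)"
    using keys by (intro hom_finprod cell_combination_hom comm_group_skeletal abelian_free_Abelian_group) auto
  also have "\<dots> = finprod ?H (\<lambda>a. skeletal_boundary k (cell_class X (Suc k) a [^]\<^bsub>skeletal_homology X (Suc k)\<^esub> ?L a)) (Poly_Mapping.keys x)"
  proof -
    have "cell_combination k (frag_cmul (?L a) (incidence X k a))
        = skeletal_boundary k (cell_class X (Suc k) a [^]\<^bsub>skeletal_homology X (Suc k)\<^esub> ?L a)" for a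
    proof -
      have "cell_combination k (incidence X k a [^]\<^bsub>?F\<^esub> ?L a) = cell_combination k (incidence X k a) [^]\<^bsub>?H\<^esub> ?L a"
        using incidence(1)[of k a] by (intro hom_int_pow cell_combination_hom group_skeletal) auto
      then show ?thesis
        using incidence[of k a] hom_int_pow[OF skeletal_boundary_hom cell_class_closed group_skeletal group_skeletal] by simp
    qed
    then show ?thesis by simp
  qed
  also have "\<dots> = skeletal_boundary k (cell_combination (Suc k) x)"
    unfolding cell_combination_def
    by (rule hom_finprod[symmetric, OF comm_group_skeletal comm_group_skeletal skeletal_boundary_hom])
       (auto intro!: group.int_pow_closed group_skeletal cell_class_closed)
  finally show "cell_combination k (boundary_map X (Suc k) x) = skeletal_boundary k (cell_combination (Suc k) x)" .
qed

text \<open>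
  The cellular boundary corresponds to the connecting homomorphism, whose square is trivial.
\<close>

theorem boundary_of_boundary:
  assumes "x \<in> chains X (Suc k)"
  shows "boundary_map X k (boundary_map X (Suc k) (x :: 'c zchain)) = 0"
proof (cases k)
  case 0
  then show ?thesis by simp
next
  case (Suc j)
  have x: "Poly_Mapping.keys x \<subseteq> cells X (Suc (Suc j))" using assms Suc by (simp add: chains_def)
  let ?y = "boundary_map X (Suc (Suc j)) x"
  have y: "Poly_Mapping.keys ?y \<subseteq> cells X (Suc j)" by (rule cell_combination_boundary(1)[OF x])
  have "cell_combination (Suc (Suc j)) x \<in> carrier (skeletal_homology X (Suc (Suc j)))"
    using x by (intro hom_in_carrier[OF cell_combination_hom]) simp
  then have "cell_combination j (boundary_map X (Suc j) ?y) = \<one>\<^bsub>skeletal_homology X j\<^esub>"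
    unfolding cell_combination_boundary(2)[OF y] cell_combination_boundary(2)[OF x]
    by (rule skeletal_boundary_square)
  also have "\<dots> = cell_combination j 0"
    using hom_one[OF cell_combination_hom group_free_Abelian_group group_skeletal, of j] by simp
  finally have "boundary_map X (Suc j) ?y = 0"
    by (intro cell_combination_inj[of _ j] cell_combination_boundary(1)[OF y]) auto
  then show ?thesis using Suc by simp
qed

section \<open>Subcomplexes containing the lower skeleton\<close>

lemma subcomplex_open_cell: "subcomplex T X \<Longrightarrow> open_cell T = open_cell X"
  by (simp add: subcomplex_def open_cell_def fun_eq_iff)

lemma subcomplex_skeleton:
  assumes "subcomplex T X"
  shows "skeleton T i = (\<Union>j\<in>{j. int j \<le> i}. \<Union>c\<in>cells T j. open_cell X j c)"
    and "subtopology (cw_space T) (skeleton T i) = subtopology (cw_space X) (skeleton T i)"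
proof -
  show eq: "skeleton T i = (\<Union>j\<in>{j. int j \<le> i}. \<Union>c\<in>cells T j. open_cell X j c)"
    by (simp add: skeleton_def subcomplex_open_cell[OF assms])
  have "skeleton T i \<subseteq> (\<Union>k. \<Union>c\<in>cells T k. open_cell X k c)"
    unfolding eq by blast
  then show "subtopology (cw_space T) (skeleton T i) = subtopology (cw_space X) (skeleton T i)"
    using assms by (simp add: subcomplex_def subtopology_subtopology Int_absorb1)
qed

text \<open>
  The inclusion of skeleta carries the class of the cell in the subcomplex to its class in \<open>X\<close>, and the connecting
  homomorphism is natural. The groups in degree \<open>k\<close> are literally the same, so the two incidence chains are
  defined by the same condition.
\<close>

theorem incidence_subcomplex:
  assumes T: "subcomplex T X" and low: "\<And>j. j \<le> k \<Longrightarrow> cells T j = cells X j"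
    and a: "a \<in> cells T (Suc k)"
  shows "incidence T k a = incidence X k a"
proof -
  have skel: "skeleton T i = skeleton X i" if "i \<le> int k" for i
  proof -
    have "skeleton T i = (\<Union>j\<in>{j. int j \<le> i}. \<Union>c\<in>cells T j. open_cell X j c)"
      by (rule subcomplex_skeleton(1)[OF T])
    also have "\<dots> = skeleton X i"
      unfolding skeleton_def using low that by (intro SUP_cong refl) auto
    finally show ?thesis .
  qed
  have cm: "char_map T = char_map X" using T by (simp add: subcomplex_def)
  let ?S = "skeleton X (int k)" and ?U = "skeleton X (int k - 1)"
  let ?ZT = "subtopology (cw_space X) (skeleton T (int (Suc k)))"
  let ?ZX = "subtopology (cw_space X) (skeleton X (int (Suc k)))"
  let ?z = "cell_class T (Suc k) a"
  have aX: "a \<in> cells X (Suc k)" using T a unfolding subcomplex_def by blast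
  have S_sub: "?S \<subseteq> skeleton T (int (Suc k))"
    unfolding skel[OF order_refl, symmetric] subcomplex_skeleton(1)[OF T] by (intro UN_mono) auto
  have T_sub: "skeleton T (int (Suc k)) \<subseteq> skeleton X (int (Suc k))"
  proof -
    have "cells T j \<subseteq> cells X j" for j using T by (simp add: subcomplex_def)
    then show ?thesis
      unfolding subcomplex_skeleton(1)[OF T] unfolding skeleton_def by (intro UN_mono) auto
  qed
  have subS: "subtopology ?ZT ?S = subtopology (cw_space X) ?S" "subtopology ?ZX ?S = subtopology (cw_space X) ?S"
    using S_sub T_sub by (auto simp: subtopology_subtopology Int_absorb1)
  have bd: "char_map X (Suc k) a ` disk_boundary (Suc k) \<subseteq> ?S"
    using char_map_boundary[OF aX] by simp
  have "open_cell X (Suc k) a \<subseteq> skeleton T (int (Suc k))"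
    unfolding subcomplex_skeleton(1)[OF T] using a by blast
  then have img: "char_map X (Suc k) a ` topspace (disk (Suc k)) \<subseteq> skeleton T (int (Suc k))"
    using bd S_sub unfolding char_map_disk by blast
  have cont: "continuous_map (disk (Suc k)) ?ZT (char_map X (Suc k) a)"
    using char_map_continuous[OF aX] img by (simp add: continuous_map_in_subtopology image_subset_iff_funcset)
  have inc: "continuous_map ?ZT ?ZX id"
    using T_sub by (auto simp: continuous_map_in_subtopology)
  have z: "?z = hom_induced (int (Suc k)) (disk (Suc k)) (disk_boundary (Suc k)) ?ZT ?S (char_map X (Suc k) a) (disk_class (Suc k))"
    unfolding cell_class_def subcomplex_skeleton(2)[OF T] cm using skel[of "int k"] by simp
  have "cell_class X (Suc k) a = hom_induced (int (Suc k)) ?ZT ?S ?ZX ?S id ?z"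
    unfolding z using cont inc bd by (subst hom_induced_compose') (auto simp: cell_class_def)
  then have "hom_relboundary (int (Suc k)) ?ZX ?S ?U (cell_class X (Suc k) a)
      = (hom_relboundary (int (Suc k)) ?ZX ?S ?U \<circ> hom_induced (int (Suc k)) ?ZT ?S ?ZX ?S id) ?z"
    by simp
  also have "\<dots> = hom_induced (int (Suc k) - 1) (subtopology ?ZT ?S) ?U (subtopology ?ZX ?S) ?U id
      (hom_relboundary (int (Suc k)) ?ZT ?S ?U ?z)"
    using naturality_hom_induced_relboundary[OF inc, of ?S ?S ?U ?U "int (Suc k)"] by simp
  also have "\<dots> = hom_relboundary (int (Suc k)) ?ZT ?S ?U ?z"
    unfolding subS using hom_relboundary[of "int (Suc k)" ?ZT ?S ?U ?z] unfolding subS by (rule hom_induced_id)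
  finally have boundary: "hom_relboundary (int (Suc k)) (subtopology (cw_space T) (skeleton T (int (Suc k)))) (skeleton T (int k)) (skeleton T (int k - 1)) ?z
      = hom_relboundary (int (Suc k)) ?ZX ?S ?U (cell_class X (Suc k) a)"
    unfolding subcomplex_skeleton(2)[OF T] using skel[of "int k"] skel[of "int k - 1"] by simp
  have H: "skeletal_homology T k = skeletal_homology X k"
    unfolding skeletal_homology_def subcomplex_skeleton(2)[OF T] using skel[of "int k"] skel[of "int k - 1"] by simp
  have C: "cell_class T k = cell_class X k"
    unfolding cell_class_def subcomplex_skeleton(2)[OF T] cm fun_eq_iff using skel[of "int k"] skel[of "int k - 1"] by simp
  show ?thesis
    unfolding incidence_def boundary H C low[OF order_refl] ..
qed

lemma boundary_map_subcomplex:
  assumes "subcomplex T X" "\<And>j. j \<le> k \<Longrightarrow> cells T j = cells X j" "x \<in> chains T (Suc k)"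
  shows "boundary_map T (Suc k) x = boundary_map X (Suc k) x"
  using assms incidence_subcomplex[OF assms(1,2)] by (auto simp: chains_def intro!: sum.cong)

end

text \<open>
  The \<open>(d-1)\<close>-skeleton together with the \<open>d\<close>-cells in \<open>S\<close>. All spanning trees have this form.
\<close>

definition with_top_cells :: "('a, 'c) cw \<Rightarrow> nat \<Rightarrow> 'c set \<Rightarrow> ('a, 'c) cw" where
  "with_top_cells X d S = \<lparr>cw_space = subtopology (cw_space X) (skeleton X (int d - 1) \<union> (\<Union>c\<in>S. open_cell X d c)),
     cells = (\<lambda>k. if k < d then cells X k else if k = d then S else {}),
     char_map = char_map X\<rparr>"

lemma cells_with_top_cells: "cells (with_top_cells X d S) k = (if k < d then cells X k else if k = d then S else {})"
  by (simp add: with_top_cells_def)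

lemma union_cells_with_top_cells:
  "(\<Union>k. \<Union>c\<in>cells (with_top_cells X d S) k. open_cell X k c) = skeleton X (int d - 1) \<union> (\<Union>c\<in>S. open_cell X d c)"
  (is "?L = ?R")
proof -
  have "UNIV = {..<d} \<union> {d} \<union> {d<..}" by auto
  then have "?L = (\<Union>k\<in>{..<d} \<union> {d} \<union> {d<..}. \<Union>c\<in>cells (with_top_cells X d S) k. open_cell X k c)"
    by simp
  also have "\<dots> = (\<Union>k\<in>{..<d}. \<Union>c\<in>cells X k. open_cell X k c) \<union> (\<Union>c\<in>S. open_cell X d c)"
    by (simp add: UN_Un cells_with_top_cells Un_commute)
  finally have "?L = (\<Union>k\<in>{..<d}. \<Union>c\<in>cells X k. open_cell X k c) \<union> (\<Union>c\<in>S. open_cell X d c)" .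
  moreover have "{j. int j \<le> int d - 1} = {..<d}" by auto
  ultimately show ?thesis by (simp add: skeleton_def)
qed

context finite_cw begin

lemma subcomplex_with_top_cells:
  assumes "S \<subseteq> cells X d"
  shows "subcomplex (with_top_cells X d S) X"
proof -
  let ?T = "with_top_cells X d S"
  have P: "skeleton X (int d - 1) \<union> (\<Union>c\<in>S. open_cell X d c) = partial_skeleton d S" by (simp add: partial_skeleton_def)
  have top: "topspace (cw_space ?T) = partial_skeleton d S"
    using part_topspace[OF assms] by (auto simp: with_top_cells_def P)
  have "char_map X k c ` topspace (disk k) \<subseteq> topspace (cw_space ?T)" if "c \<in> cells ?T k" for k c
  proof -
    have k: "k \<le> d" and c: "c \<in> cells X k"
      using that assms by (auto simp: cells_with_top_cells split: if_splits)
    have "open_cell X k c \<subseteq> (\<Union>k. \<Union>c\<in>cells ?T k. open_cell X k c)" using that by blast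
    then have "open_cell X k c \<subseteq> partial_skeleton d S" unfolding union_cells_with_top_cells P .
    moreover have "char_map X k c ` disk_boundary k \<subseteq> partial_skeleton d S"
      using char_map_boundary[OF c] skeleton_mono[of "int k - 1" "int d - 1"] k skeleton_part[of d S] by auto
    ultimately show ?thesis unfolding top char_map_disk by blast
  qed
  moreover have "cells ?T k \<subseteq> cells X k" for k
    using assms by (auto simp: cells_with_top_cells)
  ultimately show ?thesis
    unfolding subcomplex_def union_cells_with_top_cells by (simp add: with_top_cells_def)
qed

lemma subcomplex_eq_with_top_cells:
  assumes "has_dimension X d" "subcomplex T X" "\<forall>k<d. cells X k \<subseteq> cells T k"
  shows "T = with_top_cells X d (cells T d)"
proof -
  define S where "S = cells T d"
  have c: "cells T = cells (with_top_cells X d S)"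
  proof
    fix k
    have "cells T k \<subseteq> cells X k" using assms(2) by (simp add: subcomplex_def)
    then show "cells T k = cells (with_top_cells X d S) k"
      using assms(1,3) by (auto simp: cells_with_top_cells has_dimension_def not_less S_def)
  qed
  have "cw_space T = subtopology (cw_space X) (\<Union>k. \<Union>c\<in>cells T k. open_cell X k c)"
    using assms(2) by (simp add: subcomplex_def)
  also have "\<dots> = cw_space (with_top_cells X d S)"
    unfolding c union_cells_with_top_cells[of X d S] by (simp add: with_top_cells_def)
  finally have "cw_space T = cw_space (with_top_cells X d S)" .
  moreover have "char_map T = char_map (with_top_cells X d S)"
    using assms(2) by (simp add: subcomplex_def with_top_cells_def)
  ultimately have "T = with_top_cells X d S"
    using c by (intro cw.equality) auto
  then show ?thesis by (simp add: S_def)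
qed

text \<open>
  Cycles in degree \<open>k\<close> depend on the \<open>k\<close>-skeleton only. The choice of the \<open>(k+1)\<close>-cells affects the boundaries in degree
  \<open>k\<close> and the cycles in degree \<open>k + 1\<close>.
\<close>

lemma homology_with_top_cells:
  assumes S: "S \<subseteq> cells X (Suc k)"
  defines "T \<equiv> with_top_cells X (Suc k) S"
  shows "cycles T k = (cycles X k :: 'c zchain set)"
    and "boundaries T k = boundary_map X (Suc k) ` {x :: 'c zchain. Poly_Mapping.keys x \<subseteq> S}"
    and "cycles T (Suc k) = {x :: 'c zchain. Poly_Mapping.keys x \<subseteq> S \<and> boundary_map X (Suc k) x = 0}"
    and "boundaries T (Suc k) = {0 :: 'c zchain}"
proof -
  have T: "subcomplex T X" unfolding T_def by (rule subcomplex_with_top_cells[OF S])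
  have low: "cells T j = cells X j" if "j \<le> k" for j using that by (simp add: T_def cells_with_top_cells)
  have topT: "cells T (Suc k) = S" "cells T (Suc (Suc k)) = {}" by (simp_all add: T_def cells_with_top_cells)
  show "cycles T k = (cycles X k :: 'c zchain set)"
  proof (cases k)
    case 0
    then show ?thesis using low[of 0] by (simp add: cycles_def chains_def)
  next
    case (Suc j)
    have ch: "chains T k = (chains X k :: 'c zchain set)" using low by (simp add: chains_def)
    have "boundary_map T k x = boundary_map X k x" if "x \<in> chains X k" for x :: "'c zchain"
      using boundary_map_subcomplex[OF T, of j x] low that Suc by (simp add: chains_def)
    then show ?thesis unfolding cycles_def ch by (intro Collect_cong conj_cong refl) simp_all
  qed
  have chT: "chains T (Suc k) = {x :: 'c zchain. Poly_Mapping.keys x \<subseteq> S}" by (simp add: chains_def topT)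
  have bdT: "boundary_map T (Suc k) x = boundary_map X (Suc k) x" if "x \<in> chains T (Suc k)" for x :: "'c zchain"
    by (rule boundary_map_subcomplex[OF T low that])
  show "boundaries T k = boundary_map X (Suc k) ` {x :: 'c zchain. Poly_Mapping.keys x \<subseteq> S}"
    unfolding boundaries_def chT[symmetric] by (intro image_cong refl bdT)
  show "cycles T (Suc k) = {x :: 'c zchain. Poly_Mapping.keys x \<subseteq> S \<and> boundary_map X (Suc k) x = 0}"
    using bdT unfolding cycles_def chT by (intro Collect_cong conj_cong) (simp_all only: mem_Collect_eq)
  have "chains T (Suc (Suc k)) = {0 :: 'c zchain}" by (auto simp: chains_def topT)
  then show "boundaries T (Suc k) = {0 :: 'c zchain}" by (simp add: boundaries_def)
qed

end

section \<open>A weighted Cauchy-Binet formula\<close>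

text \<open>
  Expanding the rows multilinearly gives a sum over all maps \<open>f\<close> from the row indices to \<open>I\<close>, in which the
  non-injective maps contribute determinants with two equal columns. The injective maps with image \<open>S\<close> are the
  permutations of one enumeration \<open>e S\<close>, and their sum is the product of the weights times the square of one determinant.
\<close>

theorem det_weighted_gram:
  fixes q :: "nat \<Rightarrow> 'i \<Rightarrow> 'a::comm_ring_1"
  assumes I: "finite I"
    and e: "\<And>S. S \<subseteq> I \<Longrightarrow> card S = r \<Longrightarrow> bij_betw (e S) {0..<r} S"
  shows "Determinant.det (mat r r (\<lambda>(i, j). \<Sum>a\<in>I. w a * q i a * q j a)) =
    (\<Sum>S | S \<subseteq> I \<and> card S = r. (\<Prod>a\<in>S. w a) * (Determinant.det (mat r r (\<lambda>(i, j). q i (e S j))))\<^sup>2)"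
proof -
  let ?R = "{0..<r}"
  let ?P = "{p. p permutes ?R}"
  let ?F = "?R \<rightarrow>\<^sub>E I"
  let ?M = "\<lambda>f. mat r r (\<lambda>(i, j). q i (f j))"
  have finF: "finite ?F" using I by (intro finite_PiE) auto
  have det_M: "Determinant.det (?M f) = (\<Sum>p\<in>?P. signof p * (\<Prod>i\<in>?R. q (p i) (f i)))" for f
  proof -
    have "Determinant.det (?M f) = (\<Sum>p\<in>?P. signof p * (\<Prod>j<r. ?M f $$ (p j, j)))"
      by (subst det_col[of _ r]) auto
    also have "\<dots> = (\<Sum>p\<in>?P. signof p * (\<Prod>i\<in>?R. q (p i) (f i)))"
      by (intro sum.cong refl arg_cong2[where f = "(*)"] prod.cong)
         (auto simp: lessThan_atLeast0 permutes_in_image[where S = ?R, simplified])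
    finally show ?thesis .
  qed
  have "Determinant.det (mat r r (\<lambda>(i, j). \<Sum>a\<in>I. w a * q i a * q j a))
      = (\<Sum>p\<in>?P. signof p * (\<Prod>i\<in>?R. \<Sum>a\<in>I. w a * q i a * q (p i) a))"
    unfolding Determinant.det_def
    by (auto intro!: sum.cong prod.cong arg_cong2[where f = "(*)"] simp: permutes_in_image[where S = ?R, simplified])
  also have "\<dots> = (\<Sum>p\<in>?P. signof p * (\<Sum>f\<in>?F. \<Prod>i\<in>?R. w (f i) * q i (f i) * q (p i) (f i)))"
    using I by (subst prod_sum_PiE) auto
  also have "\<dots> = (\<Sum>f\<in>?F. \<Sum>p\<in>?P. signof p * (\<Prod>i\<in>?R. w (f i) * q i (f i) * q (p i) (f i)))"
    unfolding sum_distrib_left by (rule sum.swap)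
  also have "\<dots> = (\<Sum>f\<in>?F. (\<Prod>i\<in>?R. w (f i) * q i (f i)) * Determinant.det (?M f))"
    unfolding det_M sum_distrib_left prod.distrib by (intro sum.cong refl) (simp add: ac_simps)
  also have "\<dots> = (\<Sum>f | f \<in> ?F \<and> inj_on f ?R. (\<Prod>i\<in>?R. w (f i) * q i (f i)) * Determinant.det (?M f))"
  proof (rule sum.mono_neutral_right[OF finF])
    show "\<forall>f\<in>?F - {f \<in> ?F. inj_on f ?R}. (\<Prod>i\<in>?R. w (f i) * q i (f i)) * Determinant.det (?M f) = 0"
    proof
      fix f assume "f \<in> ?F - {f \<in> ?F. inj_on f ?R}"
      then obtain i j where ij: "i < r" "j < r" "i \<noteq> j" "f i = f j" by (auto simp: inj_on_def)
      then have "Determinant.det (?M f) = 0"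
        by (intro det_identical_columns[of _ r i j]) (auto intro!: eq_vecI)
      then show "(\<Prod>i\<in>?R. w (f i) * q i (f i)) * Determinant.det (?M f) = 0" by simp
    qed
  qed auto
  also have "\<dots> = (\<Sum>S | S \<subseteq> I \<and> card S = r. \<Sum>f | f \<in> {f \<in> ?F. inj_on f ?R} \<and> f ` ?R = S.
      (\<Prod>i\<in>?R. w (f i) * q i (f i)) * Determinant.det (?M f))"
    using finF I by (intro sum.group[symmetric]) (auto simp: card_image)
  also have "\<dots> = (\<Sum>S | S \<subseteq> I \<and> card S = r. (\<Prod>a\<in>S. w a) * (Determinant.det (?M (e S)))\<^sup>2)"
  proof (rule sum.cong[OF refl])
    fix S assume "S \<in> {S. S \<subseteq> I \<and> card S = r}"
    then have S: "S \<subseteq> I" "card S = r" by auto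
    let ?e = "e S"
    have be: "bij_betw ?e ?R S" by (rule e[OF S])
    let ?h = "\<lambda>p. restrict (?e \<circ> p) ?R"
    have h: "bij_betw ?h ?P {f. f \<in> {f \<in> ?F. inj_on f ?R} \<and> f ` ?R = S}"
    proof (rule bij_betwI')
      fix p p' assume p: "p \<in> ?P" "p' \<in> ?P"
      show "?h p = ?h p' \<longleftrightarrow> p = p'"
      proof
        assume eq: "?h p = ?h p'"
        show "p = p'"
        proof
          fix i show "p i = p' i"
          proof (cases "i \<in> ?R")
            case True
            then have "p i \<in> ?R" "p' i \<in> ?R" using p by (simp_all only: mem_Collect_eq permutes_in_image)
            moreover have "?e (p i) = ?e (p' i)" using fun_cong[OF eq, of i] True by simp
            ultimately show ?thesis using be unfolding bij_betw_def inj_on_def by blast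
          next
            case False
            then show ?thesis using p by (simp add: permutes_not_in)
          qed
        qed
      qed simp
    next
      fix p assume "p \<in> ?P"
      then have p: "p permutes ?R" by simp
      have "bij_betw (?e \<circ> p) ?R S"
        using bij_betw_trans[OF permutes_imp_bij[OF p] be] .
      then have b: "bij_betw (?h p) ?R S" by (rule bij_betw_cong[THEN iffD1, rotated]) simp
      then have "?h p \<in> ?F" using S by (intro restrict_PiE_iff[THEN iffD2]) (auto simp: bij_betw_def)
      then show "?h p \<in> {f. f \<in> {f \<in> ?F. inj_on f ?R} \<and> f ` ?R = S}"
        using b unfolding bij_betw_def by blast
    next
      fix f assume "f \<in> {f. f \<in> {f \<in> ?F. inj_on f ?R} \<and> f ` ?R = S}"
      then have f: "f \<in> ?F" "bij_betw f ?R S" unfolding bij_betw_def by auto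
      define p where "p i = (if i \<in> ?R then inv_into ?R ?e (f i) else i)" for i
      have "bij_betw (inv_into ?R ?e \<circ> f) ?R ?R"
        using bij_betw_trans[OF f(2) bij_betw_inv_into[OF be]] .
      then have "bij_betw p ?R ?R"
        by (rule bij_betw_cong[THEN iffD1, rotated]) (simp add: p_def)
      then have "p permutes ?R" by (rule bij_imp_permutes) (auto simp: p_def)
      moreover have "?h p = f"
      proof
        fix i show "?h p i = f i"
        proof (cases "i \<in> ?R")
          case True
          then have "f i \<in> ?e ` ?R" using f(2) be by (auto simp: bij_betw_def)
          then show ?thesis using True by (simp add: p_def f_inv_into_f)
        next
          case False
          then have "f i = undefined" using PiE_arb[OF f(1)] by blast
          then show ?thesis using False by simp
        qed
      qed
      ultimately show "\<exists>p\<in>?P. f = ?h p" by blast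
    qed
    have "(\<Sum>f | f \<in> {f \<in> ?F. inj_on f ?R} \<and> f ` ?R = S. (\<Prod>i\<in>?R. w (f i) * q i (f i)) * Determinant.det (?M f))
        = (\<Sum>p\<in>?P. (\<Prod>i\<in>?R. w (?h p i) * q i (?h p i)) * Determinant.det (?M (?h p)))"
      by (rule sum.reindex_bij_betw[OF h, symmetric])
    also have "\<dots> = (\<Sum>p\<in>?P. (\<Prod>a\<in>S. w a) * Determinant.det (?M ?e) * (signof p * (\<Prod>i\<in>?R. q i (?e (p i)))))"
    proof (rule sum.cong[OF refl])
      fix p assume "p \<in> ?P"
      then have p: "p permutes ?R" by simp
      have "(\<Prod>i\<in>?R. w (?e (p i))) = (\<Prod>i\<in>?R. w (?e i))"
        using prod.reindex_bij_betw[OF permutes_imp_bij[OF p], of "\<lambda>i. w (?e i)"] .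
      also have "\<dots> = (\<Prod>a\<in>S. w a)" by (rule prod.reindex_bij_betw[OF be])
      finally have w: "(\<Prod>i\<in>?R. w (?e (p i))) = (\<Prod>a\<in>S. w a)" .
      let ?A = "transpose_mat (?M ?e)"
      have A: "?A \<in> carrier_mat r r" by simp
      have "transpose_mat (mat r r (\<lambda>(i, j). ?A $$ (p i, j))) = ?M (?h p)"
        by (rule eq_matI) (auto simp: permutes_in_image[OF p, simplified])
      then have "Determinant.det (?M (?h p)) = signof p * Determinant.det (?M ?e)"
        using det_permute_rows[OF A p] det_transpose[OF A] by (metis det_transpose mat_carrier transpose_transpose)
      then show "(\<Prod>i\<in>?R. w (?h p i) * q i (?h p i)) * Determinant.det (?M (?h p))
          = (\<Prod>a\<in>S. w a) * Determinant.det (?M ?e) * (signof p * (\<Prod>i\<in>?R. q i (?e (p i))))"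
        using w by (simp add: prod.distrib ac_simps)
    qed
    also have "\<dots> = (\<Prod>a\<in>S. w a) * Determinant.det (?M ?e) * (\<Sum>p\<in>?P. signof p * (\<Prod>i\<in>?R. q i (?e (p i))))"
      by (rule sum_distrib_left[symmetric])
    also have "(\<Sum>p\<in>?P. signof p * (\<Prod>i\<in>?R. q i (?e (p i)))) = Determinant.det (?M ?e)"
      unfolding Determinant.det_def
      by (auto intro!: sum.cong prod.cong arg_cong2[where f = "(*)"] simp: permutes_in_image[where S = ?R, simplified])
    finally show "(\<Sum>f | f \<in> {f \<in> ?F. inj_on f ?R} \<and> f ` ?R = S. (\<Prod>i\<in>?R. w (f i) * q i (f i)) * Determinant.det (?M f))
        = (\<Prod>a\<in>S. w a) * (Determinant.det (?M ?e))\<^sup>2"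
      by (simp add: power2_eq_square mult.assoc)
  qed
  finally show ?thesis .
qed

section \<open>Linear combinations over lists\<close>

text \<open>
  Bases are handled as lists, because determinants need an order. The setting of modules covers integral chains, where
  the scalars are integers, as well as real chains.
\<close>

locale module_lists = Modules.module smul
  for smul :: "'a::comm_ring_1 \<Rightarrow> 'b::ab_group_add \<Rightarrow> 'b"
begin

definition comb :: "'b list \<Rightarrow> (nat \<Rightarrow> 'a) \<Rightarrow> 'b" where
  "comb xs c = (\<Sum>i<length xs. smul (c i) (xs ! i))"

definition independent_list :: "'b list \<Rightarrow> bool" where
  "independent_list xs \<longleftrightarrow> (\<forall>c. comb xs c = 0 \<longrightarrow> (\<forall>i<length xs. c i = 0))"

lemma comb_add: "comb xs (\<lambda>i. c i + d i) = comb xs c + comb xs d"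
  by (simp add: comb_def scale_left_distrib sum.distrib)

lemma comb_diff: "comb xs (\<lambda>i. c i - d i) = comb xs c - comb xs d"
  by (simp add: comb_def scale_left_diff_distrib sum_subtractf)

lemma comb_scale: "comb xs (\<lambda>i. r * c i) = smul r (comb xs c)"
  by (simp add: comb_def scale_sum_right)

lemma comb_zero [simp]: "comb xs (\<lambda>i. 0) = 0"
  by (simp add: comb_def)

lemma comb_cong: "(\<And>i. i < length xs \<Longrightarrow> c i = d i) \<Longrightarrow> comb xs c = comb xs d"
  by (simp add: comb_def)

lemma comb_unit: "j < length xs \<Longrightarrow> comb xs (\<lambda>i. if i = j then 1 else 0) = xs ! j"
  unfolding comb_def by (subst sum.remove[of _ j]) (auto intro!: sum.neutral)

lemma comb_snoc: "comb (xs @ [x]) c = comb xs c + smul (c (length xs)) x"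
  by (simp add: comb_def nth_append)

lemma comb_comb:
  assumes "\<And>j. j < length ys \<Longrightarrow> ys ! j = comb xs (\<lambda>i. N i j)"
  shows "comb ys c = comb xs (\<lambda>i. \<Sum>j<length ys. N i j * c j)"
proof -
  have "comb ys c = (\<Sum>j<length ys. \<Sum>i<length xs. smul (N i j * c j) (xs ! i))"
    unfolding comb_def[of ys] using assms
    by (intro sum.cong refl) (simp add: comb_def scale_sum_right mult.commute)
  also have "\<dots> = comb xs (\<lambda>i. \<Sum>j<length ys. N i j * c j)"
    unfolding comb_def scale_sum_left by (rule sum.swap)
  finally show ?thesis .
qed

lemma span_list: "span (set xs) = range (comb xs)"
proof
  have "subspace (range (comb xs))"
    unfolding subspace_def by (auto simp flip: comb_add comb_scale intro: range_eqI[of _ _ "\<lambda>i. 0"])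
  moreover have "set xs \<subseteq> range (comb xs)"
    by (auto simp: in_set_conv_nth simp flip: comb_unit)
  ultimately show "span (set xs) \<subseteq> range (comb xs)" by (rule span_minimal[rotated])
  show "range (comb xs) \<subseteq> span (set xs)"
    unfolding comb_def by (auto intro!: span_sum span_scale intro: span_base)
qed

lemma independent_list_unique:
  assumes "independent_list xs" "comb xs c = comb xs d" "i < length xs"
  shows "c i = d i"
  using assms comb_diff[of xs c d] unfolding independent_list_def by (metis eq_iff_diff_eq_0)

lemma independent_list_distinct:
  assumes "independent_list xs" shows "distinct xs"
  unfolding distinct_conv_nth
proof (intro allI impI notI)
  fix i j assume *: "i < length xs" "j < length xs" "i \<noteq> j" "xs ! i = xs ! j"
  have "(if i = i then 1 else 0 :: 'a) = (if i = j then 1 else 0)"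
    by (rule independent_list_unique[OF assms, of "\<lambda>k. if k = i then 1 else 0" "\<lambda>k. if k = j then 1 else 0"])
       (use * in \<open>simp_all add: comb_unit\<close>)
  then show False using * by simp
qed

lemma independent_list_iff: "independent_list xs \<longleftrightarrow> distinct xs \<and> independent (set xs)"
proof (intro iffI conjI)
  assume i: "independent_list xs"
  then show d: "distinct xs" by (rule independent_list_distinct)
  have bij: "bij_betw ((!) xs) {..<length xs} (set xs)" using d by (rule bij_betw_nth) auto
  show "independent (set xs)"
    unfolding independent_explicit_module
  proof (intro allI impI)
    fix t u v assume t: "finite t" "t \<subseteq> set xs" "(\<Sum>x\<in>t. smul (u x) x) = 0" "v \<in> t"
    let ?c = "\<lambda>x. if x \<in> t then u x else 0"
    have "(\<Sum>x\<in>set xs. smul (?c x) x) = (\<Sum>x\<in>t. smul (u x) x)"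
      using t by (intro sum.mono_neutral_cong_right) auto
    then have "comb xs (\<lambda>i. ?c (xs ! i)) = 0"
      unfolding comb_def using t sum.reindex_bij_betw[OF bij, of "\<lambda>x. smul (?c x) x"] by simp
    moreover obtain j where "j < length xs" "xs ! j = v" using t by (metis in_set_conv_nth subsetD)
    ultimately have "?c v = 0" using i unfolding independent_list_def by blast
    then show "u v = 0" using t by simp
  qed
next
  assume *: "distinct xs \<and> independent (set xs)"
  then have bij: "bij_betw ((!) xs) {..<length xs} (set xs)" by (intro bij_betw_nth) auto
  show "independent_list xs"
    unfolding independent_list_def
  proof (intro allI impI)
    fix c i assume 0: "comb xs c = 0" and i: "i < length xs"
    let ?f = "\<lambda>x. c (the_inv_into {..<length xs} ((!) xs) x)"
    have inv: "the_inv_into {..<length xs} ((!) xs) (xs ! i) = i" if "i < length xs" for i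
      using bij that by (intro the_inv_into_f_f) (auto simp: bij_betw_def)
    have "(\<Sum>x\<in>set xs. smul (?f x) x) = comb xs c"
      unfolding comb_def by (subst sum.reindex_bij_betw[OF bij, symmetric]) (auto simp: inv intro!: sum.cong)
    then have "?f (xs ! i) = 0"
      using independentD[of "set xs" "set xs" ?f "xs ! i"] * 0 i by auto
    then show "c i = 0" using inv[OF i] by simp
  qed
qed

end

interpretation frag: module_lists "frag_cmul :: int \<Rightarrow> ('c \<Rightarrow>\<^sub>0 int) \<Rightarrow> _"
  by unfold_locales (simp_all add: frag_cmul_distrib frag_cmul_distrib2 algebra_simps)

lemma lattice_basis_iff: "lattice_basis A es \<longleftrightarrow> frag.independent_list es \<and> range (frag.comb es) = A"
  by (auto simp: lattice_basis_def frag.independent_list_iff frag.span_list)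

lemma lattice_basis_subspace:
  assumes "lattice_basis A es"
  shows "frag.subspace A" "set es \<subseteq> A"
proof -
  have A: "A = frag.span (set es)" using assms by (simp add: lattice_basis_iff frag.span_list)
  show "frag.subspace A" unfolding A by (rule frag.subspace_span)
  show "set es \<subseteq> A" unfolding A by (rule frag.span_superset)
qed

lemma subspace_range_comb: "frag.subspace (range (frag.comb us))"
  unfolding frag.span_list[symmetric] by (rule frag.subspace_span)

lemma frag_span_subspace: "frag.subspace U \<Longrightarrow> frag.span U = U"
  by (intro subset_antisym frag.span_minimal frag.span_superset order_refl)

section \<open>The index of a subgroup of integral chains\<close>

text \<open>
  The index is the number of cosets. It is \<open>0\<close> if there are infinitely many of them, which keeps
  \<open>lattice_index_mult\<close> free of finiteness assumptions. Subgroups are written as submodules over the integers.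
\<close>

definition coset :: "'g::ab_group_add set \<Rightarrow> 'g \<Rightarrow> 'g set" where
  "coset U x = (+) x ` U"

definition lattice_index :: "'c zchain set \<Rightarrow> 'c zchain set \<Rightarrow> nat" where
  "lattice_index A U = card (coset U ` A)"

lemma coset_eq_iff:
  assumes "frag.subspace U"
  shows "coset U x = coset U y \<longleftrightarrow> x - y \<in> U"
proof
  assume eq: "coset U x = coset U y"
  have "x + 0 \<in> coset U x" using frag.subspace_0[OF assms] unfolding coset_def by (rule imageI)
  then show "x - y \<in> U" unfolding eq by (auto simp: coset_def)
next
  have sub: "coset U x \<subseteq> coset U y" if d: "x - y \<in> U" for x y
  proof
    fix z assume "z \<in> coset U x"
    then obtain u where u: "u \<in> U" "z = x + u" by (auto simp: coset_def)
    then have "(x - y) + u \<in> U" using d by (intro frag.subspace_add[OF assms])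
    moreover have "z = y + ((x - y) + u)" using u by simp
    ultimately show "z \<in> coset U y" unfolding coset_def by blast
  qed
  assume "x - y \<in> U"
  moreover from this have "y - x \<in> U" using frag.subspace_neg[OF assms] by fastforce
  ultimately show "coset U x = coset U y" using sub by blast
qed

text \<open>
  Any function that separates exactly the cosets can be used to count them.
\<close>

lemma lattice_index_eq:
  assumes "frag.subspace U" "\<And>x y. x \<in> A \<Longrightarrow> y \<in> A \<Longrightarrow> g x = g y \<longleftrightarrow> x - y \<in> U"
  shows "lattice_index A U = card (g ` A)"
proof -
  have "bij_betw (\<lambda>K. g (SOME x. x \<in> A \<and> coset U x = K)) (coset U ` A) (g ` A)"
  proof -
    have *: "g (SOME y. y \<in> A \<and> coset U y = coset U x) = g x" if "x \<in> A" for x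
    proof -
      have "(SOME y. y \<in> A \<and> coset U y = coset U x) \<in> A \<and> coset U (SOME y. y \<in> A \<and> coset U y = coset U x) = coset U x"
        by (rule someI[of _ x]) (use that in simp)
      then show ?thesis using assms coset_eq_iff[OF assms(1)] that by simp
    qed
    show ?thesis
      unfolding bij_betw_def
    proof
      show "inj_on (\<lambda>K. g (SOME x. x \<in> A \<and> coset U x = K)) (coset U ` A)"
        using * assms(2) by (auto simp: inj_on_def coset_eq_iff[OF assms(1)])
      show "(\<lambda>K. g (SOME x. x \<in> A \<and> coset U x = K)) ` coset U ` A = g ` A"
        using * by (auto simp: image_iff)
    qed
  qed
  then show ?thesis unfolding lattice_index_def by (rule bij_betw_same_card)
qed

text \<open>
  With a representative \<open>s K\<close> chosen in each coset \<open>K\<close> of \<open>V\<close>, an element \<open>x\<close> of \<open>K\<close> is determined modulo \<open>U\<close> by \<open>K\<close> and the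
  coset of \<open>x - s K\<close> in \<open>V\<close>.
\<close>

theorem lattice_index_mult:
  assumes U: "frag.subspace U" and V: "frag.subspace V" and A: "frag.subspace A" and UV: "U \<subseteq> V" and VA: "V \<subseteq> A"
  shows "lattice_index A U = lattice_index A V * lattice_index V U"
proof -
  define s where "s K = (SOME y. y \<in> A \<and> coset V y = K)" for K
  have s: "s (coset V x) \<in> A" "coset V (s (coset V x)) = coset V x" if "x \<in> A" for x
    using someI[of "\<lambda>y. y \<in> A \<and> coset V y = coset V x" x] that unfolding s_def by auto
  let ?g = "\<lambda>x. (coset V x, coset U (x - s (coset V x)))"
  have "lattice_index A U = card (?g ` A)"
  proof (rule lattice_index_eq[OF U])
    fix x y assume "x \<in> A" "y \<in> A"
    have "coset V x = coset V y \<and> coset U (x - s (coset V x)) = coset U (y - s (coset V x)) \<longleftrightarrow> x - y \<in> U"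
      unfolding coset_eq_iff[OF U] coset_eq_iff[OF V] using UV by auto
    then show "?g x = ?g y \<longleftrightarrow> x - y \<in> U" by auto
  qed
  also have "?g ` A = (coset V ` A) \<times> (coset U ` V)"
  proof
    show "?g ` A \<subseteq> (coset V ` A) \<times> (coset U ` V)"
    proof
      fix z assume "z \<in> ?g ` A"
      then obtain x where x: "x \<in> A" "z = ?g x" by blast
      have "x - s (coset V x) \<in> V" using s(2)[OF x(1)] unfolding coset_eq_iff[OF V]
        using frag.subspace_neg[OF V] by fastforce
      then show "z \<in> (coset V ` A) \<times> (coset U ` V)" using x by blast
    qed
    show "(coset V ` A) \<times> (coset U ` V) \<subseteq> ?g ` A"
    proof clarify
      fix x v assume x: "x \<in> A" and v: "v \<in> V"
      let ?y = "s (coset V x) + v"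
      have y: "?y \<in> A" using s(1)[OF x] v VA by (auto intro: frag.subspace_add[OF A])
      have "coset V ?y = coset V (s (coset V x))" using v by (simp add: coset_eq_iff[OF V])
      then have "coset V ?y = coset V x" using s(2)[OF x] by simp
      then have "?g ?y = (coset V x, coset U v)" by simp
      then show "(coset V x, coset U v) \<in> ?g ` A" using imageI[OF y, of ?g] by simp
    qed
  qed
  finally show ?thesis by (simp add: card_cartesian_product lattice_index_def)
qed

section \<open>Triangular generators of a subgroup\<close>

lemma int_subgroup_principal:
  fixes M :: "int set"
  assumes "0 \<in> M" "\<And>x y. x \<in> M \<Longrightarrow> y \<in> M \<Longrightarrow> x - y \<in> M"
  obtains c where "c \<ge> 0" "c \<in> M" "\<And>m. m \<in> M \<Longrightarrow> c dvd m"
proof (cases "M = {0}")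
  case True
  then show ?thesis using that[of 0] by simp
next
  case False
  have neg: "- x \<in> M" if "x \<in> M" for x using assms(2)[OF assms(1) that] by simp
  have add: "x + y \<in> M" if "x \<in> M" "y \<in> M" for x y using assms(2)[OF that(1) neg[OF that(2)]] by simp
  from False assms(1) obtain a where "a \<in> M" "a \<noteq> 0" by auto
  then have ex: "\<exists>n::nat. n > 0 \<and> int n \<in> M"
    using neg[of a] by (intro exI[of _ "nat \<bar>a\<bar>"]) (auto simp: abs_if)
  define n where "n = (LEAST n::nat. n > 0 \<and> int n \<in> M)"
  have n: "n > 0" "int n \<in> M" using LeastI_ex[OF ex] unfolding n_def by auto
  have mult: "int k * int n \<in> M" for k by (induction k) (auto simp: assms(1) n(2) algebra_simps intro: add)
  have multi: "q * int n \<in> M" for q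
    using mult[of "nat q"] neg[OF mult[of "nat (-q)"]] by (cases "q \<ge> 0") auto
  have "int n dvd m" if m: "m \<in> M" for m
  proof -
    have r: "m mod int n \<in> M" using assms(2)[OF m multi[of "m div int n"]] by (simp add: minus_div_mult_eq_mod)
    have "m mod int n = 0"
    proof (rule ccontr)
      assume "m mod int n \<noteq> 0"
      moreover have "0 \<le> m mod int n" "m mod int n < int n" using n by auto
      ultimately have "nat (m mod int n) > 0 \<and> int (nat (m mod int n)) \<in> M" "nat (m mod int n) < n" using r by auto
      then show False using not_less_Least[of "nat (m mod int n)" "\<lambda>n. n > 0 \<and> int n \<in> M"] unfolding n_def by blast
    qed
    then show ?thesis by auto
  qed
  then show ?thesis using that[of "int n"] n by auto
qed

text \<open>
  This is the Hermite normal form. Induction on the given basis: the last coordinates of the elements of \<open>L\<close> form an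
  ideal generated by some \<open>c\<close>, and \<open>L\<close> is generated by one element \<open>h\<close> with last coordinate \<open>c\<close> and by the elements with
  last coordinate \<open>0\<close>. If \<open>c = 0\<close> then \<open>h = 0\<close> is taken. The list \<open>hs\<close> keeps such zero entries and has the length of \<open>es\<close>,
  which makes its coordinate matrix square, while the list \<open>bs\<close> drops them and is a basis of \<open>L\<close>. In the
  nonsingular case the index is multiplied by \<open>\<bar>c\<bar>\<close> in each step.
\<close>

theorem triangular_generators:
  assumes "frag.independent_list es" "frag.subspace L" "L \<subseteq> range (frag.comb es)"
  obtains hs H bs where "length hs = length es"
    "\<And>j. j < length es \<Longrightarrow> hs ! j = frag.comb es (\<lambda>i. H i j)"
    "\<And>i j. j < i \<Longrightarrow> H i j = 0"
    "range (frag.comb hs) = L"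
    "(\<And>j. j < length es \<Longrightarrow> H j j \<noteq> 0) \<Longrightarrow>
       int (lattice_index (range (frag.comb es)) L) = \<bar>\<Prod>j<length es. H j j\<bar>"
    "frag.independent_list bs" "range (frag.comb bs) = L"
proof -
  have "\<exists>hs H bs. length hs = length es \<and> (\<forall>j<length es. hs ! j = frag.comb es (\<lambda>i. H i j)) \<and>
      (\<forall>i j. j < i \<longrightarrow> H i j = 0) \<and> range (frag.comb hs) = L \<and>
      ((\<forall>j<length es. H j j \<noteq> 0) \<longrightarrow> int (lattice_index (range (frag.comb es)) L) = \<bar>\<Prod>j<length es. H j j\<bar>) \<and>
      frag.independent_list bs \<and> range (frag.comb bs) = L"
    using assms
  proof (induction es arbitrary: L rule: rev_induct)
    case Nil
    have r: "range (frag.comb []) = {0}" by (auto simp: frag.comb_def)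
    have "L = {0}" using Nil frag.subspace_0[of L] unfolding r by blast
    moreover have "lattice_index {0} {0::'a zchain} = 1"
      by (simp add: lattice_index_def)
    ultimately show ?case by (intro exI[of _ "[]"] exI[of _ "\<lambda>_ _. 0"] exI[of _ "[]"])
        (simp add: r frag.independent_list_def)
  next
    case (snoc e es)
    let ?n = "length es" and ?E = "range (frag.comb es)" and ?E' = "range (frag.comb (es @ [e]))"
    have sE: "frag.subspace ?E" "frag.subspace ?E'" by (rule subspace_range_comb)+
    have uniq: "x = y \<and> m = k" if "x \<in> ?E" "y \<in> ?E" "x + frag_cmul m e = y + frag_cmul k e" for x y m k
    proof -
      obtain c d where c: "x = frag.comb es c" "y = frag.comb es d" using \<open>x \<in> ?E\<close> \<open>y \<in> ?E\<close> by auto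
      have eq: "frag.comb (es @ [e]) (c(?n := m)) = x + frag_cmul m e"
        "frag.comb (es @ [e]) (d(?n := k)) = y + frag_cmul k e"
        unfolding frag.comb_snoc c by (auto intro!: arg_cong2[where f = "(+)"] frag.comb_cong)
      have "m = k"
        using frag.independent_list_unique[OF snoc.prems(1), of "c(?n := m)" "d(?n := k)" ?n] eq that(3) by simp
      then show ?thesis using that(3) by simp
    qed
    have E'_iff: "z \<in> ?E' \<longleftrightarrow> (\<exists>x m. x \<in> ?E \<and> z = x + frag_cmul m e)" for z
    proof
      assume "\<exists>x m. x \<in> ?E \<and> z = x + frag_cmul m e"
      then obtain c m where "z = frag.comb es c + frag_cmul m e" by auto
      also have "\<dots> = frag.comb (es @ [e]) (c(?n := m))"
        unfolding frag.comb_snoc by (auto intro!: arg_cong2[where f = "(+)"] frag.comb_cong)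
      finally show "z \<in> ?E'" by simp
    qed (auto simp: frag.comb_snoc)
    have ind: "frag.independent_list es"
      unfolding frag.independent_list_def
    proof (intro allI impI)
      fix c i assume "frag.comb es c = 0" "i < ?n"
      then have "frag.comb (es @ [e]) (c(?n := 0)) = frag.comb (es @ [e]) (\<lambda>i. 0)"
        unfolding frag.comb_snoc frag.comb_zero by (auto intro: frag.comb_cong[THEN trans])
      then show "c i = 0"
        using frag.independent_list_unique[OF snoc.prems(1), of "c(?n := 0)" "\<lambda>i. 0" i] \<open>i < ?n\<close> by simp
    qed
    let ?M = "{m. \<exists>x\<in>?E. x + frag_cmul m e \<in> L}"
    obtain c where c: "c \<ge> 0" "c \<in> ?M" "\<And>m. m \<in> ?M \<Longrightarrow> c dvd m"
    proof (rule int_subgroup_principal[of ?M])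
      have "0 + frag_cmul 0 e \<in> L" using frag.subspace_0[OF snoc.prems(2)] by simp
      then show "0 \<in> ?M" using frag.subspace_0[OF sE(1)] by blast
      fix m k assume "m \<in> ?M" "k \<in> ?M"
      then obtain x y where xy: "x \<in> ?E" "y \<in> ?E" "x + frag_cmul m e \<in> L" "y + frag_cmul k e \<in> L" by blast
      have "x - y \<in> ?E" "(x + frag_cmul m e) - (y + frag_cmul k e) \<in> L"
        using xy sE(1) snoc.prems(2) by (auto intro: frag.subspace_diff)
      moreover have "(x + frag_cmul m e) - (y + frag_cmul k e) = (x - y) + frag_cmul (m - k) e"
        by (simp add: frag.scale_left_diff_distrib)
      ultimately show "m - k \<in> ?M" by auto
    qed blast
    have "\<exists>h x0. h \<in> L \<and> x0 \<in> ?E \<and> h = x0 + frag_cmul c e \<and> (c = 0 \<longrightarrow> h = 0)"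
    proof (cases "c = 0")
      case True
      then show ?thesis using frag.subspace_0[OF snoc.prems(2)] frag.subspace_0[OF sE(1)]
        by (intro exI[of _ 0]) simp
    qed (use c(2) in blast)
    then obtain h x0 where h: "h \<in> L" "x0 \<in> ?E" "h = x0 + frag_cmul c e" "c = 0 \<Longrightarrow> h = 0" by blast
    obtain a where a: "x0 = frag.comb es a" using h(2) by auto
    let ?L0 = "L \<inter> ?E"
    have sL0: "frag.subspace ?L0" using snoc.prems(2) sE(1) by (rule frag.subspace_inter)
    obtain hs H bs where IH: "length hs = ?n" "\<forall>j<?n. hs ! j = frag.comb es (\<lambda>i. H i j)"
        "\<forall>i j. j < i \<longrightarrow> H i j = 0" "range (frag.comb hs) = ?L0"
        "(\<forall>j<?n. H j j \<noteq> 0) \<longrightarrow> int (lattice_index ?E ?L0) = \<bar>\<Prod>j<?n. H j j\<bar>"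
        "frag.independent_list bs" "range (frag.comb bs) = ?L0"
      using snoc.IH[OF ind sL0] by blast
    define H' where "H' i j = (if j = ?n then (if i < ?n then a i else if i = ?n then c else 0)
        else if i < ?n then H i j else 0)" for i j
    have 1: "length (hs @ [h]) = length (es @ [e])" using IH(1) by simp
    have 2: "(hs @ [h]) ! j = frag.comb (es @ [e]) (\<lambda>i. H' i j)" if "j < length (es @ [e])" for j
    proof (cases "j = ?n")
      case True
      then show ?thesis
        using IH(1) h(3) a by (auto simp: nth_append frag.comb_snoc H'_def intro!: arg_cong2[where f = "(+)"] frag.comb_cong)
    next
      case False
      then show ?thesis
        using that IH(1,2) by (auto simp: nth_append frag.comb_snoc H'_def intro!: frag.comb_cong)
    qed
    have 3: "\<forall>i j. j < i \<longrightarrow> H' i j = 0" using IH(3) by (auto simp: H'_def)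
    have split: "\<exists>q. y - frag_cmul q h \<in> ?L0" if y: "y \<in> L" for y
    proof -
      obtain x m where xm: "x \<in> ?E" "y = x + frag_cmul m e" using y snoc.prems(3) E'_iff by blast
      then have "m \<in> ?M" using y by auto
      then obtain q where q: "m = c * q" using c(3) by (auto elim: dvdE)
      have y': "y - frag_cmul q h = x - frag_cmul q x0"
        unfolding xm h(3) q by (simp add: frag_cmul_distrib2 mult.commute)
      have "y - frag_cmul q h \<in> L"
        using y h(1) snoc.prems(2) by (intro frag.subspace_diff frag.subspace_scale)
      moreover have "x - frag_cmul q x0 \<in> ?E"
        using xm h(2) sE(1) by (intro frag.subspace_diff frag.subspace_scale)
      ultimately have "y - frag_cmul q h \<in> ?L0" unfolding y' by blast
      then show ?thesis by blast
    qed
    have gen: "range (frag.comb (gs @ [h])) = L" if gs: "range (frag.comb gs) = ?L0" for gs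
    proof
      have "frag.comb gs b \<in> L" for b using gs by auto
      then show "range (frag.comb (gs @ [h])) \<subseteq> L"
        using h(1) snoc.prems(2) by (auto simp: frag.comb_snoc intro!: frag.subspace_add frag.subspace_scale)
      show "L \<subseteq> range (frag.comb (gs @ [h]))"
      proof
        fix y assume "y \<in> L"
        then obtain q where "y - frag_cmul q h \<in> range (frag.comb gs)" using split gs by blast
        then obtain b where b: "y - frag_cmul q h = frag.comb gs b" by blast
        have "frag.comb (gs @ [h]) (b(length gs := q)) = frag.comb gs b + frag_cmul q h"
          unfolding frag.comb_snoc by (auto intro!: arg_cong2[where f = "(+)"] frag.comb_cong)
        also have "\<dots> = y" by (simp flip: b)
        finally show "y \<in> range (frag.comb (gs @ [h]))" by (metis rangeI)
      qed
    qed
    \<comment> \<open>The triangular generators and the basis are extended by the same element \<open>h\<close>.\<close>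
    have 5: "range (frag.comb (hs @ [h])) = L" by (rule gen[OF IH(4)])
    have 7: "\<exists>bs. frag.independent_list bs \<and> range (frag.comb bs) = L"
    proof (cases "c = 0")
      case True
      then have "L \<subseteq> ?L0" using split h(4) by auto
      then have "range (frag.comb bs) = L" using IH(7) by blast
      then show ?thesis using IH(6) by blast
    next
      case False
      have "frag.independent_list (bs @ [h])"
        unfolding frag.independent_list_def
      proof (intro allI impI)
        fix b i assume 0: "frag.comb (bs @ [h]) b = 0" and i: "i < length (bs @ [h])"
        let ?m = "b (length bs)"
        have bE: "frag.comb bs b \<in> ?E" using IH(7) by blast
        have "frag.comb bs b + frag_cmul ?m x0 \<in> ?E"
          using bE h(2) sE(1) by (intro frag.subspace_add frag.subspace_scale)
        moreover have "(frag.comb bs b + frag_cmul ?m x0) + frag_cmul (?m * c) e = 0 + frag_cmul 0 e"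
          using 0 unfolding frag.comb_snoc h(3) by (simp add: frag_cmul_distrib2 add.assoc)
        ultimately have "?m * c = 0" using uniq frag.subspace_0[OF sE(1)] by blast
        then have m: "?m = 0" using False by simp
        then have "frag.comb bs b = 0" using 0 by (simp add: frag.comb_snoc)
        then show "b i = 0" using IH(6) i m by (auto simp: frag.independent_list_def less_Suc_eq)
      qed
      then show ?thesis using gen[OF IH(7)] by blast
    qed
    have 6: "int (lattice_index ?E' L) = \<bar>\<Prod>j<length (es @ [e]). H' j j\<bar>"
      if nz: "\<forall>j<length (es @ [e]). H' j j \<noteq> 0"
    proof -
      have c0: "c > 0" using nz c(1) by (auto simp: H'_def dest!: spec[of _ ?n])
      let ?V = "{x + y | x y. x \<in> L \<and> y \<in> ?E}"
      have sV: "frag.subspace ?V"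
      proof -
        have eq: "frag.span (L \<union> ?E) = ?V"
          unfolding frag.span_Un frag_span_subspace[OF snoc.prems(2)] frag_span_subspace[OF sE(1)] ..
        show ?thesis
          unfolding eq[symmetric] by (rule frag.subspace_span)
      qed
      have LV: "L \<subseteq> ?V" using frag.subspace_0[OF sE(1)] by force
      have EE': "?E \<subseteq> ?E'"
      proof
        fix x assume "x \<in> ?E"
        then have "x + frag_cmul 0 e \<in> ?E'" using E'_iff by blast
        then show "x \<in> ?E'" by simp
      qed
      have VE': "?V \<subseteq> ?E'" using snoc.prems(3) EE' by (auto intro!: frag.subspace_add[OF sE(2)])
      have V_iff: "x + frag_cmul m e \<in> ?V \<longleftrightarrow> c dvd m" if x: "x \<in> ?E" for x m
      proof
        assume "x + frag_cmul m e \<in> ?V"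
        then obtain l y where "l \<in> L" "y \<in> ?E" "x + frag_cmul m e = l + y" by blast
        then have "(x - y) + frag_cmul m e \<in> L" "x - y \<in> ?E"
          using x sE(1) by (simp_all add: algebra_simps frag.subspace_diff)
        then have "m \<in> ?M" by blast
        then show "c dvd m" by (rule c(3))
      next
        assume "c dvd m"
        then obtain q where q: "m = c * q" by (auto elim: dvdE)
        have "x + frag_cmul m e = frag_cmul q h + (x - frag_cmul q x0)"
          unfolding h(3) q by (simp add: frag_cmul_distrib2 mult.commute)
        moreover have "frag_cmul q h \<in> L" "x - frag_cmul q x0 \<in> ?E"
          using h x sE(1) snoc.prems(2) by (auto intro: frag.subspace_diff frag.subspace_scale)
        ultimately show "x + frag_cmul m e \<in> ?V" by blast
      qed
      \<comment> \<open>Modulo \<open>L + ?E\<close>, an element is determined by its last coordinate modulo \<open>c\<close>.\<close>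
      have V1: "lattice_index ?E' ?V = nat c"
      proof -
        define p where "p z = (THE m. \<exists>x\<in>?E. z = x + frag_cmul m e)" for z
        have p: "p (x + frag_cmul m e) = m" if "x \<in> ?E" for x m
          unfolding p_def using uniq that by (intro the_equality) blast+
        have "lattice_index ?E' ?V = card ((\<lambda>z. p z mod c) ` ?E')"
        proof (rule lattice_index_eq[OF sV])
          fix z z' assume "z \<in> ?E'" "z' \<in> ?E'"
          then obtain x m x' m' where z: "x \<in> ?E" "z = x + frag_cmul m e" "x' \<in> ?E" "z' = x' + frag_cmul m' e"
            using E'_iff by meson
          have "z - z' = (x - x') + frag_cmul (m - m') e" unfolding z by (simp add: frag.scale_left_diff_distrib)
          moreover have "x - x' \<in> ?E" using z sE(1) by (intro frag.subspace_diff)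
          ultimately have "z - z' \<in> ?V \<longleftrightarrow> c dvd m - m'" using V_iff by simp
          then show "p z mod c = p z' mod c \<longleftrightarrow> z - z' \<in> ?V"
            unfolding z by (simp add: p z mod_eq_dvd_iff)
        qed
        also have "(\<lambda>z. p z mod c) ` ?E' = {0..<c}"
        proof
          show "(\<lambda>z. p z mod c) ` ?E' \<subseteq> {0..<c}" using c0 by auto
          show "{0..<c} \<subseteq> (\<lambda>z. p z mod c) ` ?E'"
          proof
            fix m assume m: "m \<in> {0..<c}"
            have "0 + frag_cmul m e \<in> ?E'" using E'_iff frag.subspace_0[OF sE(1)] by blast
            moreover have "p (0 + frag_cmul m e) mod c = m" using m p[OF frag.subspace_0[OF sE(1)]] by simp
            ultimately show "m \<in> (\<lambda>z. p z mod c) ` ?E'" by (metis imageI)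
          qed
        qed
        finally show ?thesis by simp
      qed
      \<comment> \<open>This is the second isomorphism theorem: \<open>?V / L\<close> is \<open>?E / (L \<inter> ?E)\<close>.\<close>
      have V2: "lattice_index ?V L = lattice_index ?E ?L0"
      proof -
        have "lattice_index ?E ?L0 = card (coset L ` ?E)"
          by (rule lattice_index_eq[OF sL0]) (auto simp: coset_eq_iff[OF snoc.prems(2)] intro: frag.subspace_diff[OF sE(1)])
        also have "coset L ` ?E = coset L ` ?V"
        proof
          show "coset L ` ?E \<subseteq> coset L ` ?V" using frag.subspace_0[OF snoc.prems(2)] by (intro image_mono) force
          show "coset L ` ?V \<subseteq> coset L ` ?E"
          proof
            fix K assume "K \<in> coset L ` ?V"
            then obtain l y where ly: "l \<in> L" "y \<in> ?E" "K = coset L (l + y)" by blast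
            then have "K = coset L y" by (simp add: coset_eq_iff[OF snoc.prems(2)])
            then show "K \<in> coset L ` ?E" using ly(2) by (rule image_eqI)
          qed
        qed
        finally show ?thesis by (simp add: lattice_index_def)
      qed
      have "int (lattice_index ?E' L) = c * int (lattice_index ?E ?L0)"
        using lattice_index_mult[OF snoc.prems(2) sV sE(2) LV VE'] V1 V2 c0 by simp
      also have "int (lattice_index ?E ?L0) = \<bar>\<Prod>j<?n. H j j\<bar>"
        using IH(5) nz by (auto simp: H'_def less_Suc_eq)
      also have "(\<Prod>j<?n. H j j) = (\<Prod>j<?n. H' j j)" by (intro prod.cong) (auto simp: H'_def)
      also have "c * \<bar>\<Prod>j<?n. H' j j\<bar> = \<bar>\<Prod>j<length (es @ [e]). H' j j\<bar>"
        using c0 by (simp add: H'_def abs_mult mult.commute)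
      finally show ?thesis .
    qed
    obtain bs' where bs': "frag.independent_list bs'" "range (frag.comb bs') = L" using 7 by blast
    show ?case
      by (intro exI[of _ "hs @ [h]"] exI[of _ H'] exI[of _ bs'] conjI allI impI)
         (fact 1 | rule 2, assumption | rule 3[rule_format], assumption
           | fact 5 | rule 6, blast | fact bs')+
  qed
  then obtain hs H bs where *: "length hs = length es" "\<forall>j<length es. hs ! j = frag.comb es (\<lambda>i. H i j)"
      "\<forall>i j. j < i \<longrightarrow> H i j = 0" "range (frag.comb hs) = L"
      "(\<forall>j<length es. H j j \<noteq> 0) \<longrightarrow> int (lattice_index (range (frag.comb es)) L) = \<bar>\<Prod>j<length es. H j j\<bar>"
      "frag.independent_list bs" "range (frag.comb bs) = L"
    by blast
  show ?thesis by (rule that[of hs H bs]) (use * in blast)+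
qed

lemma lattice_basis_frag_of:
  fixes cs :: "'c list"
  assumes "distinct cs"
  shows "lattice_basis {x. Poly_Mapping.keys x \<subseteq> set cs} (map frag_of cs)"
proof -
  let ?es = "map frag_of cs"
  have comb: "frag.comb ?es c = (\<Sum>i<length cs. frag_cmul (c i) (frag_of (cs ! i)))" for c
    by (simp add: frag.comb_def)
  have lk: "Poly_Mapping.lookup (frag.comb ?es c) (cs ! j) = c j" if "j < length cs" for c j
  proof -
    have "Poly_Mapping.lookup (frag.comb ?es c) (cs ! j) = (\<Sum>i<length cs. c i * (if i = j then 1 else 0))"
      unfolding comb lookup_sum using that assms
      by (intro sum.cong refl) (auto simp: lookup_single when_def nth_eq_iff_index_eq)
    then show ?thesis using that by (simp add: if_distrib cong: if_cong)
  qed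
  have lk0: "Poly_Mapping.lookup (frag.comb ?es c) a = 0" if "a \<notin> set cs" for c a
    unfolding comb lookup_sum using that by (intro sum.neutral ballI) (auto simp: lookup_single when_def)
  have "frag.independent_list ?es"
    unfolding frag.independent_list_def using lk by (metis length_map lookup_zero)
  moreover have "range (frag.comb ?es) = {x. Poly_Mapping.keys x \<subseteq> set cs}"
  proof
    show "range (frag.comb ?es) \<subseteq> {x. Poly_Mapping.keys x \<subseteq> set cs}"
      using lk0 by (auto simp: in_keys_iff)
    show "{x. Poly_Mapping.keys x \<subseteq> set cs} \<subseteq> range (frag.comb ?es)"
    proof
      fix x :: "'c zchain" assume x: "x \<in> {x. Poly_Mapping.keys x \<subseteq> set cs}"
      have "x = frag.comb ?es (\<lambda>i. Poly_Mapping.lookup x (cs ! i))"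
      proof (rule poly_mapping_eqI)
        fix a show "Poly_Mapping.lookup x a = Poly_Mapping.lookup (frag.comb ?es (\<lambda>i. Poly_Mapping.lookup x (cs ! i))) a"
        proof (cases "a \<in> set cs")
          case True
          then obtain j where "j < length cs" "a = cs ! j" by (metis in_set_conv_nth)
          then show ?thesis using lk by simp
        next
          case False
          then have "Poly_Mapping.lookup x a = 0" using x by (auto simp: in_keys_iff)
          then show ?thesis using lk0[OF False] by simp
        qed
      qed
      then show "x \<in> range (frag.comb ?es)" by blast
    qed
  qed
  ultimately show ?thesis by (simp add: lattice_basis_iff)
qed

theorem lattice_basis_exists:
  assumes "finite K" "frag.subspace L" "L \<subseteq> {x. Poly_Mapping.keys x \<subseteq> K}"
  shows "\<exists>es. lattice_basis L es"
proof -
  obtain cs where cs: "set cs = K" "distinct cs" using finite_distinct_list[OF assms(1)] by blast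
  have ind: "frag.independent_list (map frag_of cs)" and "L \<subseteq> range (frag.comb (map frag_of cs))"
    using lattice_basis_frag_of[OF cs(2)] assms(3) by (simp_all add: lattice_basis_iff cs(1))
  then obtain bs where "frag.independent_list bs" "range (frag.comb bs) = L"
    using triangular_generators[OF ind assms(2)] by blast
  then show ?thesis using lattice_basis_iff by blast
qed

text \<open>
  The coordinate matrix of \<open>us\<close> and the triangular one of \<open>triangular_generators\<close> are integral multiples of each other, so
  their determinants agree up to sign. For the triangular matrix the determinant is the product of the diagonal.
\<close>

theorem lattice_index_det:
  assumes es: "frag.independent_list es" and len: "length us = length es"
    and us: "\<And>j. j < length es \<Longrightarrow> us ! j = frag.comb es (\<lambda>i. N i j)"
    and nz: "Determinant.det (mat (length es) (length es) (\<lambda>(i, j). N i j)) \<noteq> 0"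
  shows "int (lattice_index (range (frag.comb es)) (range (frag.comb us))) =
    \<bar>Determinant.det (mat (length es) (length es) (\<lambda>(i, j). N i j))\<bar>"
proof -
  let ?n = "length es"
  let ?L = "range (frag.comb us)"
  have sub: "frag.subspace ?L" by (rule subspace_range_comb)
  have Lsub: "?L \<subseteq> range (frag.comb es)"
  proof
    fix x assume "x \<in> ?L"
    then obtain c where "x = frag.comb us c" by blast
    then have "x = frag.comb es (\<lambda>i. \<Sum>j<length us. N i j * c j)"
      using frag.comb_comb[of us es N c] us len by simp
    then show "x \<in> range (frag.comb es)" by blast
  qed
  obtain hs H where hs: "length hs = ?n" "\<And>j. j < ?n \<Longrightarrow> hs ! j = frag.comb es (\<lambda>i. H i j)"
    "\<And>i j. j < i \<Longrightarrow> H i j = 0" "range (frag.comb hs) = ?L"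
    "(\<forall>j<?n. H j j \<noteq> 0) \<longrightarrow> int (lattice_index (range (frag.comb es)) ?L) = \<bar>\<Prod>j<?n. H j j\<bar>"
    by (rule triangular_generators[OF es sub Lsub], rule that) (blast | simp)+
  let ?m = "\<lambda>F :: nat \<Rightarrow> nat \<Rightarrow> int. mat ?n ?n (\<lambda>(i, j). F i j)"
  \<comment> \<open>Generators of one group in terms of the generators \<open>vs\<close> of the same group: the coordinate matrices differ by an integral factor.\<close>
  have transition: "\<exists>Y. ?m B = ?m A * ?m Y"
    if vs: "length vs = ?n" "\<And>j. j < ?n \<Longrightarrow> vs ! j = frag.comb es (\<lambda>i. A i j)"
      and ws: "length ws = ?n" "\<And>j. j < ?n \<Longrightarrow> ws ! j = frag.comb es (\<lambda>i. B i j)"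
      and eq: "range (frag.comb vs) = range (frag.comb ws)" for vs ws A B
  proof -
    have "\<exists>c. ws ! j = frag.comb vs c" if "j < ?n" for j
    proof -
      have "ws ! j \<in> range (frag.comb ws)"
        using frag.comb_unit[of j ws] that ws(1) rangeI[of "frag.comb ws" "\<lambda>i. if i = j then 1 else 0"] by simp
      then show ?thesis unfolding eq[symmetric] by blast
    qed
    then obtain C where C: "ws ! j = frag.comb vs (C j)" if "j < ?n" for j by metis
    have "B i j = (\<Sum>k<?n. A i k * C j k)" if "i < ?n" "j < ?n" for i j
    proof (rule frag.independent_list_unique[OF es _ that(1)])
      have "frag.comb es (\<lambda>i. B i j) = frag.comb vs (C j)" using C[OF that(2)] ws(2)[OF that(2)] by simp
      also have "\<dots> = frag.comb es (\<lambda>i. \<Sum>k<?n. A i k * C j k)"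
        using frag.comb_comb[of vs es A "C j"] vs by simp
      finally show "frag.comb es (\<lambda>i. B i j) = frag.comb es (\<lambda>i. \<Sum>k<?n. A i k * C j k)" .
    qed
    then have "?m B = ?m A * ?m (\<lambda>k j. C j k)"
      by (intro eq_matI) (auto simp: scalar_prod_def lessThan_atLeast0)
    then show ?thesis by blast
  qed
  obtain Y where Y: "?m N = ?m H * ?m Y"
    using transition[of hs H us N, OF hs(1) hs(2) _ us hs(4)] len by auto
  obtain Z where Z: "?m H = ?m N * ?m Z"
    using transition[of us N hs H, OF _ us hs(1) hs(2) hs(4)[symmetric]] len by auto
  let ?d = "\<lambda>F. Determinant.det (?m F)"
  have dN: "?d N = ?d H * ?d Y" unfolding Y by (rule det_mult) auto
  have dH: "?d H = ?d N * ?d Z" unfolding Z by (rule det_mult) auto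
  have "?d N dvd ?d H" "?d H dvd ?d N" using dN dH by (metis dvd_triv_left)+
  then have abs: "\<bar>?d N\<bar> = \<bar>?d H\<bar>" by (metis abs_dvd_iff dvd_abs_iff zdvd_antisym_abs abs_abs)
  have tri: "?d H = (\<Prod>j<?n. H j j)"
  proof -
    have "?d H = prod_list (diag_mat (?m H))"
      using hs(3) by (intro det_upper_triangular[of _ ?n]) (auto simp: upper_triangular_def)
    then show ?thesis by (simp add: prod_list_diag_prod lessThan_atLeast0)
  qed
  have "\<bar>?d H\<bar> \<noteq> 0" unfolding abs[symmetric] abs_eq_0_iff by (rule nz)
  then have "(\<Prod>j<?n. H j j) \<noteq> 0" unfolding tri abs_eq_0_iff .
  then have "\<forall>j<?n. H j j \<noteq> 0" by simp
  then show ?thesis using hs(5) abs tri by simp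
qed

section \<open>Integral chains among real chains\<close>

interpretation rv: module_lists "scaleR :: real \<Rightarrow> 'b::real_vector \<Rightarrow> 'b"
  by unfold_locales (simp_all add: scaleR_add_right scaleR_add_left)

lemma span_list_real: "span (set xs) = range (rv.comb xs)"
  unfolding span_raw_def by (rule rv.span_list)

lemma independent_list_real_iff: "rv.independent_list xs \<longleftrightarrow> distinct xs \<and> independent (set xs)"
  unfolding dependent_raw_def by (rule rv.independent_list_iff)

lemma lookup_scaleR [simp]: "Poly_Mapping.lookup (r *\<^sub>R x) c = r * Poly_Mapping.lookup x c"
  for x :: "'c rchain"
proof -
  have "finite {i. r * Poly_Mapping.lookup x i \<noteq> 0}"
    by (rule finite_subset[OF _ finite_keys[of x]]) (auto simp: in_keys_iff)
  then show ?thesis by (simp add: scaleR_poly_mapping_def lookup_Abs_poly_mapping)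
qed

lemma lookup_real_chain [simp]: "Poly_Mapping.lookup (real_chain x) c = real_of_int (Poly_Mapping.lookup x c)"
  by (simp add: real_chain_def map.rep_eq when_def)

lemma keys_real_chain [simp]: "Poly_Mapping.keys (real_chain x) = Poly_Mapping.keys x"
  by (auto simp: in_keys_iff)

lemma real_chain_add: "real_chain (x + y) = real_chain x + real_chain y"
  and real_chain_scale: "real_chain (frag_cmul n x) = real_of_int n *\<^sub>R real_chain x"
  and real_chain_0 [simp]: "real_chain 0 = 0"
  by (rule poly_mapping_eqI, simp add: lookup_add)+

lemma real_chain_sum: "real_chain (sum f A) = (\<Sum>a\<in>A. real_chain (f a))"
  by (induction A rule: infinite_finite_induct) (simp_all add: real_chain_add)

lemma real_chain_inj: "real_chain x = real_chain y \<longleftrightarrow> x = y"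
  by (metis lookup_real_chain of_int_eq_iff poly_mapping_eqI)

lemma real_chain_comb: "real_chain (frag.comb es c) = rv.comb (map real_chain es) (\<lambda>i. real_of_int (c i))"
  by (simp add: frag.comb_def rv.comb_def real_chain_sum real_chain_scale)

section \<open>Gram determinants\<close>

lemma chain_inner_sum:
  assumes "finite S" "Poly_Mapping.keys x \<subseteq> S"
  shows "chain_inner x y = (\<Sum>c\<in>S. Poly_Mapping.lookup x c * Poly_Mapping.lookup y c)"
  unfolding chain_inner_def using assms by (intro sum.mono_neutral_left) (auto simp: in_keys_iff)

lemma chain_inner_commute: "chain_inner x y = chain_inner y x"
  using chain_inner_sum[of "Poly_Mapping.keys x \<union> Poly_Mapping.keys y" x y]
    chain_inner_sum[of "Poly_Mapping.keys x \<union> Poly_Mapping.keys y" y x] by (simp add: mult.commute)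

lemma chain_inner_add_right: "chain_inner x (y + z) = chain_inner x y + chain_inner x z"
  by (simp add: chain_inner_def lookup_add distrib_left sum.distrib)

lemma chain_inner_scale_right: "chain_inner x (r *\<^sub>R y) = r * chain_inner x y"
  by (simp add: chain_inner_def sum_distrib_left mult.left_commute)

lemma chain_inner_0_right [simp]: "chain_inner x 0 = 0"
  by (simp add: chain_inner_def)

lemma linear_chain_inner: "linear (chain_inner x)"
  by (rule linearI) (simp_all add: chain_inner_add_right chain_inner_scale_right)

lemma chain_inner_diff_left: "chain_inner (x - y) z = chain_inner x z - chain_inner y z"
  by (metis chain_inner_commute linear_chain_inner linear_diff)

lemma chain_inner_comb_right: "chain_inner x (rv.comb ys c) = (\<Sum>i<length ys. c i * chain_inner x (ys ! i))"
  unfolding rv.comb_def linear_sum[OF linear_chain_inner] by (simp add: chain_inner_scale_right)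

lemma chain_inner_comb_left: "chain_inner (rv.comb ys c) x = (\<Sum>i<length ys. c i * chain_inner (ys ! i) x)"
  using chain_inner_comb_right[of x ys c] by (simp add: chain_inner_commute)

lemma chain_inner_self_eq_0: "chain_inner x x = 0 \<longleftrightarrow> x = 0"
proof
  assume "chain_inner x x = 0"
  then have "\<forall>c\<in>Poly_Mapping.keys x. Poly_Mapping.lookup x c * Poly_Mapping.lookup x c = 0"
    unfolding chain_inner_def by (subst (asm) sum_nonneg_eq_0_iff) auto
  then show "x = 0" by (auto simp: poly_mapping_eq_iff fun_eq_iff in_keys_iff)
qed simp

definition gram :: "'c rchain list \<Rightarrow> 'c rchain list \<Rightarrow> real mat" where
  "gram xs ys = mat (length xs) (length ys) (\<lambda>(i, j). chain_inner (xs ! i) (ys ! j))"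

lemma gram_carrier [simp]: "gram xs ys \<in> carrier_mat (length xs) (length ys)"
  by (simp add: gram_def)

lemma gram_mult_vec:
  assumes "i < length xs"
  shows "(gram xs ys *\<^sub>v vec (length ys) c) $ i = chain_inner (xs ! i) (rv.comb ys c)"
  using assms by (simp add: gram_def chain_inner_comb_right scalar_prod_def mult.commute lessThan_atLeast0)

text \<open>
  A vector in the kernel of the Gram matrix gives a combination of the list that is orthogonal to all entries, hence to
  itself.
\<close>

theorem gram_det_nonzero_iff: "Determinant.det (gram xs xs) \<noteq> 0 \<longleftrightarrow> rv.independent_list xs"
proof -
  let ?n = "length xs"
  have "Determinant.det (gram xs xs) = 0 \<longleftrightarrow> (\<exists>v. v \<in> carrier_vec ?n \<and> v \<noteq> 0\<^sub>v ?n \<and> gram xs xs *\<^sub>v v = 0\<^sub>v ?n)"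
    by (rule det_0_iff_vec_prod_zero_field) simp
  also have "\<dots> \<longleftrightarrow> (\<exists>c. rv.comb xs c = 0 \<and> (\<exists>i<?n. c i \<noteq> 0))"
  proof
    assume "\<exists>v. v \<in> carrier_vec ?n \<and> v \<noteq> 0\<^sub>v ?n \<and> gram xs xs *\<^sub>v v = 0\<^sub>v ?n"
    then obtain v where v: "v \<in> carrier_vec ?n" "v \<noteq> 0\<^sub>v ?n" "gram xs xs *\<^sub>v v = 0\<^sub>v ?n" by blast
    have v_eq: "v = vec ?n (($) v)" using v(1) by auto
    let ?x = "rv.comb xs (($) v)"
    have "chain_inner (xs ! i) ?x = 0" if "i < ?n" for i
      using gram_mult_vec[OF that, of xs "($) v"] v(3) that unfolding v_eq[symmetric] by simp
    then have "chain_inner ?x ?x = 0" unfolding chain_inner_comb_left[of xs "($) v" ?x] by simp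
    then have "?x = 0" by (simp add: chain_inner_self_eq_0)
    moreover have "\<exists>i<?n. v $ i \<noteq> 0" using v(1,2) by (metis carrier_vecD eq_vecI index_zero_vec)
    ultimately show "\<exists>c. rv.comb xs c = 0 \<and> (\<exists>i<?n. c i \<noteq> 0)" by blast
  next
    assume "\<exists>c. rv.comb xs c = 0 \<and> (\<exists>i<?n. c i \<noteq> 0)"
    then obtain c i where c: "rv.comb xs c = 0" "i < ?n" "c i \<noteq> 0" by blast
    have "gram xs xs *\<^sub>v vec ?n c = 0\<^sub>v ?n"
      by (rule eq_vecI) (use gram_mult_vec[of _ xs xs c] c(1) in \<open>auto simp: gram_def\<close>)
    moreover have "vec ?n c \<noteq> 0\<^sub>v ?n" using c(2,3) by (metis index_vec index_zero_vec(1))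
    ultimately show "\<exists>v. v \<in> carrier_vec ?n \<and> v \<noteq> 0\<^sub>v ?n \<and> gram xs xs *\<^sub>v v = 0\<^sub>v ?n"
      by (intro exI[of _ "vec ?n c"]) simp
  qed
  finally show ?thesis unfolding rv.independent_list_def by blast
qed

text \<open>
  Independence over the integers is preserved by extension of scalars because the Gram matrix is integral: if it is
  singular, then its kernel contains a nonzero integral vector.
\<close>

theorem real_independent_iff: "rv.independent_list (map real_chain zs) \<longleftrightarrow> frag.independent_list zs"
proof
  assume r: "rv.independent_list (map real_chain zs)"
  show "frag.independent_list zs"
    unfolding frag.independent_list_def
  proof (intro allI impI)
    fix c i assume "frag.comb zs c = 0" "i < length zs"
    then show "c i = 0"
      using r real_chain_comb[of zs c] unfolding rv.independent_list_def by force
  qed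
next
  assume z: "frag.independent_list zs"
  let ?n = "length zs" and ?xs = "map real_chain zs"
  let ?K = "\<Union>(Poly_Mapping.keys ` set zs)"
  define G where "G = mat ?n ?n (\<lambda>(i, j). \<Sum>c\<in>?K. Poly_Mapping.lookup (zs ! i) c * Poly_Mapping.lookup (zs ! j) c)"
  have G: "G \<in> carrier_mat ?n ?n" by (simp add: G_def)
  have "gram ?xs ?xs = map_mat real_of_int G"
  proof (rule eq_matI)
    fix i j assume "i < dim_row (map_mat real_of_int G)" "j < dim_col (map_mat real_of_int G)"
    then have ij: "i < ?n" "j < ?n" by (auto simp: G_def)
    have "chain_inner (real_chain (zs ! i)) (real_chain (zs ! j))
        = (\<Sum>c\<in>?K. real_of_int (Poly_Mapping.lookup (zs ! i) c * Poly_Mapping.lookup (zs ! j) c))"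
      using ij by (subst chain_inner_sum[of ?K]) (auto intro!: UN_I[of "zs ! i"])
    then show "gram ?xs ?xs $$ (i, j) = map_mat real_of_int G $$ (i, j)"
      using ij by (simp add: gram_def G_def)
  qed (auto simp: gram_def G_def)
  then have det: "Determinant.det (gram ?xs ?xs) = real_of_int (Determinant.det G)"
    by (simp add: of_int_hom.hom_det)
  show "rv.independent_list ?xs"
  proof (rule ccontr)
    assume "\<not> rv.independent_list ?xs"
    then have "Determinant.det G = 0" using det gram_det_nonzero_iff[of ?xs] by simp
    then obtain v where v: "v \<in> carrier_vec ?n" "v \<noteq> 0\<^sub>v ?n" "G *\<^sub>v v = 0\<^sub>v ?n"
      using det_0_iff_vec_prod_zero[OF G] by blast
    let ?c = "\<lambda>i. real_of_int (v $ i)"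
    let ?x = "rv.comb ?xs ?c"
    have "chain_inner (?xs ! i) ?x = 0" if i: "i < ?n" for i
    proof -
      have "chain_inner (?xs ! i) ?x = (gram ?xs ?xs *\<^sub>v vec (length ?xs) ?c) $ i"
        using gram_mult_vec[of i ?xs ?xs ?c] i by simp
      also have "\<dots> = real_of_int ((G *\<^sub>v v) $ i)"
        using i v(1) G unfolding \<open>gram ?xs ?xs = map_mat real_of_int G\<close>
        by (auto simp: scalar_prod_def intro!: sum.cong)
      finally show ?thesis using v(3) i by simp
    qed
    then have "chain_inner ?x ?x = 0" unfolding chain_inner_comb_left[of ?xs ?c ?x] by simp
    then have "real_chain (frag.comb zs (($) v)) = real_chain 0"
      by (simp add: chain_inner_self_eq_0 real_chain_comb)
    then have "frag.comb zs (($) v) = 0" by (simp only: real_chain_inj)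
    then have "\<forall>i<?n. v $ i = 0" using z unfolding frag.independent_list_def by blast
    then show False using v(1,2) by (metis carrier_vecD eq_vecI index_zero_vec)
  qed
qed

lemma gram_comb:
  assumes len: "length us = length es" and us: "\<And>j. j < length es \<Longrightarrow> us ! j = rv.comb es (\<lambda>i. N i j)"
  defines "M \<equiv> mat (length es) (length es) (\<lambda>(i, j). N i j)"
  shows "gram es us = gram es es * M" and "gram us us = transpose_mat M * gram es us"
    and "Determinant.det (gram us us) = (Determinant.det M)\<^sup>2 * Determinant.det (gram es es)"
proof -
  let ?n = "length es"
  have M: "M \<in> carrier_mat ?n ?n" by (simp add: M_def)
  show 1: "gram es us = gram es es * M"
    by (rule eq_matI)
       (auto simp: gram_def M_def len us chain_inner_comb_right scalar_prod_def mult.commute lessThan_atLeast0)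
  show 2: "gram us us = transpose_mat M * gram es us"
  proof (rule eq_matI)
    fix i j assume "i < dim_row (transpose_mat M * gram es us)" "j < dim_col (transpose_mat M * gram es us)"
    then have ij: "i < ?n" "j < ?n" by (auto simp: M_def gram_def len)
    have "chain_inner (us ! i) (us ! j) = (\<Sum>k<?n. N k i * chain_inner (es ! k) (us ! j))"
      unfolding us[OF ij(1)] by (rule chain_inner_comb_left)
    then show "gram us us $$ (i, j) = (transpose_mat M * gram es us) $$ (i, j)"
      using ij by (simp add: gram_def M_def len scalar_prod_def lessThan_atLeast0)
  qed (auto simp: gram_def M_def len)
  have "Determinant.det (gram us us) = Determinant.det (transpose_mat M) * Determinant.det (gram es us)"
    unfolding 2 using len M gram_carrier[of es us] by (intro det_mult[of _ ?n]) auto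
  also have "Determinant.det (gram es us) = Determinant.det (gram es es) * Determinant.det M"
    unfolding 1 using M by (intro det_mult[of _ ?n]) auto
  finally show "Determinant.det (gram us us) = (Determinant.det M)\<^sup>2 * Determinant.det (gram es es)"
    using det_transpose[OF M] by (simp add: power2_eq_square)
qed

text \<open>
  The Gram determinant changes by the square of the determinant of the coordinate matrix, whose absolute value is an
  index by \<open>lattice_index_det\<close>.
\<close>

theorem gram_lattice_index:
  assumes es: "lattice_basis A es" and len: "length us = length es" and us: "set us \<subseteq> A"
    and ind: "frag.independent_list us"
  shows "Determinant.det (gram (map real_chain us) (map real_chain us)) =
    (real (lattice_index A (range (frag.comb us))))\<^sup>2 * Determinant.det (gram (map real_chain es) (map real_chain es))"
proof -
  let ?n = "length es"
  have A: "range (frag.comb es) = A" and ies: "frag.independent_list es"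
    using es by (auto simp: lattice_basis_iff)
  have "\<exists>c. us ! j = frag.comb es c" if "j < ?n" for j
    using us A that len by (metis nth_mem rangeE subsetD)
  then obtain C where C: "\<And>j. j < ?n \<Longrightarrow> us ! j = frag.comb es (C j)" by metis
  define N where "N i j = C j i" for i j
  have N: "us ! j = frag.comb es (\<lambda>i. N i j)" if "j < ?n" for j using C[OF that] by (simp add: N_def)
  let ?M = "mat ?n ?n (\<lambda>(i, j). N i j)"
  let ?R = "mat ?n ?n (\<lambda>(i, j). real_of_int (N i j))"
  have "?R = map_mat real_of_int ?M" by (rule eq_matI) auto
  then have det: "Determinant.det ?R = real_of_int (Determinant.det ?M)"
    by (simp add: of_int_hom.hom_det)
  have gr: "Determinant.det (gram (map real_chain us) (map real_chain us)) =
    (real_of_int (Determinant.det ?M))\<^sup>2 * Determinant.det (gram (map real_chain es) (map real_chain es))"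
    using gram_comb(3)[of "map real_chain us" "map real_chain es" "\<lambda>i j. real_of_int (N i j)"] len N det
    by (simp add: real_chain_comb)
  have "Determinant.det (gram (map real_chain us) (map real_chain us)) \<noteq> 0"
    using gram_det_nonzero_iff real_independent_iff ind by blast
  then have "Determinant.det ?M \<noteq> 0" using gr by auto
  then have "int (lattice_index A (range (frag.comb us))) = \<bar>Determinant.det ?M\<bar>"
    using lattice_index_det[OF ies len N] unfolding A by blast
  then have "real_of_int (int (lattice_index A (range (frag.comb us)))) = real_of_int \<bar>Determinant.det ?M\<bar>"
    by (rule arg_cong)
  then have "real (lattice_index A (range (frag.comb us))) = \<bar>real_of_int (Determinant.det ?M)\<bar>"
    by simp
  then show ?thesis unfolding gr by simp
qed

section \<open>Orthogonal projection and determinants of operators\<close>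

lemma orthogonal_projection_eqI:
  assumes "subspace V" "y \<in> V" "\<And>v. v \<in> V \<Longrightarrow> chain_inner (x - y) v = 0"
  shows "orthogonal_projection V x = y"
  unfolding orthogonal_projection_def
proof (rule the_equality)
  fix z assume z: "z \<in> V \<and> (\<forall>v\<in>V. chain_inner (x - z) v = 0)"
  have d: "y - z \<in> V" using assms z by (intro subspace_diff) auto
  have "chain_inner (x - z) (y - z) - chain_inner (x - y) (y - z) = chain_inner (y - z) (y - z)"
    unfolding chain_inner_diff_left[symmetric] by simp
  then have "chain_inner (y - z) (y - z) = 0" using z assms(3)[OF d] d by simp
  then show "z = y" by (simp add: chain_inner_self_eq_0)
qed (use assms in auto)

text \<open>
  Invertibility of the Gram matrix provides the coordinates of the projection.
\<close>

theorem orthogonal_projection: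
  assumes "rv.independent_list bs"
  shows "orthogonal_projection (span (set bs)) x \<in> span (set bs)"
    and "v \<in> span (set bs) \<Longrightarrow> chain_inner v (orthogonal_projection (span (set bs)) x) = chain_inner v x"
proof -
  let ?n = "length bs" and ?V = "span (set bs)"
  have G: "gram bs bs \<in> carrier_mat ?n ?n" by simp
  obtain B where B: "B \<in> carrier_mat ?n ?n" "gram bs bs * B = 1\<^sub>m ?n"
    using det_non_zero_imp_unit[OF G] gram_det_nonzero_iff[of bs] assms
    unfolding Units_def ring_mat_def by auto
  let ?b = "vec ?n (\<lambda>i. chain_inner (bs ! i) x)"
  define c where "c = B *\<^sub>v ?b"
  have c: "c \<in> carrier_vec ?n" using B by (auto simp: c_def)
  have c_eq: "c = vec ?n (($) c)" using c by auto
  have "gram bs bs *\<^sub>v c = (gram bs bs * B) *\<^sub>v ?b"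
    unfolding c_def by (rule assoc_mult_mat_vec[OF G B(1), symmetric]) simp
  also have "\<dots> = ?b" unfolding B(2) by simp
  finally have Gc: "gram bs bs *\<^sub>v c = ?b" .
  let ?y = "rv.comb bs (($) c)"
  have bi: "chain_inner (bs ! i) ?y = chain_inner (bs ! i) x" if "i < ?n" for i
    using gram_mult_vec[OF that, of bs "($) c"] Gc that unfolding c_eq[symmetric] by simp
  have inner: "chain_inner v ?y = chain_inner v x" if v: "v \<in> ?V" for v
  proof -
    obtain e where "v = rv.comb bs e" using v unfolding span_list_real by blast
    then show ?thesis using bi by (simp add: chain_inner_comb_left)
  qed
  have y: "?y \<in> ?V" unfolding span_list_real by blast
  have "chain_inner (x - ?y) v = 0" if "v \<in> ?V" for v
    using inner[OF that] chain_inner_diff_left[of x ?y v] by (simp add: chain_inner_commute[of _ v])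
  then have eq: "orthogonal_projection ?V x = ?y"
    by (intro orthogonal_projection_eqI[OF subspace_span y])
  show "orthogonal_projection ?V x \<in> ?V" unfolding eq by (rule y)
  show "v \<in> ?V \<Longrightarrow> chain_inner v (orthogonal_projection ?V x) = chain_inner v x" unfolding eq by (rule inner)
qed

text \<open>
  The determinant is computed in a basis about which nothing else is known. Pairing with that basis replaces the
  representing matrix by inner products, at the cost of a factor that is the Gram determinant of this basis.
\<close>

theorem operator_det_gram:
  assumes bs0: "rv.independent_list as" "span (set as) = V" and L: "\<And>v. v \<in> V \<Longrightarrow> L v \<in> V"
  obtains bs where "rv.independent_list bs" "span (set bs) = V" "length bs = length as"
    "operator_det V L * Determinant.det (gram bs bs) = Determinant.det (gram bs (map L bs))"
proof -
  let ?P = "\<lambda>bs. distinct bs \<and> independent (set bs) \<and> span (set bs) = V"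
  define bs where "bs = (SOME bs. ?P bs)"
  have "?P bs" unfolding bs_def
    by (rule someI[of ?P as]) (use bs0 in \<open>simp add: independent_list_real_iff\<close>)
  then have bs: "distinct bs" "independent (set bs)" "span (set bs) = V" by auto
  have ind: "rv.independent_list bs" using bs by (simp add: independent_list_real_iff)
  have "independent (set as)" "distinct as" using bs0 by (simp_all add: independent_list_real_iff)
  then have len: "length bs = length as"
    using bs bs0(2) by (metis dim_eq_card distinct_card)
  let ?n = "length bs"
  define R where "R i j = representation (set bs) (L (bs ! j)) (bs ! i)" for i j
  have det: "operator_det V L = Determinant.det (mat ?n ?n (\<lambda>(i, j). R i j))"
    unfolding operator_det_def bs_def[symmetric] Let_def R_def ..
  have comb: "map L bs ! j = rv.comb bs (\<lambda>i. R i j)" if j: "j < ?n" for j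
  proof -
    have "bs ! j \<in> V" using j bs(3) span_base nth_mem by metis
    then have "L (bs ! j) \<in> span (set bs)" using L bs(3) by simp
    then have "(\<Sum>b\<in>set bs. representation (set bs) (L (bs ! j)) b *\<^sub>R b) = L (bs ! j)"
      by (intro real_vector.sum_representation_eq bs(2)) auto
    moreover have "(\<Sum>b\<in>set bs. representation (set bs) (L (bs ! j)) b *\<^sub>R b) = rv.comb bs (\<lambda>i. R i j)"
      unfolding rv.comb_def R_def using bij_betw_nth[OF bs(1) refl refl]
      by (subst sum.reindex_bij_betw[symmetric]) auto
    ultimately show ?thesis using j by simp
  qed
  have "gram bs (map L bs) = gram bs bs * mat ?n ?n (\<lambda>(i, j). R i j)"
    by (rule gram_comb(1)) (use comb in auto)
  then have "Determinant.det (gram bs (map L bs)) = Determinant.det (gram bs bs) * operator_det V L"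
    unfolding det by (simp add: det_mult[of _ ?n])
  then show ?thesis using that[of bs] ind bs(3) len by simp
qed

section \<open>Quotients of groups of integral chains\<close>

lemma chain_subgroup_simps [simp]:
  "carrier (chain_subgroup A) = A" "monoid.mult (chain_subgroup A) = (+)" "monoid.one (chain_subgroup A) = 0"
  by (simp_all add: chain_subgroup_def free_Abelian_group_def)

lemma comm_group_chain_subgroup:
  assumes "frag.subspace A" shows "comm_group (chain_subgroup A)"
proof (rule comm_groupI)
  fix x assume "x \<in> carrier (chain_subgroup A)"
  then have "- x \<in> A" using frag.subspace_neg[OF assms] by simp
  then show "\<exists>y\<in>carrier (chain_subgroup A). y \<otimes>\<^bsub>chain_subgroup A\<^esub> x = \<one>\<^bsub>chain_subgroup A\<^esub>"
    by (intro bexI[of _ "- x"]) auto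
qed (auto simp: frag.subspace_add[OF assms] frag.subspace_0[OF assms] ac_simps)

lemma subgroup_chain_subgroup:
  assumes "frag.subspace A" "frag.subspace U" "U \<subseteq> A"
  shows "subgroup U (chain_subgroup A)"
proof -
  interpret comm_group "chain_subgroup A" by (rule comm_group_chain_subgroup[OF assms(1)])
  show ?thesis
  proof (rule subgroupI)
    fix x assume x: "x \<in> U"
    then have "inv\<^bsub>chain_subgroup A\<^esub> x = - x"
      using assms by (intro inv_equality) (auto simp: frag.subspace_neg)
    then show "inv\<^bsub>chain_subgroup A\<^esub> x \<in> U" using x frag.subspace_neg[OF assms(2)] by simp
  qed (use assms frag.subspace_0 in \<open>auto intro: frag.subspace_add\<close>)
qed

lemma int_pow_chain_subgroup:
  assumes "frag.subspace A" "x \<in> A"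
  shows "x [^]\<^bsub>chain_subgroup A\<^esub> (n::nat) = frag_cmul (int n) x"
    and "x [^]\<^bsub>chain_subgroup A\<^esub> (m::int) = frag_cmul m x"
proof -
  interpret comm_group "chain_subgroup A" by (rule comm_group_chain_subgroup[OF assms(1)])
  show nat: "x [^]\<^bsub>chain_subgroup A\<^esub> (n::nat) = frag_cmul (int n) x" for n
    by (induction n) (simp_all add: frag.scale_left_distrib add.commute)
  have inv: "inv\<^bsub>chain_subgroup A\<^esub> y = - y" if "y \<in> A" for y
    using assms that by (intro inv_equality) (auto simp: frag.subspace_neg)
  have x: "x \<in> carrier (chain_subgroup A)" using assms by simp
  show "x [^]\<^bsub>chain_subgroup A\<^esub> (m::int) = frag_cmul m x"
  proof (cases m)
    case (nonneg n)
    show ?thesis unfolding nonneg int_pow_int nat by (rule refl)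
  next
    case (neg n)
    have "frag_cmul (int (Suc n)) x \<in> A" by (rule frag.subspace_scale[OF assms])
    from inv[OF this] show ?thesis
      unfolding neg int_pow_neg[OF x] int_pow_int nat by (simp only: frag.scale_minus_left)
  qed
qed

lemma finprod_chain_subgroup:
  assumes "frag.subspace A" "\<And>i. i \<in> I \<Longrightarrow> f i \<in> A"
  shows "finprod (chain_subgroup A) f I = sum f I"
proof -
  interpret comm_group "chain_subgroup A" by (rule comm_group_chain_subgroup[OF assms(1)])
  show ?thesis using assms(2) by (induction I rule: infinite_finite_induct) (auto simp: Pi_iff)
qed

lemma quotient_group:
  assumes "frag.subspace A" "frag.subspace U" "U \<subseteq> A"
  shows "comm_group (chain_subgroup A Mod U)"
    and "coset U \<in> hom (chain_subgroup A) (chain_subgroup A Mod U)"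
    and "carrier (chain_subgroup A Mod U) = coset U ` A"
    and "\<one>\<^bsub>chain_subgroup A Mod U\<^esub> = coset U 0"
proof -
  interpret comm_group "chain_subgroup A" by (rule comm_group_chain_subgroup[OF assms(1)])
  have sg: "subgroup U (chain_subgroup A)" by (rule subgroup_chain_subgroup[OF assms])
  interpret N: normal U "chain_subgroup A" by (rule subgroup_imp_normal[OF sg])
  show "comm_group (chain_subgroup A Mod U)" by (rule abelian_FactGroup[OF sg])
  have rc: "U #>\<^bsub>chain_subgroup A\<^esub> x = coset U x" for x
    by (auto simp: r_coset_def coset_def add.commute)
  show "coset U \<in> hom (chain_subgroup A) (chain_subgroup A Mod U)"
    using N.r_coset_hom_Mod unfolding rc .
  show "carrier (chain_subgroup A Mod U) = coset U ` A"
    by (auto simp: FactGroup_def RCOSETS_def rc)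
  show "\<one>\<^bsub>chain_subgroup A Mod U\<^esub> = coset U 0"
    by (auto simp: FactGroup_def coset_def)
qed

lemma quotient_pow:
  assumes "frag.subspace A" "frag.subspace U" "U \<subseteq> A" "x \<in> A"
  shows "coset U x [^]\<^bsub>chain_subgroup A Mod U\<^esub> (n::nat) = coset U (frag_cmul (int n) x)"
    and "coset U x [^]\<^bsub>chain_subgroup A Mod U\<^esub> (m::int) = coset U (frag_cmul m x)"
proof -
  note q = quotient_group[OF assms(1-3)]
  interpret Q: comm_group "chain_subgroup A Mod U" by (rule q(1))
  interpret G: comm_group "chain_subgroup A" by (rule comm_group_chain_subgroup[OF assms(1)])
  interpret h: group_hom "chain_subgroup A" "chain_subgroup A Mod U" "coset U"
    using q(2) by (simp add: group_hom_def group_hom_axioms_def G.is_group Q.is_group)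
  show "coset U x [^]\<^bsub>chain_subgroup A Mod U\<^esub> (n::nat) = coset U (frag_cmul (int n) x)"
    using h.hom_nat_pow[of x n] int_pow_chain_subgroup(1)[OF assms(1,4)] assms(4) by simp
  show "coset U x [^]\<^bsub>chain_subgroup A Mod U\<^esub> (m::int) = coset U (frag_cmul m x)"
    using h.hom_int_pow[of x m] int_pow_chain_subgroup(2)[OF assms(1,4)] assms(4) by simp
qed

lemma coset_0_iff: "frag.subspace U \<Longrightarrow> coset U x = coset U 0 \<longleftrightarrow> x \<in> U"
  using coset_eq_iff[of U x 0] by simp

lemma order_quotient:
  assumes "frag.subspace A" "frag.subspace U" "U \<subseteq> A"
  shows "Coset.order (chain_subgroup A Mod U) = lattice_index A U"
  unfolding Coset.order_def quotient_group(3)[OF assms] lattice_index_def ..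

text \<open>
  The elements of \<open>Z\<close> that represent torsion classes modulo \<open>U\<close>.
\<close>

definition saturation :: "'c zchain set \<Rightarrow> 'c zchain set \<Rightarrow> 'c zchain set" where
  "saturation Z U = {x \<in> Z. \<exists>n>0. frag_cmul n x \<in> U}"

lemma subspace_saturation:
  assumes "frag.subspace Z" "frag.subspace U"
  shows "frag.subspace (saturation Z U)"
  unfolding frag.subspace_def
proof (intro conjI ballI allI)
  show "0 \<in> saturation Z U"
    using frag.subspace_0[OF assms(1)] frag.subspace_0[OF assms(2)] by (auto simp: saturation_def intro: exI[of _ 1])
  fix x y assume "x \<in> saturation Z U" "y \<in> saturation Z U"
  then obtain n m where nm: "x \<in> Z" "y \<in> Z" "n > 0" "m > 0" "frag_cmul n x \<in> U" "frag_cmul m y \<in> U"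
    by (auto simp: saturation_def)
  have "frag_cmul m (frag_cmul n x) + frag_cmul n (frag_cmul m y) \<in> U"
    by (rule frag.subspace_add[OF assms(2) frag.subspace_scale[OF assms(2) nm(5)] frag.subspace_scale[OF assms(2) nm(6)]])
  then have "frag_cmul (n * m) (x + y) \<in> U"
    by (simp add: frag_cmul_distrib2 mult.commute)
  then show "x + y \<in> saturation Z U"
    using nm frag.subspace_add[OF assms(1)] by (auto simp: saturation_def intro: exI[of _ "n * m"])
next
  fix c x assume "x \<in> saturation Z U"
  then obtain n where n: "x \<in> Z" "n > 0" "frag_cmul n x \<in> U" by (auto simp: saturation_def)
  have "frag_cmul c (frag_cmul n x) \<in> U" by (rule frag.subspace_scale[OF assms(2) n(3)])
  then have "frag_cmul n (frag_cmul c x) \<in> U" by (simp add: mult.commute)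
  then show "frag_cmul c x \<in> saturation Z U"
    using n frag.subspace_scale[OF assms(1)] by (auto simp: saturation_def)
qed

lemma torsion_order_quotient:
  assumes "frag.subspace Z" "frag.subspace U" "U \<subseteq> Z"
  shows "torsion_order (chain_subgroup Z Mod U) = lattice_index (saturation Z U) U"
proof -
  have "{x \<in> carrier (chain_subgroup Z Mod U). \<exists>n::nat. n > 0 \<and> x [^]\<^bsub>chain_subgroup Z Mod U\<^esub> n = \<one>\<^bsub>chain_subgroup Z Mod U\<^esub>}
      = coset U ` saturation Z U"
  proof (intro equalityI subsetI)
    fix K assume "K \<in> {x \<in> carrier (chain_subgroup Z Mod U). \<exists>n::nat. n > 0 \<and> x [^]\<^bsub>chain_subgroup Z Mod U\<^esub> n = \<one>\<^bsub>chain_subgroup Z Mod U\<^esub>}"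
    then obtain x and n :: nat where x: "x \<in> Z" "K = coset U x" "n > 0"
      "coset U x [^]\<^bsub>chain_subgroup Z Mod U\<^esub> n = \<one>\<^bsub>chain_subgroup Z Mod U\<^esub>"
      unfolding quotient_group(3)[OF assms] by blast
    then have "frag_cmul (int n) x \<in> U"
      unfolding quotient_pow(1)[OF assms x(1)] quotient_group(4)[OF assms] coset_0_iff[OF assms(2)] by blast
    then show "K \<in> coset U ` saturation Z U" using x by (auto simp: saturation_def intro!: imageI exI[of _ "int n"])
  next
    fix K assume "K \<in> coset U ` saturation Z U"
    then obtain x n where x: "x \<in> Z" "K = coset U x" "n > 0" "frag_cmul n x \<in> U" by (auto simp: saturation_def)
    have "coset U x [^]\<^bsub>chain_subgroup Z Mod U\<^esub> (nat n) = \<one>\<^bsub>chain_subgroup Z Mod U\<^esub>"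
      unfolding quotient_pow(1)[OF assms x(1)] quotient_group(4)[OF assms] coset_0_iff[OF assms(2)] using x by simp
    moreover have "nat n > 0" using x by simp
    ultimately show "K \<in> {x \<in> carrier (chain_subgroup Z Mod U). \<exists>n::nat. n > 0 \<and> x [^]\<^bsub>chain_subgroup Z Mod U\<^esub> n = \<one>\<^bsub>chain_subgroup Z Mod U\<^esub>}"
      unfolding quotient_group(3)[OF assms] using x by blast
  qed
  then show ?thesis unfolding torsion_order_def lattice_index_def by simp
qed

lemma trivial_quotient_iff:
  assumes "frag.subspace Z"
  shows "trivial_group (chain_subgroup Z Mod {0}) \<longleftrightarrow> Z = {0}"
proof -
  have z: "frag.subspace {0}" "{0} \<subseteq> Z" using frag.subspace_0[OF assms] by simp_all
  note q = quotient_group[OF assms z]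
  interpret Q: comm_group "chain_subgroup Z Mod {0}" by (rule q(1))
  have "trivial_group (chain_subgroup Z Mod {0}) \<longleftrightarrow> coset {0} ` Z = {coset {0} 0}"
    unfolding trivial_group_def q(3,4) using Q.is_group by simp
  also have "\<dots> \<longleftrightarrow> Z = {0}"
    using z by (auto simp: coset_def)
  finally show ?thesis .
qed

section \<open>The rank of a quotient\<close>

lemma independent_length_le:
  assumes "frag.independent_list vs" "set vs \<subseteq> A" "real_chain ` A \<subseteq> span (set ws)"
  shows "length vs \<le> length ws"
proof -
  have r: "rv.independent_list (map real_chain vs)" using assms(1) real_independent_iff by blast
  then have "independent (set (map real_chain vs))" and d: "distinct (map real_chain vs)"
    by (simp_all add: independent_list_real_iff)
  moreover have "set (map real_chain vs) \<subseteq> span (set ws)" using assms(2,3) by auto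
  ultimately have "card (set (map real_chain vs)) \<le> card (set ws)"
    using independent_span_bound[of "set ws" "set (map real_chain vs)"] by blast
  also have "\<dots> \<le> length ws" by (rule card_length)
  finally show ?thesis using distinct_card[OF d] by simp
qed

lemma lattice_basis_span:
  assumes "lattice_basis A es"
  shows "realification A = span (set (map real_chain es))" "real_chain ` A \<subseteq> span (set (map real_chain es))"
proof -
  have A: "A = range (frag.comb es)" using assms by (simp add: lattice_basis_iff)
  show sub: "real_chain ` A \<subseteq> span (set (map real_chain es))"
    unfolding A span_list_real by (auto simp: real_chain_comb)
  have "set (map real_chain es) \<subseteq> real_chain ` A" using lattice_basis_subspace(2)[OF assms] by auto
  then show "realification A = span (set (map real_chain es))"
    unfolding realification_def using sub by (metis span_mono span_span subset_antisym)
qed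

text \<open>
  Representatives of independent classes form, together with a basis of \<open>U\<close>, an independent list in \<open>Z\<close>. This bounds
  the rank from above. The bound is attained, since over the reals the basis of \<open>U\<close> extends to a basis of the span of \<open>Z\<close>
  by elements of \<open>Z\<close>.
\<close>

theorem abelian_rank_quotient:
  assumes Z: "lattice_basis Z zs" and U: "lattice_basis U us" and UZ: "U \<subseteq> Z"
  shows "length us \<le> length zs" and "abelian_rank (chain_subgroup Z Mod U) = length zs - length us"
proof -
  let ?Q = "chain_subgroup Z Mod U"
  have rU: "range (frag.comb us) = U"
    and iZ: "frag.independent_list zs" and iU: "frag.independent_list us"
    using Z U by (simp_all add: lattice_basis_iff)
  note sZ = lattice_basis_subspace(1)[OF Z] and sU = lattice_basis_subspace(1)[OF U]
    and usU = lattice_basis_subspace(2)[OF U]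
  note q = quotient_group[OF sZ sU UZ]
  note bound = independent_length_le[OF _ _ lattice_basis_span(2)[OF Z], simplified]
  show le: "length us \<le> length zs" by (rule bound[OF iU]) (use usU UZ in auto)
  let ?ind = "\<lambda>S. finite S \<and> S \<subseteq> carrier ?Q \<and>
     (\<forall>n. finprod ?Q (\<lambda>x. x [^]\<^bsub>?Q\<^esub> (n x :: int)) S = \<one>\<^bsub>?Q\<^esub> \<longrightarrow> (\<forall>x\<in>S. n x = 0))"
  \<comment> \<open>Relations between classes are read in \<open>Z\<close>: the product of powers of cosets is the coset of the combination.\<close>
  have fp: "finprod ?Q (\<lambda>K. K [^]\<^bsub>?Q\<^esub> (n K :: int)) (coset U ` X) = coset U (\<Sum>x\<in>X. frag_cmul (n (coset U x)) x)"
    if X: "finite X" "X \<subseteq> Z" "inj_on (coset U) X" for X n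
  proof -
    interpret Q: comm_group ?Q by (rule q(1))
    have cl: "coset U x [^]\<^bsub>?Q\<^esub> (m :: int) \<in> carrier ?Q" if "x \<in> X" for x m
      by (rule Q.int_pow_closed) (use that X(2) q(3) in blast)
    have cl': "coset U (frag_cmul m x) \<in> carrier ?Q" if "x \<in> X" for x m
      unfolding q(3) by (rule imageI, rule frag.subspace_scale[OF sZ]) (use that X(2) in blast)
    have "finprod ?Q (\<lambda>K. K [^]\<^bsub>?Q\<^esub> (n K :: int)) (coset U ` X)
        = finprod ?Q (\<lambda>x. coset U x [^]\<^bsub>?Q\<^esub> n (coset U x)) X"
      using X(2,3) by (intro Q.finprod_reindex) (auto intro!: cl)
    also have "\<dots> = finprod ?Q (\<lambda>x. coset U (frag_cmul (n (coset U x)) x)) X"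
    proof (rule Q.finprod_cong'[OF refl])
      show "coset U x [^]\<^bsub>?Q\<^esub> n (coset U x) = coset U (frag_cmul (n (coset U x)) x)" if "x \<in> X" for x
        by (rule quotient_pow(2)[OF sZ sU UZ]) (use that X(2) in blast)
    qed (use cl' in blast)
    also have "\<dots> = coset U (finprod (chain_subgroup Z) (\<lambda>x. frag_cmul (n (coset U x)) x) X)"
      using X by (intro hom_finprod[symmetric] comm_group_chain_subgroup sZ q(1,2)) (auto intro: frag.subspace_scale[OF sZ])
    also have "finprod (chain_subgroup Z) (\<lambda>x. frag_cmul (n (coset U x)) x) X = (\<Sum>x\<in>X. frag_cmul (n (coset U x)) x)"
      using X by (intro finprod_chain_subgroup sZ) (auto intro: frag.subspace_scale[OF sZ])
    finally show ?thesis .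
  qed
  have comb_append: "frag.comb (xs @ ys) c = frag.comb xs c + frag.comb ys (\<lambda>i. c (length xs + i))" for xs ys c
  proof -
    have "{..<length xs + length ys} = {..<length xs} \<union> (\<lambda>i. length xs + i) ` {..<length ys}"
    proof -
      have "(\<lambda>i. length xs + i) ` {..<length ys} = {length xs..<length xs + length ys}"
        by (simp add: lessThan_atLeast0 image_add_atLeastLessThan add.commute)
      then show ?thesis by auto
    qed
    then show ?thesis
      unfolding frag.comb_def length_append
      by (simp only:) (subst sum.union_disjoint, auto simp: sum.reindex nth_append intro!: arg_cong2[where f = "(+)"] sum.cong)
  qed
  have upper: "card S \<le> length zs - length us" if S: "?ind S" for S
  proof -
    have fS: "finite S" by (rule conjunct1[OF S])
    have SZ: "S \<subseteq> coset U ` Z" using conjunct1[OF conjunct2[OF S]] unfolding q(3) .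
    have S_ind: "\<forall>K\<in>S. n K = 0" if "finprod ?Q (\<lambda>K. K [^]\<^bsub>?Q\<^esub> (n K :: int)) S = \<one>\<^bsub>?Q\<^esub>" for n
      using conjunct2[OF conjunct2[OF S], rule_format, of n] that by simp
    have "\<forall>K\<in>S. \<exists>x. x \<in> Z \<and> coset U x = K" using SZ by blast
    then obtain s where s: "\<And>K. K \<in> S \<Longrightarrow> s K \<in> Z \<and> coset U (s K) = K" by metis
    obtain Ks where Ks: "set Ks = S" "distinct Ks" using finite_distinct_list[OF fS] by blast
    let ?xs = "map s Ks"
    have inj: "inj_on s S" using s by (metis inj_onI)
    have X: "finite (s ` S)" "s ` S \<subseteq> Z" "inj_on (coset U) (s ` S)" "coset U ` s ` S = S"
    proof -
      show "finite (s ` S)" using fS by simp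
      show "s ` S \<subseteq> Z" using s by blast
      show "inj_on (coset U) (s ` S)" by (rule inj_onI) (use s in auto)
      have "(\<lambda>K. coset U (s K)) ` S = (\<lambda>K. K) ` S" using s by (intro image_cong) auto
      then show "coset U ` s ` S = S" by (simp add: image_image)
    qed
    have "frag.independent_list (?xs @ us)"
      unfolding frag.independent_list_def
    proof (intro allI impI)
      fix c i assume 0: "frag.comb (?xs @ us) c = 0" and i: "i < length (?xs @ us)"
      define n where "n K = c (the_inv_into {..<length Ks} ((!) Ks) K)" for K
      have bij: "bij_betw ((!) Ks) {..<length Ks} S" using Ks bij_betw_nth by blast
      have n: "n (Ks ! j) = c j" if "j < length Ks" for j
        unfolding n_def using bij that by (subst the_inv_into_f_f) (auto simp: bij_betw_def)
      have "(\<Sum>x\<in>s ` S. frag_cmul (n (coset U x)) x) = (\<Sum>K\<in>S. frag_cmul (n K) (s K))"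
        using s inj by (subst sum.reindex) (auto intro!: sum.cong)
      also have "\<dots> = (\<Sum>j<length Ks. frag_cmul (n (Ks ! j)) (s (Ks ! j)))"
        by (rule sum.reindex_bij_betw[OF bij, symmetric])
      also have "\<dots> = frag.comb ?xs c"
        unfolding frag.comb_def by (simp add: n)
      also have "frag.comb ?xs c = - frag.comb us (\<lambda>i. c (length ?xs + i))"
        using 0 unfolding comb_append by (simp add: eq_neg_iff_add_eq_0)
      also have "\<dots> \<in> U" using frag.subspace_neg[OF sU] rU by blast
      finally have "finprod ?Q (\<lambda>K. K [^]\<^bsub>?Q\<^esub> n K) S = \<one>\<^bsub>?Q\<^esub>"
        using fp[OF X(1-3), of n] unfolding X(4) q(4) by (simp add: coset_0_iff[OF sU])
      then have "\<forall>K\<in>S. n K = 0" by (rule S_ind)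
      then have cz: "c j = 0" if "j < length Ks" for j
        using n[OF that] that Ks(1) nth_mem by force
      then have "frag.comb ?xs c = 0" by (simp add: frag.comb_def)
      then have "frag.comb us (\<lambda>i. c (length ?xs + i)) = 0" using 0 unfolding comb_append by simp
      then have "\<forall>j<length us. c (length ?xs + j) = 0" using iU unfolding frag.independent_list_def by blast
      then show "c i = 0" using cz i
        by (cases "i < length Ks") (auto dest!: spec[of _ "i - length Ks"])
    qed
    then have "length (?xs @ us) \<le> length zs"
      by (rule bound) (use X(2) usU UZ Ks in auto)
    moreover have "length Ks = card S" using Ks distinct_card by metis
    ultimately show ?thesis by simp
  qed
  have attained: "\<exists>S. ?ind S \<and> card S = length zs - length us"
  proof -
    let ?ru = "set (map real_chain us)"
    have iu: "independent ?ru" and du: "distinct (map real_chain us)"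
      using iU real_independent_iff independent_list_real_iff by blast+
    have iz: "independent (set (map real_chain zs))" and dz: "distinct (map real_chain zs)"
      using iZ real_independent_iff independent_list_real_iff by blast+
    have "?ru \<subseteq> real_chain ` Z" using usU UZ by auto
    then obtain B where B: "?ru \<subseteq> B" "B \<subseteq> real_chain ` Z" "independent B" "real_chain ` Z \<subseteq> span B"
      using maximal_independent_subset_extend[OF _ iu, of "real_chain ` Z"] by blast
    have fB: "finite B"
      using independent_span_bound[of "set (map real_chain zs)" B] B(2,3) lattice_basis_span(2)[OF Z] by blast
    have "span B = realification Z"
      unfolding realification_def using B(2,4) by (metis span_mono span_span subset_antisym)
    then have "card B = card (set (map real_chain zs))"
      using B(3) iz unfolding lattice_basis_span(1)[OF Z] by (metis dim_eq_card)
    then have cB: "card B = length zs" using distinct_card[OF dz] by simp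
    define X where "X = {x \<in> Z. real_chain x \<in> B - ?ru}"
    have XB: "bij_betw real_chain X (B - ?ru)"
      unfolding bij_betw_def X_def using B(2) by (auto simp: inj_on_def real_chain_inj)
    have fX: "finite X" using XB fB bij_betw_finite by blast
    have cX: "card X = length zs - length us"
      using bij_betw_same_card[OF XB] card_Diff_subset[of ?ru B] B(1) cB distinct_card[OF du] by simp
    \<comment> \<open>A combination of the added elements that lies in \<open>U\<close> lies in the real span of \<open>us\<close>. As \<open>B\<close> is independent, its coefficients vanish.\<close>
    have key: "\<forall>x\<in>X. m x = 0" if m: "(\<Sum>x\<in>X. frag_cmul (m x) x) \<in> U" for m
    proof -
      obtain c where c: "(\<Sum>x\<in>X. frag_cmul (m x) x) = frag.comb us c" using m rU by blast
      have "(\<Sum>x\<in>X. real_of_int (m x) *\<^sub>R real_chain x) \<in> span ?ru"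
        using arg_cong[OF c, of real_chain] unfolding real_chain_sum real_chain_scale real_chain_comb span_list_real by blast
      moreover define f where "f = (\<lambda>b. real_of_int (m (the_inv_into X real_chain b)))"
      moreover have fx: "f (real_chain x) = real_of_int (m x)" if "x \<in> X" for x
        unfolding f_def using XB that by (subst the_inv_into_f_f) (auto simp: bij_betw_def)
      have "(\<Sum>x\<in>X. real_of_int (m x) *\<^sub>R real_chain x) = (\<Sum>b\<in>B - ?ru. f b *\<^sub>R b)"
        unfolding sum.reindex_bij_betw[OF XB, symmetric] using fx by simp
      ultimately have "(\<Sum>b\<in>B - ?ru. f b *\<^sub>R b) \<in> span ?ru" by simp
      then obtain g where g: "(\<Sum>b\<in>B - ?ru. f b *\<^sub>R b) = (\<Sum>b\<in>?ru. g b *\<^sub>R b)"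
        unfolding span_finite[OF finite_set] by blast
      let ?h = "\<lambda>b. if b \<in> ?ru then - g b else f b"
      have "(\<Sum>b\<in>B. ?h b *\<^sub>R b) = (\<Sum>b\<in>B - ?ru. ?h b *\<^sub>R b) + (\<Sum>b\<in>?ru. ?h b *\<^sub>R b)"
        by (rule sum.subset_diff[OF B(1) fB])
      also have "\<dots> = 0" using g by (simp add: sum_negf)
      finally have "?h b = 0" if "b \<in> B" for b
        using independentD[OF B(3) fB order_refl, of ?h b] that by blast
      then have "f b = 0" if "b \<in> B - ?ru" for b using that by (metis DiffE)
      then show ?thesis using fx XB by (metis bij_betwE of_int_eq_0_iff)
    qed
    have inj: "inj_on (coset U) X"
    proof (rule inj_onI, rule ccontr)
      fix x y assume xy: "x \<in> X" "y \<in> X" "coset U x = coset U y" "x \<noteq> y"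
      have "(\<Sum>z\<in>X. frag_cmul ((if z = x then 1 else 0) - (if z = y then 1 else 0)) z) = x - y"
        using fX xy by (simp add: frag.scale_left_diff_distrib sum_subtractf if_distrib[of "\<lambda>c. frag_cmul c _"] cong: if_cong)
      also have "\<dots> \<in> U" using xy(3) by (simp add: coset_eq_iff[OF sU])
      finally show False using key[of "\<lambda>z. (if z = x then 1 else 0) - (if z = y then 1 else 0)"] xy by auto
    qed
    have XZ: "X \<subseteq> Z" by (auto simp: X_def)
    have A: "?ind (coset U ` X)"
    proof (intro conjI allI impI)
      fix n assume "finprod ?Q (\<lambda>K. K [^]\<^bsub>?Q\<^esub> (n K :: int)) (coset U ` X) = \<one>\<^bsub>?Q\<^esub>"
      then have "(\<Sum>x\<in>X. frag_cmul (n (coset U x)) x) \<in> U"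
        unfolding fp[OF fX XZ inj] q(4) coset_0_iff[OF sU] .
      then show "\<forall>K\<in>coset U ` X. n K = 0" using key[of "\<lambda>x. n (coset U x)"] by blast
    qed (use fX XZ q(3) in auto)
    have B: "card (coset U ` X) = length zs - length us" using card_image[OF inj] cX by simp
    show ?thesis by (rule exI[of _ "coset U ` X"], rule conjI[OF A B])
  qed
  define ind where "ind = ?ind"
  have up: "card S \<le> length zs - length us" if "ind S" for S using upper that unfolding ind_def .
  have att: "\<exists>S. ind S \<and> card S = length zs - length us" using attained unfolding ind_def .
  have "Max {card S |S. ind S} = length zs - length us"
  proof (rule Max_eqI)
    have "{card S |S. ind S} \<subseteq> {..length zs - length us}" using up by blast
    then show "finite {card S |S. ind S}" by (rule finite_subset) simp
    show "y \<le> length zs - length us" if "y \<in> {card S |S. ind S}" for y using up that by blast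
    obtain S0 where "ind S0" "card S0 = length zs - length us" using att by blast
    then show "length zs - length us \<in> {card S |S. ind S}"
      by (intro CollectI exI[of _ S0] conjI) simp_all
  qed
  then show "abelian_rank ?Q = length zs - length us"
    unfolding abelian_rank_def ind_def .
qed

section \<open>The determinant of a projected weighted Laplacian\<close>

text \<open>
  If \<open>G\<close> is the Gram matrix of a basis of \<open>V\<close>, the determinant times \<open>det G\<close> is a weighted sum of squared determinants
  with entries \<open>\<langle>b\<^sub>i, \<beta>\<^sub>a\<rangle>\<close>. Projecting \<open>\<beta>\<^sub>a\<close> to \<open>V\<close> does not change these entries, and if \<open>M\<close> contains the coordinates of the
  projections then the determinants are \<open>det G \<cdot> det M\<close>, whereas the Gram determinant of the projections is
  \<open>(det M)\<^sup>2 \<cdot> det G\<close>.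
\<close>

theorem operator_det_laplacian:
  fixes \<beta> :: "'i \<Rightarrow> 'c rchain" and w :: "'i \<Rightarrow> real"
  assumes I: "finite I" and bs0: "rv.independent_list as" "span (set as) = V"
    and L: "\<And>x. x \<in> V \<Longrightarrow> L x = orthogonal_projection V (\<Sum>a\<in>I. (w a * chain_inner (\<beta> a) x) *\<^sub>R \<beta> a)"
    and e: "\<And>S. S \<subseteq> I \<Longrightarrow> card S = length as \<Longrightarrow> bij_betw (e S) {0..<length as} S"
  defines "us \<equiv> \<lambda>S. map (\<lambda>j. orthogonal_projection V (\<beta> (e S j))) [0..<length as]"
  shows "operator_det V L = (\<Sum>S | S \<subseteq> I \<and> card S = length as. (\<Prod>a\<in>S. w a) * Determinant.det (gram (us S) (us S)))"
proof -
  let ?n = "length as" and ?P = "orthogonal_projection V"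
  have PV: "?P x \<in> V" for x
    unfolding bs0(2)[symmetric] by (rule orthogonal_projection(1)[OF bs0(1)])
  have inner_P: "chain_inner v (?P x) = chain_inner v x" if "v \<in> V" for v x
    using orthogonal_projection(2)[OF bs0(1), of v x] that unfolding bs0(2) .
  obtain bs where bs: "rv.independent_list bs" "span (set bs) = V" "length bs = ?n"
    "operator_det V L * Determinant.det (gram bs bs) = Determinant.det (gram bs (map L bs))"
    using operator_det_gram[OF bs0, of L] L PV by metis
  have bV: "bs ! i \<in> V" if "i < ?n" for i
    using bs(2,3) that by (metis nth_mem span_base)
  let ?q = "\<lambda>i a. chain_inner (bs ! i) (\<beta> a)"
  have "gram bs (map L bs) = mat ?n ?n (\<lambda>(i, j). \<Sum>a\<in>I. w a * ?q i a * ?q j a)"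
  proof (rule eq_matI)
    fix i j assume "i < dim_row (mat ?n ?n (\<lambda>(i, j). \<Sum>a\<in>I. w a * ?q i a * ?q j a))"
      "j < dim_col (mat ?n ?n (\<lambda>(i, j). \<Sum>a\<in>I. w a * ?q i a * ?q j a))"
    then have ij: "i < ?n" "j < ?n" by auto
    have "chain_inner (bs ! i) (L (bs ! j)) = chain_inner (bs ! i) (\<Sum>a\<in>I. (w a * chain_inner (\<beta> a) (bs ! j)) *\<^sub>R \<beta> a)"
      unfolding L[OF bV[OF ij(2)]] by (rule inner_P[OF bV[OF ij(1)]])
    also have "\<dots> = (\<Sum>a\<in>I. w a * ?q i a * ?q j a)"
      unfolding linear_sum[OF linear_chain_inner] chain_inner_scale_right
      by (intro sum.cong refl) (simp add: chain_inner_commute ac_simps)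
    finally show "gram bs (map L bs) $$ (i, j) = mat ?n ?n (\<lambda>(i, j). \<Sum>a\<in>I. w a * ?q i a * ?q j a) $$ (i, j)"
      using ij bs(3) by (simp add: gram_def)
  qed (use bs(3) in \<open>auto simp: gram_def\<close>)
  then have "operator_det V L * Determinant.det (gram bs bs)
      = (\<Sum>S | S \<subseteq> I \<and> card S = ?n. (\<Prod>a\<in>S. w a) * (Determinant.det (mat ?n ?n (\<lambda>(i, j). ?q i (e S j))))\<^sup>2)"
    using det_weighted_gram[OF I e, where w = w and q = ?q] bs(4) by simp
  also have "\<dots> = (\<Sum>S | S \<subseteq> I \<and> card S = ?n. (\<Prod>a\<in>S. w a) * (Determinant.det (gram bs bs) * Determinant.det (gram (us S) (us S))))"
  proof (rule sum.cong[OF refl])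
    fix S
    have len: "length (us S) = length bs" by (simp add: us_def bs(3))
    have q_gram: "mat ?n ?n (\<lambda>(i, j). ?q i (e S j)) = gram bs (us S)"
      by (rule eq_matI) (auto simp: gram_def us_def bs(3) inner_P bV)
    have V: "V = range (rv.comb bs)" using bs(2) unfolding span_list_real by (rule sym)
    have "us S ! j \<in> V" if "j < length bs" for j
      using PV that by (simp add: us_def bs(3))
    then have "\<exists>c. us S ! j = rv.comb bs c" if "j < length bs" for j
      using that unfolding V by blast
    then obtain C where C: "\<And>j. j < length bs \<Longrightarrow> us S ! j = rv.comb bs (C j)" by metis
    let ?M = "mat (length bs) (length bs) (\<lambda>(i, j). C j i)"
    have g1: "gram bs (us S) = gram bs bs * ?M" by (rule gram_comb(1)[OF len C])
    have g3: "Determinant.det (gram (us S) (us S)) = (Determinant.det ?M)\<^sup>2 * Determinant.det (gram bs bs)"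
      by (rule gram_comb(3)[OF len C])
    have "Determinant.det (gram bs (us S)) = Determinant.det (gram bs bs) * Determinant.det ?M"
      unfolding g1 by (rule det_mult[of _ "length bs"]) auto
    then have "(Determinant.det (gram bs (us S)))\<^sup>2 = Determinant.det (gram bs bs) * Determinant.det (gram (us S) (us S))"
      unfolding g3 by (simp add: power2_eq_square)
    then show "(\<Prod>a\<in>S. w a) * (Determinant.det (mat ?n ?n (\<lambda>(i, j). ?q i (e S j))))\<^sup>2
        = (\<Prod>a\<in>S. w a) * (Determinant.det (gram bs bs) * Determinant.det (gram (us S) (us S)))"
      unfolding q_gram by simp
  qed
  also have "\<dots> = (\<Sum>S | S \<subseteq> I \<and> card S = ?n. (\<Prod>a\<in>S. w a) * Determinant.det (gram (us S) (us S))) * Determinant.det (gram bs bs)"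
    unfolding sum_distrib_right by (intro sum.cong refl) (simp add: ac_simps)
  finally show ?thesis
    using gram_det_nonzero_iff[of bs] bs(1) by simp
qed

section \<open>Homomorphisms of groups of integral chains\<close>

lemma additive_scale:
  fixes p :: "'c zchain \<Rightarrow> 'd zchain"
  assumes B: "frag.subspace B" and add: "\<And>x y. x \<in> B \<Longrightarrow> y \<in> B \<Longrightarrow> p (x + y) = p x + p y" and x: "x \<in> B"
  shows "p 0 = 0" and "p (frag_cmul n x) = frag_cmul n (p x)"
proof -
  show p0: "p 0 = 0" using add[of 0 0] frag.subspace_0[OF B] by simp
  have nat: "p (frag_cmul (int m) x) = frag_cmul (int m) (p x)" for m
  proof (induction m)
    case (Suc m)
    have "p (frag_cmul (int m) x + x) = p (frag_cmul (int m) x) + p x"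
      using x frag.subspace_scale[OF B] by (intro add) auto
    then show ?case using Suc by (simp add: frag.scale_left_distrib add.commute)
  qed (simp add: p0)
  have neg: "p (- y) = - p y" if "y \<in> B" for y
    using add[of y "- y"] that frag.subspace_neg[OF B] p0 by (simp add: eq_neg_iff_add_eq_0 add.commute)
  show "p (frag_cmul n x) = frag_cmul n (p x)"
  proof (cases n)
    case (neg m)
    have "frag_cmul (int (Suc m)) x \<in> B" by (rule frag.subspace_scale[OF B x])
    then show ?thesis unfolding neg frag.scale_minus_left using nat[of "Suc m"] \<open>\<And>y. y \<in> B \<Longrightarrow> p (- y) = - p y\<close> by metis
  qed (use nat in simp)
qed

lemma additive_comb:
  fixes p :: "'c zchain \<Rightarrow> 'd zchain"
  assumes B: "frag.subspace B" and add: "\<And>x y. x \<in> B \<Longrightarrow> y \<in> B \<Longrightarrow> p (x + y) = p x + p y" and us: "set us \<subseteq> B"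
  shows "p (frag.comb us c) = frag.comb (map p us) c"
proof -
  have "p (\<Sum>i<m. frag_cmul (c i) (us ! i)) = (\<Sum>i<m. frag_cmul (c i) (p (us ! i))) \<and> (\<Sum>i<m. frag_cmul (c i) (us ! i)) \<in> B"
    if "m \<le> length us" for m
    using that
  proof (induction m)
    case 0
    then show ?case using additive_scale(1)[OF B add] frag.subspace_0[OF B] by simp
  next
    case (Suc m)
    have u: "us ! m \<in> B" using us Suc.prems by auto
    then show ?case
      using Suc add additive_scale(2)[OF B add u] frag.subspace_scale[OF B u] frag.subspace_add[OF B] by simp
  qed
  from this[of "length us"] show ?thesis by (simp add: frag.comb_def)
qed

text \<open>
  A basis of \<open>B\<close> is also independent over the reals, so the homomorphism has a linear extension and the choice in the
  definition succeeds.
\<close>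

lemma real_hom:
  assumes bs: "lattice_basis B bs" and add: "\<And>x y. x \<in> B \<Longrightarrow> y \<in> B \<Longrightarrow> p (x + y) = p x + p y"
  shows "linear (real_hom B p)" and "x \<in> B \<Longrightarrow> real_hom B p (real_chain x) = real_chain (p x)"
proof -
  have rB: "range (frag.comb bs) = B" and iB: "frag.independent_list bs"
    using bs by (simp_all add: lattice_basis_iff)
  note sB = lattice_basis_subspace(1)[OF bs] and bsB = lattice_basis_subspace(2)[OF bs]
  have "independent (real_chain ` set bs)"
    using iB real_independent_iff[of bs] independent_list_real_iff[of "map real_chain bs"] by simp
  then obtain F where F: "linear F" "\<forall>y\<in>real_chain ` set bs. F y = real_chain (p (Hilbert_Choice.inv real_chain y))"
    using linear_independent_extend[of "real_chain ` set bs" "\<lambda>y. real_chain (p (Hilbert_Choice.inv real_chain y))"] by blast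
  have inv: "Hilbert_Choice.inv real_chain (real_chain z) = z" for z :: "'a zchain"
    by (rule inv_f_f) (auto simp: inj_on_def real_chain_inj)
  have "F (real_chain y) = real_chain (p y)" if "y \<in> B" for y
  proof -
    obtain c where c: "y = frag.comb bs c" using \<open>y \<in> B\<close> rB by blast
    have "F (real_chain y) = rv.comb (map F (map real_chain bs)) (\<lambda>i. real_of_int (c i))"
      unfolding c real_chain_comb rv.comb_def linear_sum[OF F(1)] by (simp add: linear_scale[OF F(1)])
    also have "map F (map real_chain bs) = map real_chain (map p bs)"
      using F(2) by (auto simp: inv)
    also have "rv.comb (map real_chain (map p bs)) (\<lambda>i. real_of_int (c i)) = real_chain (p y)"
    proof -
      have "p (frag.comb bs c) = frag.comb (map p bs) c"
        by (rule additive_comb[OF sB _ bsB]) (rule add)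
      then show ?thesis unfolding c by (simp only: real_chain_comb)
    qed
    finally show ?thesis .
  qed
  then have "\<exists>F. linear F \<and> (\<forall>a\<in>B. F (real_chain a) = real_chain (p a))" using F(1) by blast
  then have *: "linear (real_hom B p) \<and> (\<forall>a\<in>B. real_hom B p (real_chain a) = real_chain (p a))"
    unfolding real_hom_def by (rule someI_ex)
  show "linear (real_hom B p)" using * by blast
  show "x \<in> B \<Longrightarrow> real_hom B p (real_chain x) = real_chain (p x)" using * by blast
qed

lemma lattice_index_image:
  assumes B: "frag.subspace B" and U: "frag.subspace U" "U \<subseteq> B" and pU: "frag.subspace (p ` U)"
    and add: "\<And>x y. x \<in> B \<Longrightarrow> y \<in> B \<Longrightarrow> p (x + y) = p x + p y" and inj: "inj_on p B"
  shows "lattice_index (p ` B) (p ` U) = lattice_index B U"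
proof -
  have "lattice_index B U = card ((\<lambda>x. coset (p ` U) (p x)) ` B)"
  proof (rule lattice_index_eq[OF U(1)])
    fix x y assume xy: "x \<in> B" "y \<in> B"
    have d: "x - y \<in> B" using xy by (rule frag.subspace_diff[OF B])
    have "p x = p (x - y) + p y" using add[OF d xy(2)] by simp
    then have "p x - p y = p (x - y)" by simp
    moreover have "p (x - y) \<in> p ` U \<longleftrightarrow> x - y \<in> U" by (rule inj_on_image_mem_iff[OF inj d U(2)])
    ultimately show "coset (p ` U) (p x) = coset (p ` U) (p y) \<longleftrightarrow> x - y \<in> U"
      by (simp add: coset_eq_iff[OF pU])
  qed
  then show ?thesis by (simp add: lattice_index_def image_image)
qed

section \<open>Torsion of quotients\<close>

lemma lattice_index_nonzero:
  assumes "lattice_basis A es" "length us = length es" "set us \<subseteq> A" "frag.independent_list us"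
  shows "lattice_index A (range (frag.comb us)) \<noteq> 0"
proof -
  have "Determinant.det (gram (map real_chain us) (map real_chain us)) \<noteq> 0"
    using assms(4) gram_det_nonzero_iff real_independent_iff by blast
  then show ?thesis using gram_lattice_index[OF assms] by auto
qed

text \<open>
  Among the multiples of \<open>x\<close> two lie in the same coset if there are only finitely many cosets.
\<close>

lemma multiple_in_sublattice:
  assumes "frag.subspace U" "frag.subspace A" "lattice_index A U \<noteq> 0" "x \<in> A"
  shows "\<exists>n>0. frag_cmul n x \<in> U"
proof -
  have "finite (coset U ` A)" using assms(3) unfolding lattice_index_def by (metis card.infinite)
  moreover have "range (\<lambda>i::nat. coset U (frag_cmul (int i) x)) \<subseteq> coset U ` A"
    using frag.subspace_scale[OF assms(2,4)] by blast
  ultimately have "finite (range (\<lambda>i::nat. coset U (frag_cmul (int i) x)))" by (rule finite_subset[rotated])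
  then have "\<not> inj (\<lambda>i::nat. coset U (frag_cmul (int i) x))" using finite_imageD infinite_UNIV_nat by blast
  then obtain i j :: nat where "i \<noteq> j" "coset U (frag_cmul (int i) x) = coset U (frag_cmul (int j) x)"
    by (auto simp: inj_on_def)
  then obtain i j :: nat where ij: "i < j" "coset U (frag_cmul (int j) x) = coset U (frag_cmul (int i) x)"
    by (metis nat_neq_iff)
  then have "frag_cmul (int j - int i) x \<in> U"
    unfolding coset_eq_iff[OF assms(1)] by (simp add: frag.scale_left_diff_distrib)
  then show ?thesis using ij(1) by (intro exI[of _ "int j - int i"]) simp
qed

text \<open>
  Finite index of \<open>U\<close> in \<open>B\<close> implies that \<open>U\<close> and \<open>B\<close> have the same saturation, and torsion is the quotient of the
  saturation.
\<close>

theorem torsion_index: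
  assumes Z: "frag.subspace Z" and B: "frag.subspace B" and U: "frag.subspace U" and UB: "U \<subseteq> B" and BZ: "B \<subseteq> Z"
    and nz: "lattice_index B U \<noteq> 0"
  shows "torsion_order (chain_subgroup Z Mod U) = torsion_order (chain_subgroup Z Mod B) * lattice_index B U"
proof -
  have "saturation Z U = saturation Z B"
  proof
    show "saturation Z U \<subseteq> saturation Z B" using UB by (auto simp: saturation_def)
    show "saturation Z B \<subseteq> saturation Z U"
    proof
      fix x assume "x \<in> saturation Z B"
      then obtain n where n: "x \<in> Z" "n > 0" "frag_cmul n x \<in> B" by (auto simp: saturation_def)
      then obtain m where "m > 0" "frag_cmul m (frag_cmul n x) \<in> U"
        using multiple_in_sublattice[OF U B nz] by blast
      then show "x \<in> saturation Z U" using n by (auto simp: saturation_def intro!: exI[of _ "m * n"])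
    qed
  qed
  moreover have "B \<subseteq> saturation Z B" using BZ by (auto simp: saturation_def intro!: exI[of _ 1])
  ultimately show ?thesis
    using torsion_order_quotient[OF Z U] torsion_order_quotient[OF Z B BZ] UB BZ
      lattice_index_mult[OF U B subspace_saturation[OF Z B] UB] by auto
qed

text \<open>
  The saturation of \<open>B\<close> has the same real span as \<open>B\<close> and hence a basis of the same length.
\<close>

lemma torsion_order_nonzero:
  assumes Z: "lattice_basis Z zs" and B: "lattice_basis B bs" and BZ: "B \<subseteq> Z" and K: "finite K" "Z \<subseteq> {x. Poly_Mapping.keys x \<subseteq> K}"
  shows "torsion_order (chain_subgroup Z Mod B) \<noteq> 0"
proof -
  have rB: "range (frag.comb bs) = B" and iB: "frag.independent_list bs"
    using B by (simp_all add: lattice_basis_iff)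
  note sZ = lattice_basis_subspace(1)[OF Z] and sB = lattice_basis_subspace(1)[OF B]
    and bsB = lattice_basis_subspace(2)[OF B]
  let ?S = "saturation Z B"
  have "?S \<subseteq> {x. Poly_Mapping.keys x \<subseteq> K}" using K(2) unfolding saturation_def by blast
  then obtain ss where ss: "lattice_basis ?S ss"
    using lattice_basis_exists[OF K(1) subspace_saturation[OF sZ sB]] by blast
  have BS: "B \<subseteq> ?S" using BZ by (auto simp: saturation_def intro!: exI[of _ 1])
  have iS: "frag.independent_list ss" and ssS: "set ss \<subseteq> ?S"
    using ss frag.span_superset[of "set ss"] by (auto simp: lattice_basis_iff frag.span_list)
  have "real_chain ` ?S \<subseteq> span (set (map real_chain bs))"
  proof clarify
    fix x assume "x \<in> ?S"
    then obtain n where n: "n > 0" "frag_cmul n x \<in> B" by (auto simp: saturation_def)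
    then have "real_of_int n *\<^sub>R real_chain x \<in> span (set (map real_chain bs))"
      using lattice_basis_span(2)[OF B] unfolding real_chain_scale[symmetric] by blast
    then have "inverse (real_of_int n) *\<^sub>R real_of_int n *\<^sub>R real_chain x \<in> span (set (map real_chain bs))"
      by (rule span_scale)
    then show "real_chain x \<in> span (set (map real_chain bs))" using n(1) by simp
  qed
  then have "length ss \<le> length bs"
    using independent_length_le[OF iS ssS] by (metis length_map)
  moreover have "length bs \<le> length ss"
    using independent_length_le[OF iB _ lattice_basis_span(2)[OF ss]] bsB BS by (metis length_map subset_trans)
  ultimately have "lattice_index ?S B \<noteq> 0"
    using lattice_index_nonzero[OF ss, of bs] iB bsB BS unfolding rB by auto
  then show ?thesis using torsion_order_quotient[OF sZ sB BZ] by simp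
qed

section \<open>Boundary maps in coordinates\<close>

lemma boundary_map_int_sum:
  assumes "finite K" "Poly_Mapping.keys x \<subseteq> K"
  shows "boundary_map X (Suc k) (x :: 'c zchain) = (\<Sum>a\<in>K. frag_cmul (Poly_Mapping.lookup x a) (incidence X k a))"
  unfolding boundary_map_int using assms by (intro sum.mono_neutral_left) (auto simp: in_keys_iff)

lemma boundary_map_int_add: "boundary_map X (Suc k) (x + y :: 'c zchain) = boundary_map X (Suc k) x + boundary_map X (Suc k) y"
proof -
  let ?K = "Poly_Mapping.keys x \<union> Poly_Mapping.keys y"
  have "Poly_Mapping.keys (x + y) \<subseteq> ?K" by (rule keys_add)
  then show ?thesis
    by (simp add: boundary_map_int_sum[of ?K] lookup_add frag.scale_left_distrib sum.distrib del: boundary_map.simps)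
qed

lemma boundary_map_int_scale: "boundary_map X (Suc k) (frag_cmul n x :: 'c zchain) = frag_cmul n (boundary_map X (Suc k) x)"
  by (rule additive_scale(2)[of UNIV]) (simp_all add: frag.subspace_UNIV boundary_map_int_add del: boundary_map.simps)

lemma subspace_keys: "frag.subspace {x. Poly_Mapping.keys x \<subseteq> S}"
proof -
  have "Poly_Mapping.keys (x + y) \<subseteq> S" if "Poly_Mapping.keys x \<subseteq> S" "Poly_Mapping.keys y \<subseteq> S"
    for x y :: "'a zchain" using that keys_add[of x y] by blast
  moreover have "Poly_Mapping.keys (frag_cmul c x) \<subseteq> S" if "Poly_Mapping.keys x \<subseteq> S"
    for c and x :: "'a zchain" using that keys_cmul[of c x] by blast
  ultimately show ?thesis by (simp add: frag.subspace_def)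
qed

lemma subspace_boundary_kernel:
  "frag.subspace {x :: 'c zchain. Poly_Mapping.keys x \<subseteq> S \<and> boundary_map X (Suc k) x = 0}"
proof -
  have "boundary_map X (Suc k) (0 :: 'c zchain) = 0" by simp
  then show ?thesis
    using subspace_keys[of S] unfolding frag.subspace_def
    by (simp add: boundary_map_int_add boundary_map_int_scale del: boundary_map.simps)
qed

lemma boundary_map_frag_of: "boundary_map X (Suc k) (frag_of a) = incidence X k a"
  by (subst boundary_map_int_sum[of "{a}"]) (auto simp: lookup_single)

lemma boundary_map_list:
  fixes cs :: "'c list"
  shows "boundary_map X (Suc k) (frag.comb (map frag_of cs) c) = frag.comb (map (incidence X k) cs) c"
proof -
  have "boundary_map X (Suc k) (frag.comb (map frag_of cs) c) = frag.comb (map (boundary_map X (Suc k)) (map frag_of cs)) c"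
    by (rule additive_comb[of UNIV]) (simp_all add: frag.subspace_UNIV boundary_map_int_add del: boundary_map.simps)
  also have "map (boundary_map X (Suc k)) (map frag_of cs) = map (incidence X k) cs"
    by (simp add: boundary_map_frag_of o_def del: boundary_map.simps)
  finally show ?thesis .
qed

lemma boundary_image_list:
  fixes cs :: "'c list"
  assumes "distinct cs"
  shows "boundary_map X (Suc k) ` {x. Poly_Mapping.keys x \<subseteq> set cs} = range (frag.comb (map (incidence X k) cs))"
proof -
  have "{x. Poly_Mapping.keys x \<subseteq> set cs} = range (frag.comb (map frag_of cs))"
    using lattice_basis_frag_of[OF assms] by (simp add: lattice_basis_iff)
  then show ?thesis by (simp add: image_image boundary_map_list del: boundary_map.simps)
qed

text \<open>
  A chain on the cells \<open>cs\<close> is given by its coefficients, and its boundary is the combination of the incidence chains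
  with the same coefficients.
\<close>

lemma boundary_kernel_list:
  fixes cs :: "'c list"
  assumes "distinct cs"
  shows "{x :: 'c zchain. Poly_Mapping.keys x \<subseteq> set cs \<and> boundary_map X (Suc k) x = 0} = {0} \<longleftrightarrow>
    frag.independent_list (map (incidence X k) cs)"
proof -
  let ?es = "map frag_of cs :: 'c zchain list"
  have es: "{x. Poly_Mapping.keys x \<subseteq> set cs} = range (frag.comb ?es)" "frag.independent_list ?es"
    using lattice_basis_frag_of[OF assms] by (simp_all add: lattice_basis_iff)
  have "{x :: 'c zchain. Poly_Mapping.keys x \<subseteq> set cs \<and> boundary_map X (Suc k) x = 0}
      = {x \<in> range (frag.comb ?es). boundary_map X (Suc k) x = 0}" using es(1) by blast
  also have "\<dots> = {0} \<longleftrightarrow> (\<forall>c. frag.comb (map (incidence X k) cs) c = 0 \<longrightarrow> frag.comb ?es c = 0)"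
  proof -
    have "0 \<in> range (frag.comb ?es)" using frag.comb_zero by (metis rangeI)
    moreover have "boundary_map X (Suc k) (0 :: 'c zchain) = 0" by simp
    ultimately show ?thesis by (auto simp: boundary_map_list simp del: boundary_map.simps)
  qed
  also have "\<dots> \<longleftrightarrow> frag.independent_list (map (incidence X k) cs)"
  proof
    assume "\<forall>c. frag.comb (map (incidence X k) cs) c = 0 \<longrightarrow> frag.comb ?es c = 0"
    then show "frag.independent_list (map (incidence X k) cs)"
      using es(2) unfolding frag.independent_list_def by simp
  next
    assume i: "frag.independent_list (map (incidence X k) cs)"
    show "\<forall>c. frag.comb (map (incidence X k) cs) c = 0 \<longrightarrow> frag.comb ?es c = 0"
    proof (intro allI impI)
      fix c assume "frag.comb (map (incidence X k) cs) c = 0"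
      then have "\<forall>i<length cs. c i = 0" using i unfolding frag.independent_list_def by simp
      then show "frag.comb ?es c = 0" by (simp add: frag.comb_def)
    qed
  qed
  finally show ?thesis .
qed

lemma boundary_map_real:
  assumes "finite K" "Poly_Mapping.keys x \<subseteq> K"
  shows "boundary_map X (Suc k) (x :: 'c rchain) = (\<Sum>a\<in>K. Poly_Mapping.lookup x a *\<^sub>R real_chain (incidence X k a))"
proof -
  have "Poly_Mapping.map (\<lambda>n. r * of_int n) y = r *\<^sub>R real_chain y" for r and y :: "'c zchain"
    by (rule poly_mapping_eqI) (simp add: map.rep_eq when_def)
  then have "boundary_map X (Suc k) x = (\<Sum>a\<in>Poly_Mapping.keys x. Poly_Mapping.lookup x a *\<^sub>R real_chain (incidence X k a))"
    by simp
  also have "\<dots> = (\<Sum>a\<in>K. Poly_Mapping.lookup x a *\<^sub>R real_chain (incidence X k a))"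
    using assms by (intro sum.mono_neutral_left) (auto simp: in_keys_iff)
  finally show ?thesis .
qed

lemma boundary_map_real_chain: "boundary_map X (Suc k) (real_chain x) = real_chain (boundary_map X (Suc k) x)"
  by (simp add: boundary_map_real[of "Poly_Mapping.keys x"] boundary_map_int real_chain_sum real_chain_scale del: boundary_map.simps)

context finite_cw begin

text \<open>
  The coefficients of the adjoint are found by pairing with the individual cells.
\<close>

lemma coboundary_map:
  fixes y :: "'c rchain"
  shows "coboundary_map X (Suc k) y \<in> chains X (Suc k)"
    and "a \<in> cells X (Suc k) \<Longrightarrow> Poly_Mapping.lookup (coboundary_map X (Suc k) y) a = chain_inner (real_chain (incidence X k a)) y"
proof -
  let ?I = "cells X (Suc k)" and ?\<beta> = "\<lambda>a. real_chain (incidence X k a)"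
  define z where "z = (\<Sum>a\<in>?I. Poly_Mapping.single a (chain_inner (?\<beta> a) y))"
  have lz: "Poly_Mapping.lookup z a = (if a \<in> ?I then chain_inner (?\<beta> a) y else 0)" for a
    using finite_cells[of "Suc k"] by (simp add: z_def lookup_sum lookup_single when_def)
  have zc: "z \<in> chains X (Suc k)"
    unfolding chains_def by (rule CollectI, rule subsetI, rule ccontr) (simp add: in_keys_iff lz)
  have inner: "chain_inner (boundary_map X (Suc k) v) y = (\<Sum>a\<in>?I. Poly_Mapping.lookup v a * chain_inner (?\<beta> a) y)"
    if "v \<in> chains X (Suc k)" for v
  proof -
    have "boundary_map X (Suc k) v = (\<Sum>a\<in>?I. Poly_Mapping.lookup v a *\<^sub>R ?\<beta> a)"
      using that finite_cells by (intro boundary_map_real) (auto simp: chains_def)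
    then show ?thesis
      unfolding chain_inner_commute[of _ y]
      by (simp add: linear_sum[OF linear_chain_inner] chain_inner_scale_right del: boundary_map.simps)
  qed
  have inner': "chain_inner v x = (\<Sum>a\<in>?I. Poly_Mapping.lookup v a * Poly_Mapping.lookup x a)"
    if "v \<in> chains X (Suc k)" for v x :: "'c rchain"
    using that finite_cells by (intro chain_inner_sum) (auto simp: chains_def)
  have eq: "coboundary_map X (Suc k) y = z"
    unfolding coboundary_map_def
  proof (rule the_equality)
    show "z \<in> chains X (Suc k) \<and> (\<forall>v\<in>chains X (Suc k). chain_inner (boundary_map X (Suc k) v) y = chain_inner v z)"
      using zc by (auto simp: inner inner' lz simp del: boundary_map.simps intro!: sum.cong)
    fix x assume x: "x \<in> chains X (Suc k) \<and> (\<forall>v\<in>chains X (Suc k). chain_inner (boundary_map X (Suc k) v) y = chain_inner v x)"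
    show "x = z"
    proof (rule poly_mapping_eqI)
      fix a
      show "Poly_Mapping.lookup x a = Poly_Mapping.lookup z a"
      proof (cases "a \<in> ?I")
        case True
        let ?v = "Poly_Mapping.single a (1::real)"
        have v: "?v \<in> chains X (Suc k)" using True by (simp add: chains_def)
        have *: "(\<Sum>b\<in>?I. Poly_Mapping.lookup ?v b * f b) = f a" for f :: "'c \<Rightarrow> real"
          using True finite_cells[of "Suc k"] by (simp add: lookup_single when_def if_distrib[of "\<lambda>c. c * _"] cong: if_cong)
        show ?thesis using x v inner[OF v] inner'[OF v, of x] True by (simp add: * lz del: boundary_map.simps)
      next
        case False
        then have "Poly_Mapping.lookup x a = 0" using x by (auto simp: chains_def in_keys_iff)
        then show ?thesis using False by (simp add: lz)
      qed
    qed
  qed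
  show "coboundary_map X (Suc k) y \<in> chains X (Suc k)" unfolding eq by (rule zc)
  show "a \<in> ?I \<Longrightarrow> Poly_Mapping.lookup (coboundary_map X (Suc k) y) a = chain_inner (?\<beta> a) y"
    unfolding eq lz by simp
qed

lemma weighted_laplacian:
  fixes y :: "'c rchain"
  shows "boundary_map X (Suc k) (exp_weight W (coboundary_map X (Suc k) y)) =
    (\<Sum>a\<in>cells X (Suc k). (exp (- W a) * chain_inner (real_chain (incidence X k a)) y) *\<^sub>R real_chain (incidence X k a))"
proof -
  let ?z = "coboundary_map X (Suc k) y"
  have l: "Poly_Mapping.lookup (exp_weight W ?z) a = exp (- W a) * Poly_Mapping.lookup ?z a" for a
    by (simp add: exp_weight_def lookup_mapp when_def in_keys_iff)
  have "Poly_Mapping.keys (exp_weight W ?z) \<subseteq> cells X (Suc k)"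
    using coboundary_map(1)[of k y] by (auto simp: chains_def in_keys_iff l)
  then show ?thesis
    by (subst boundary_map_real[OF finite_cells]) (auto simp: l coboundary_map(2) intro!: sum.cong)
qed

lemma subspace_cycles: "frag.subspace (cycles X k :: 'c zchain set)"
proof (cases k)
  case 0
  then show ?thesis using subspace_keys[of "cells X 0"] by (simp add: cycles_def chains_def)
next
  case (Suc j)
  then show ?thesis using subspace_boundary_kernel[of "cells X k" X j] by (simp add: cycles_def chains_def del: boundary_map.simps)
qed

end

section \<open>Spanning trees and the determinant formula\<close>

lemma subgroup_imp_subspace:
  assumes "subgroup A (free_Abelian_group K)"
  shows "frag.subspace A" "A \<subseteq> {x. Poly_Mapping.keys x \<subseteq> K}"
proof -
  interpret subgroup A "free_Abelian_group K" by fact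
  show sub: "A \<subseteq> {x. Poly_Mapping.keys x \<subseteq> K}" using subset by (auto simp: free_Abelian_group_def)
  have add: "x + y \<in> A" if "x \<in> A" "y \<in> A" for x y using m_closed[OF that] by simp
  have neg: "- x \<in> A" if x: "x \<in> A" for x
  proof -
    have "Poly_Mapping.keys x \<subseteq> K" using sub x by blast
    from inv_free_Abelian_group[OF this] show ?thesis using m_inv_closed[OF x] by simp
  qed
  have zero: "0 \<in> A" using one_closed by simp
  have nat: "frag_cmul (int n) x \<in> A" if "x \<in> A" for n x
    by (induction n) (auto simp: zero frag.scale_left_distrib that intro: add)
  have "frag_cmul c x \<in> A" if x: "x \<in> A" for c x
  proof (cases c)
    case (neg n)
    show ?thesis unfolding neg frag.scale_minus_left by (rule \<open>\<And>x. x \<in> A \<Longrightarrow> - x \<in> A\<close>[OF nat[OF x]])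
  qed (use nat[OF x] in simp)
  then show "frag.subspace A" unfolding frag.subspace_def using zero add by blast
qed

context finite_cw begin

lemma boundary_image_subset_cycles:
  "boundary_map X (Suc k) ` {x :: 'c zchain. Poly_Mapping.keys x \<subseteq> cells X (Suc k)} \<subseteq> cycles X k"
  using boundary_of_boundary[of _ k] cell_combination_boundary(1)[of _ k]
  by (auto simp: cycles_def chains_def simp del: boundary_map.simps)

text \<open>
  Top homology consists of the linear relations between the boundaries of the chosen cells. If there are none, these
  boundaries form a basis of the boundary group of the subcomplex. Both Betti numbers are then the rank of the same cycle
  group reduced by the number of elements of a basis of the respective boundary group.
\<close>

theorem with_top_cells_spanning_tree_iff:
  fixes cs :: "'c list"
  assumes B: "lattice_basis (boundaries X k) bs" and cs: "distinct cs" "set cs \<subseteq> cells X (Suc k)"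
  shows "with_top_cells X (Suc k) (set cs) \<in> spanning_trees X (Suc k) \<longleftrightarrow>
    length cs = length bs \<and> frag.independent_list (map (incidence X k) cs)"
proof -
  let ?T = "with_top_cells X (Suc k) (set cs)"
  let ?vs = "map (incidence X k) cs"
  let ?U = "range (frag.comb ?vs)"
  note hom = homology_with_top_cells[OF cs(2)]
  have T: "subcomplex ?T X" by (rule subcomplex_with_top_cells[OF cs(2)])
  have low: "\<forall>j<Suc k. cells X j \<subseteq> cells ?T j" by (simp add: cells_with_top_cells)
  have BX: "boundaries X k = boundary_map X (Suc k) ` {x :: 'c zchain. Poly_Mapping.keys x \<subseteq> cells X (Suc k)}"
    by (simp add: boundaries_def chains_def)
  have BT: "boundaries ?T k = ?U" unfolding hom(2) by (rule boundary_image_list[OF cs(1)])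
  have UB: "?U \<subseteq> boundaries X k"
    unfolding BX boundary_image_list[OF cs(1), symmetric] using cs(2) by (intro image_mono) auto
  have BZ: "boundaries X k \<subseteq> (cycles X k :: 'c zchain set)" unfolding BX by (rule boundary_image_subset_cycles)
  have "(cycles X k :: 'c zchain set) \<subseteq> {x. Poly_Mapping.keys x \<subseteq> cells X k}" by (auto simp: cycles_def chains_def)
  then obtain zs where zs: "lattice_basis (cycles X k) zs"
    using lattice_basis_exists[OF finite_cells subspace_cycles] by blast
  have top: "trivial_group (cellular_homology ?T (Suc k)) \<longleftrightarrow> frag.independent_list ?vs"
  proof -
    let ?C = "cycles ?T (Suc k) :: 'c zchain set"
    have "frag.subspace ?C" unfolding hom(3) by (rule subspace_boundary_kernel)
    then have "trivial_group (cellular_homology ?T (Suc k)) \<longleftrightarrow> ?C = {0}"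
      unfolding cellular_homology_def hom(4) by (rule trivial_quotient_iff)
    then show ?thesis unfolding hom(3) boundary_kernel_list[OF cs(1)] .
  qed
  have betti: "betti ?T k = betti X k \<longleftrightarrow> length cs = length bs" if "frag.independent_list ?vs"
  proof -
    have U: "lattice_basis ?U ?vs" using that by (simp add: lattice_basis_iff)
    have "length ?vs \<le> length zs" "betti ?T k = length zs - length ?vs"
      using abelian_rank_quotient[OF zs U] UB BZ unfolding betti_def cellular_homology_def hom(1) BT by auto
    moreover have "length bs \<le> length zs" "betti X k = length zs - length bs"
      using abelian_rank_quotient[OF zs B BZ] unfolding betti_def cellular_homology_def by auto
    ultimately show ?thesis by auto
  qed
  show ?thesis using T low top betti by (auto simp: spanning_trees_def)
qed

end

theorem theorem6p6:
  fixes X :: "('a, 'c) cw" and d :: nat and W :: "'c \<Rightarrow> real"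
    and A :: "'c zchain set" and p :: "'c zchain \<Rightarrow> 'c zchain"
  assumes "finite_CW_complex X"
    and "connected_space (cw_space X)"
    and "has_dimension X d"
    and "d \<ge> 1"
    and "subgroup A (free_Abelian_group (cells X (d - 1)))"
    and "real_isomorphism (boundaries X (d - 1)) A p"
    and "\<forall>x\<in>boundaries X (d - 1).
           orthogonal_projection (realification A) x = real_hom (boundaries X (d - 1)) p x"
  shows "operator_det (realification A) (reduced_laplacian X d W A) =
           (gram_det A * (real (cokernel_order (boundaries X (d - 1)) A p))\<^sup>2
              / (real (homology_torsion X d))\<^sup>2)
           * (\<Sum>T\<in>spanning_trees X d. tree_weight W d T)"
proof -
  obtain k where d: "d = Suc k" using assms(4) by (cases d) auto
  interpret finite_cw X by unfold_locales (rule assms(1))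
  let ?I = "cells X (Suc k)" and ?\<beta> = "incidence X k"
  let ?B = "boundaries X k :: 'c zchain set" and ?Z = "cycles X k :: 'c zchain set" and ?V = "realification A"
  have finI: "finite ?I" by (rule finite_cells)
  have subA: "subgroup A (free_Abelian_group (cells X k))"
    and iso: "real_isomorphism ?B A p"
    and proj: "\<forall>x\<in>boundaries X k. orthogonal_projection ?V x = real_hom ?B p x"
    using assms(5-7) by (simp_all add: d)

  have BX: "?B = boundary_map X (Suc k) ` {x. Poly_Mapping.keys x \<subseteq> ?I}"
    by (simp add: boundaries_def chains_def)
  have BZ: "?B \<subseteq> ?Z" unfolding BX by (rule boundary_image_subset_cycles)
  have ZK: "?Z \<subseteq> {x. Poly_Mapping.keys x \<subseteq> cells X k}" by (auto simp: cycles_def chains_def)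
  have image_list: "boundary_map X (Suc k) ` {x. Poly_Mapping.keys x \<subseteq> set cs} = range (frag.comb (map ?\<beta> cs))"
    if "distinct cs" for cs by (rule boundary_image_list[OF that])
  have sB: "frag.subspace ?B"
  proof -
    obtain cs where cs: "set cs = ?I" "distinct cs" using finite_distinct_list[OF finI] by blast
    show ?thesis unfolding BX cs(1)[symmetric] image_list[OF cs(2)] by (rule subspace_range_comb)
  qed
  note sA = subgroup_imp_subspace[OF subA]
  obtain zs where zs: "lattice_basis ?Z zs"
    using lattice_basis_exists[OF finite_cells subspace_cycles ZK] by blast
  obtain bs where bs: "lattice_basis ?B bs"
    using lattice_basis_exists[OF finite_cells sB] BZ ZK by blast
  define es where "es = (SOME es. lattice_basis A es)"
  have es: "lattice_basis A es"
    unfolding es_def by (rule someI_ex[OF lattice_basis_exists[OF finite_cells sA]])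
  have mu: "gram_det A = Determinant.det (gram (map real_chain es) (map real_chain es))"
    unfolding gram_det_def es_def[symmetric] Let_def gram_def
    by (rule arg_cong[where f = Determinant.det], rule eq_matI) auto
  have V: "?V = span (set (map real_chain es))" by (rule lattice_basis_span(1)[OF es])
  have ies: "frag.independent_list es" and ibs: "frag.independent_list bs"
    using es bs by (simp_all add: lattice_basis_iff)
  have bsB: "set bs \<subseteq> ?B" and esA: "set es \<subseteq> A"
    using lattice_basis_subspace(2) bs es by blast+

  have p_hom: "p \<in> hom (chain_subgroup ?B) (chain_subgroup A)"
    and bij: "bij_betw (real_hom ?B p) (realification ?B) ?V"
    using iso by (simp_all add: real_isomorphism_def)
  have p_add: "p (x + y) = p x + p y" if "x \<in> ?B" "y \<in> ?B" for x y
    using p_hom that by (simp add: hom_def)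
  have p_mem: "p x \<in> A" if "x \<in> ?B" for x
    using p_hom that by (auto simp: hom_def)
  let ?F = "real_hom ?B p"
  have F: "linear ?F" and Fp: "\<And>x. x \<in> ?B \<Longrightarrow> ?F (real_chain x) = real_chain (p x)"
    using real_hom[OF bs p_add] by blast+
  have FB: "realification ?B = span (set (map real_chain bs))" by (rule lattice_basis_span(1)[OF bs])
  have rc_mem: "real_chain x \<in> realification ?B" if "x \<in> ?B" for x
    using that by (simp add: realification_def span_base)
  have p_inj: "inj_on p ?B"
  proof (rule inj_onI)
    fix x y assume xy: "x \<in> ?B" "y \<in> ?B" "p x = p y"
    then have "?F (real_chain x) = ?F (real_chain y)" by (simp add: Fp)
    then have "real_chain x = real_chain y"
      using bij rc_mem xy(1,2) unfolding bij_betw_def inj_on_def by blast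
    then show "x = y" by (simp only: real_chain_inj)
  qed
  have p_ind: "frag.independent_list (map p vs) \<longleftrightarrow> frag.independent_list vs" if vs: "set vs \<subseteq> ?B" for vs
  proof -
    have comb_mem: "frag.comb vs c \<in> ?B" for c
      using sB vs unfolding frag.comb_def by (auto intro!: frag.subspace_sum frag.subspace_scale)
    have "frag.comb (map p vs) c = 0 \<longleftrightarrow> frag.comb vs c = 0" for c
    proof -
      have "frag.comb (map p vs) c = p (frag.comb vs c)"
        by (rule additive_comb[symmetric, OF sB _ vs]) (rule p_add)
      moreover have "p 0 = 0" by (rule additive_scale(1)[OF sB _ frag.subspace_0[OF sB]]) (rule p_add)
      ultimately show ?thesis
        using inj_onD[OF p_inj, of "frag.comb vs c" 0] comb_mem[of c] frag.subspace_0[OF sB] by auto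
    qed
    then show ?thesis by (simp add: frag.independent_list_def)
  qed
  have proj_p: "orthogonal_projection ?V (real_chain x) = real_chain (p x)" if x: "x \<in> ?B" for x
  proof -
    obtain y where y: "Poly_Mapping.keys y \<subseteq> ?I" "x = boundary_map X (Suc k) y" using x unfolding BX by blast
    have "real_chain x = boundary_map X (Suc k) (real_chain y)" unfolding y(2) by (rule boundary_map_real_chain[symmetric])
    moreover have "real_chain y \<in> chains X (Suc k)" using y(1) by (simp add: chains_def)
    ultimately have "real_chain x \<in> boundaries X k" unfolding boundaries_def by blast
    then show ?thesis using proj Fp[OF x] by simp
  qed

  \<comment> \<open>The real extension of \<open>p\<close> is an isomorphism, so the ranks of \<open>A\<close> and of the boundary group agree.\<close>
  have r: "length bs = length es"
  proof (rule antisym)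
    have "frag.independent_list (map p bs)" "set (map p bs) \<subseteq> A"
      using p_ind[OF bsB] ibs bsB p_mem by auto
    then have "length (map p bs) \<le> length (map real_chain es)"
      by (rule independent_length_le[OF _ _ lattice_basis_span(2)[OF es]])
    then show "length bs \<le> length es" by simp
    have "?V = ?F ` span (set (map real_chain bs))"
      using bij unfolding FB bij_betw_def by (simp only:)
    also have "\<dots> = span (?F ` set (map real_chain bs))" by (rule linear_span_image[OF F, symmetric])
    finally have "real_chain ` A \<subseteq> span (set (map ?F (map real_chain bs)))"
      using lattice_basis_span(2)[OF es] unfolding V set_map by (simp only:)
    then have "length es \<le> length (map ?F (map real_chain bs))"
      by (rule independent_length_le[OF ies esA])
    then show "length es \<le> length bs" by simp
  qed

  let ?r = "length es"
  have "\<exists>f. bij_betw f {0..<?r} S" if "S \<subseteq> ?I" "card S = ?r" for S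
    using ex_bij_betw_nat_finite[OF finite_subset[OF that(1) finI]] that(2) by auto
  then obtain e where e: "\<And>S. S \<subseteq> ?I \<Longrightarrow> card S = ?r \<Longrightarrow> bij_betw (e S) {0..<?r} S" by metis
  define cs where "cs S = map (e S) [0..<?r]" for S
  have cs: "distinct (cs S)" "set (cs S) = S" "length (cs S) = ?r" if "S \<subseteq> ?I" "card S = ?r" for S
    using e[OF that] by (auto simp: cs_def distinct_map bij_betw_def)
  define vs where "vs S = map ?\<beta> (cs S)" for S
  have \<beta>B: "?\<beta> a \<in> ?B" if "a \<in> ?I" for a
  proof -
    have "Poly_Mapping.keys (frag_of a) \<subseteq> ?I" using that by simp
    then show ?thesis unfolding BX using boundary_map_frag_of[of X k a] by (metis (mono_tags, lifting) imageI mem_Collect_eq)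
  qed
  have vsB: "set (vs S) \<subseteq> ?B" and vs_len: "length (vs S) = ?r" if "S \<subseteq> ?I" "card S = ?r" for S
    using cs[OF that] \<beta>B that(1) by (auto simp: vs_def)

  let ?\<T> = "{S. S \<subseteq> ?I \<and> card S = ?r \<and> frag.independent_list (vs S)}"
  let ?T = "with_top_cells X (Suc k)"
  have trees: "spanning_trees X d = ?T ` ?\<T>"
  proof
    show "?T ` ?\<T> \<subseteq> spanning_trees X d"
    proof clarify
      fix S assume S: "S \<subseteq> ?I" "card S = ?r" "frag.independent_list (vs S)"
      have "?T (set (cs S)) \<in> spanning_trees X (Suc k)"
        using with_top_cells_spanning_tree_iff[OF bs, of "cs S"] cs[OF S(1,2)] S r by (simp add: vs_def)
      then show "?T S \<in> spanning_trees X d" using cs(2)[OF S(1,2)] d by simp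
    qed
    show "spanning_trees X d \<subseteq> ?T ` ?\<T>"
    proof
      fix T assume T: "T \<in> spanning_trees X d"
      define S where "S = cells T (Suc k)"
      have sub: "subcomplex T X" "\<forall>j<Suc k. cells X j \<subseteq> cells T j"
        using T by (simp_all add: spanning_trees_def d)
      have TS: "T = ?T S"
        unfolding S_def using subcomplex_eq_with_top_cells[OF assms(3)] sub d by simp
      have SI: "S \<subseteq> ?I" using sub(1) by (simp add: S_def subcomplex_def)
      obtain ds where ds: "set ds = S" "distinct ds" using finite_distinct_list[OF finite_subset[OF SI finI]] by blast
      have "length ds = length bs" using with_top_cells_spanning_tree_iff[OF bs ds(2)] ds(1) SI T TS d by simp
      then have c: "card S = ?r" using ds distinct_card r by metis
      then have "frag.independent_list (vs S)"
        using with_top_cells_spanning_tree_iff[OF bs cs(1)[OF SI c]] cs(2)[OF SI c] SI T TS d by (simp add: vs_def)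
      then show "T \<in> ?T ` ?\<T>" using TS SI c by blast
    qed
  qed
  have inj: "inj_on ?T ?\<T>"
  proof (rule inj_onI)
    fix S S' assume "?T S = ?T S'"
    then have "cells (?T S) (Suc k) = cells (?T S') (Suc k)" by simp
    then show "S = S'" by (simp add: cells_with_top_cells)
  qed

  let ?t = "cokernel_order ?B A p" and ?\<theta> = "homology_torsion X d"
  let ?w = "\<lambda>a. exp (- W a)"
  have theta: "?\<theta> = torsion_order (chain_subgroup ?Z Mod ?B)"
    by (simp add: homology_torsion_def cellular_homology_def d)
  have theta_nz: "?\<theta> \<noteq> 0"
    unfolding theta by (rule torsion_order_nonzero[OF zs bs BZ finite_cells ZK])
  have pB: "frag.subspace (p ` C)" if "frag.subspace C" "C \<subseteq> ?B" for C
    unfolding frag.subspace_def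
  proof (intro conjI ballI allI)
    show "0 \<in> p ` C"
      using additive_scale(1)[OF sB p_add frag.subspace_0[OF sB]] frag.subspace_0[OF that(1)] by (metis imageI)
    fix x y assume "x \<in> p ` C" "y \<in> p ` C"
    then obtain u v where uv: "u \<in> C" "v \<in> C" "x = p u" "y = p v" by blast
    have "u \<in> ?B" "v \<in> ?B" using uv(1,2) that(2) by blast+
    then have "x + y = p (u + v)" unfolding uv(3,4) by (rule p_add[symmetric])
    then show "x + y \<in> p ` C" using frag.subspace_add[OF that(1) uv(1,2)] by blast
  next
    fix n x assume "x \<in> p ` C"
    then obtain u where u: "u \<in> C" "x = p u" by blast
    have "p (frag_cmul n u) = frag_cmul n (p u)"
      by (rule additive_scale(2)[OF sB]) (use p_add u(1) that(2) in auto)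
    then show "frag_cmul n x \<in> p ` C"
      using frag.subspace_scale[OF that(1) u(1), of n] u(2) by (metis imageI)
  qed
  have pBA: "p ` ?B \<subseteq> A" using p_mem by blast
  have t: "?t = lattice_index A (p ` ?B)"
    unfolding cokernel_order_def by (rule order_quotient[OF sA(1) pB[OF sB order_refl] pBA])

  \<comment> \<open>The contribution of one tree, obtained by comparing the indices of \<open>p ` ?U \<subseteq> p ` ?B \<subseteq> A\<close>.\<close>
  have weight: "(\<Prod>a\<in>S. ?w a) * Determinant.det (gram (map real_chain (map p (vs S))) (map real_chain (map p (vs S))))
      = gram_det A * (real ?t)\<^sup>2 / (real ?\<theta>)\<^sup>2 * tree_weight W d (?T S)"
    if S: "S \<subseteq> ?I" "card S = ?r" and ind: "frag.independent_list (vs S)" for S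
  proof -
    let ?U = "range (frag.comb (vs S))"
    have U: "lattice_basis ?U (vs S)" using ind by (simp add: lattice_basis_iff)
    have sU: "frag.subspace ?U" by (rule lattice_basis_subspace(1)[OF U])
    have UB: "?U \<subseteq> ?B"
      using sB vsB[OF S] unfolding frag.comb_def by (auto intro!: frag.subspace_sum frag.subspace_scale)
    have nz: "lattice_index ?B ?U \<noteq> 0"
      by (rule lattice_index_nonzero[OF bs _ vsB[OF S] ind]) (simp add: vs_len[OF S] r)
    have thT: "homology_torsion (?T S) d = ?\<theta> * lattice_index ?B ?U"
    proof -
      have "boundaries (?T S) k = ?U"
        unfolding homology_with_top_cells(2)[OF S(1)] vs_def
        using image_list[OF cs(1)[OF S]] cs(2)[OF S] by simp
      then have "homology_torsion (?T S) d = torsion_order (chain_subgroup ?Z Mod ?U)"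
        by (simp add: homology_torsion_def cellular_homology_def d homology_with_top_cells(1)[OF S(1)])
      then show ?thesis
        unfolding theta using torsion_index[OF subspace_cycles sB sU UB BZ nz] by simp
    qed
    have ipu: "frag.independent_list (map p (vs S))" using p_ind[OF vsB[OF S]] ind by blast
    have pU: "range (frag.comb (map p (vs S))) = p ` ?U"
    proof -
      have "frag.comb (map p (vs S)) c = p (frag.comb (vs S) c)" for c
        by (rule additive_comb[symmetric, OF sB _ vsB[OF S]]) (rule p_add)
      then show ?thesis by (simp add: image_image)
    qed
    have "lattice_index A (p ` ?U) = lattice_index A (p ` ?B) * lattice_index (p ` ?B) (p ` ?U)"
      by (rule lattice_index_mult[OF pB[OF sU UB] pB[OF sB order_refl] sA(1) image_mono[OF UB] pBA])
    also have "lattice_index (p ` ?B) (p ` ?U) = lattice_index ?B ?U"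
      by (rule lattice_index_image[OF sB sU UB pB[OF sU UB] p_add p_inj])
    finally have index: "lattice_index A (p ` ?U) = ?t * lattice_index ?B ?U" unfolding t .
    have "Determinant.det (gram (map real_chain (map p (vs S))) (map real_chain (map p (vs S))))
        = (real (lattice_index A (p ` ?U)))\<^sup>2 * gram_det A"
      unfolding mu pU[symmetric]
      by (rule gram_lattice_index[OF es _ _ ipu]) (use vs_len[OF S] vsB[OF S] p_mem in auto)
    also have "\<dots> = (real ?t * real (lattice_index ?B ?U))\<^sup>2 * gram_det A" unfolding index by simp
    also have "\<dots> = gram_det A * (real ?t)\<^sup>2 / (real ?\<theta>)\<^sup>2 * (real (homology_torsion (?T S) d))\<^sup>2"
      unfolding thT using theta_nz by (simp add: power_mult_distrib field_simps)
    finally show ?thesis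
      by (simp add: tree_weight_def cells_with_top_cells d ac_simps)
  qed

  \<comment> \<open>The operator in terms of the incidence chains, and its determinant as a sum over all sets of \<open>?r\<close> cells.\<close>
  have L: "reduced_laplacian X d W A x
      = orthogonal_projection ?V (\<Sum>a\<in>?I. (?w a * chain_inner (real_chain (?\<beta> a)) x) *\<^sub>R real_chain (?\<beta> a))" for x
    unfolding reduced_laplacian_def d weighted_laplacian ..
  have us: "map (\<lambda>j. orthogonal_projection ?V (real_chain (?\<beta> (e S j)))) [0..<?r] = map real_chain (map p (vs S))"
    if S: "S \<subseteq> ?I" "card S = ?r" for S
  proof -
    have "e S j \<in> ?I" if "j < ?r" for j using e[OF S] S(1) that by (auto simp: bij_betw_def)
    then show ?thesis using proj_p \<beta>B by (simp add: vs_def cs_def)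
  qed
  have ind_es: "rv.independent_list (map real_chain es)" using ies real_independent_iff by blast
  have "operator_det ?V (reduced_laplacian X d W A)
      = (\<Sum>S | S \<subseteq> ?I \<and> card S = ?r. (\<Prod>a\<in>S. ?w a) * Determinant.det (gram (map real_chain (map p (vs S))) (map real_chain (map p (vs S)))))"
    using operator_det_laplacian[OF finI ind_es V[symmetric], of "reduced_laplacian X d W A" ?w "\<lambda>a. real_chain (?\<beta> a)" e] L e us
    by simp
  also have "\<dots> = (\<Sum>S\<in>?\<T>. (\<Prod>a\<in>S. ?w a) * Determinant.det (gram (map real_chain (map p (vs S))) (map real_chain (map p (vs S)))))"
  proof (rule sum.mono_neutral_right)
    show "finite {S. S \<subseteq> ?I \<and> card S = ?r}" by (rule finite_subset[OF _ finite_Pow_iff[THEN iffD2, OF finI]]) auto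
    show "\<forall>S\<in>{S. S \<subseteq> ?I \<and> card S = ?r} - ?\<T>.
        (\<Prod>a\<in>S. ?w a) * Determinant.det (gram (map real_chain (map p (vs S))) (map real_chain (map p (vs S)))) = 0"
    proof
      fix S assume "S \<in> {S. S \<subseteq> ?I \<and> card S = ?r} - ?\<T>"
      then have S: "S \<subseteq> ?I" "card S = ?r" "\<not> frag.independent_list (vs S)" by auto
      have "\<not> rv.independent_list (map real_chain (map p (vs S)))"
        using p_ind[OF vsB[OF S(1,2)]] S(3) real_independent_iff by blast
      then have "Determinant.det (gram (map real_chain (map p (vs S))) (map real_chain (map p (vs S)))) = 0"
        using gram_det_nonzero_iff by blast
      then show "(\<Prod>a\<in>S. ?w a) * Determinant.det (gram (map real_chain (map p (vs S))) (map real_chain (map p (vs S)))) = 0"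
        by simp
    qed
  qed auto
  also have "\<dots> = (\<Sum>S\<in>?\<T>. gram_det A * (real ?t)\<^sup>2 / (real ?\<theta>)\<^sup>2 * tree_weight W d (?T S))"
    by (intro sum.cong refl weight) auto
  also have "\<dots> = gram_det A * (real ?t)\<^sup>2 / (real ?\<theta>)\<^sup>2 * (\<Sum>S\<in>?\<T>. tree_weight W d (?T S))"
    by (rule sum_distrib_left[symmetric])
  also have "(\<Sum>S\<in>?\<T>. tree_weight W d (?T S)) = (\<Sum>T\<in>spanning_trees X d. tree_weight W d T)"
    unfolding trees by (simp add: sum.reindex[OF inj])
  finally show ?thesis by (simp add: d)
qed

end
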